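(* Let $\mathbb G=\mathbb W\mathbb V$ be a splitting of a Carnot group by homogeneous complementary subgroups with $\mathbb V\ne\{0\}$ horizontal. Let $A\subset\mathbb W$ and let $\phi:A\to\mathbb V$ be intrinsic Lipschitz. Then there exists an intrinsic Lipschitz extension $\tilde\phi:\mathbb W\to\mathbb V$ of $\phi$. Moreover, $\tilde\phi$ can be chosen in such a way that its intrinsic Lipschitz constant is controlled in terms of the intrinsic Lipschitz constant of $\phi$ (that is, there is a function $u:[0,\infty)\to[0,\infty)$, depending only on $\mathbb G,\mathbb W,\mathbb V,d$, such that the intrinsic Lipschitz constant of $\tilde\phi$ is at most $u(\ell)$ whenever that of $\phi$ is at most $\ell$).
   Context: A Carnot group $\mathbb G$ is a connected, simply connected nilpotent Lie group whose Lie algebra is stratified: $\mathfrak g=\mathfrak g_1\oplus\dots\oplus\mathfrak g_s$, $\mathfrak g_{j+1}=[\mathfrak g_j,\mathfrak g_1]$, $\mathfrak g_s\ne\{0\}$, $[\mathfrak g_s,\mathfrak g]=\{0\}$. Dilations $\delta_\lambda$, $\lambda>0$, are the group automorphisms induced via $\exp$ by $X\mapsto\lambda^jX$ on $\mathfrak g_j$. $d$ is a fixed left-invariant distance on $\mathbb G$ inducing the manifold topology with $d(\delta_\lambda x,\delta_\lambda y)=\lambda d(x,y)$; $\|x\|_{\mathbb G}:=d(0,x)$. Homogeneous complementary subgroups: Lie subgroups $\mathbb W,\mathbb V$ invariant under dilations with $\mathbb W\cap\mathbb V=\{0\}$ and $\mathbb G=\mathbb W\mathbb V$; every $x\in\mathbb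 G$ is uniquely $x=x_{\mathbb W}x_{\mathbb V}$. $\mathbb V$ is horizontal if $\mathbb V\subset\exp(\mathfrak g_1)$. For $A\subset\mathbb W$ and $\phi:A\to\mathbb V$, $\mathrm{gr}_\phi:=\{w\phi(w):w\in A\}$. With $\mathscr C_\alpha:=\{x\in\mathbb G:\|x_{\mathbb W}\|_{\mathbb G}\le\alpha\|x_{\mathbb V}\|_{\mathbb G}\}$, $\phi$ is intrinsic Lipschitz if there is $\alpha>0$ with $\mathrm{gr}_\phi\cap x\mathscr C_\alpha=\{x\}$ for every $x\in\mathrm{gr}_\phi$; its intrinsic Lipschitz constant is the infimum of $1/\alpha$ over all such $\alpha>0$. *)

theory Defs
  imports
    "HOL-Analysis.Analysis"
    "HOL-Algebra.Coset"
    "HOL-Algebra.Generated_Groups"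
    "HOL-Library.Function_Algebras"
begin

section \<open>Smooth manifolds\<close>

text \<open>
  Manifolds are modelled on a linear subspace \<open>S\<close> of a Euclidean space, so that the dimension is
  \<open>dim S\<close> and manifolds of different dimensions (a group and its subgroups) can share one
  model type. \<open>Ck_on k S U f\<close> is meant for \<open>U\<close> open in \<open>S\<close> and says that all iterated
  directional derivatives of \<open>f\<close> along \<open>S\<close> up to order \<open>k\<close> exist and are continuous on \<open>U\<close>.
\<close>

primrec Ck_on ::
  "nat \<Rightarrow> 'e::euclidean_space set \<Rightarrow> 'e set \<Rightarrow> ('e \<Rightarrow> 'f::euclidean_space) \<Rightarrow> bool"
where
  "Ck_on 0 S U f \<longleftrightarrow> continuous_on U f"
| "Ck_on (Suc k) S U f \<longleftrightarrow> continuous_on U f \<and>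
     (\<forall>v\<in>S. \<exists>f'. (\<forall>x\<in>U. ((\<lambda>t::real. f (x + t *\<^sub>R v)) has_vector_derivative f' x) (at 0)) \<and>
                 Ck_on k S U f')"

definition Cinf_on ::
  "'e::euclidean_space set \<Rightarrow> 'e set \<Rightarrow> ('e \<Rightarrow> 'f::euclidean_space) \<Rightarrow> bool"
where
  "Cinf_on S U f \<longleftrightarrow> (\<forall>k. Ck_on k S U f)"

text \<open>A chart is a pair of its domain and its coordinate map.\<close>

type_synonym ('a, 'e) chart = "'a set \<times> ('a \<Rightarrow> 'e)"

definition is_chart :: "'a topology \<Rightarrow> 'e::euclidean_space set \<Rightarrow> ('a, 'e) chart \<Rightarrow> bool" where
  "is_chart M S c \<longleftrightarrow> (case c of (U, \<phi>) \<Rightarrow>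
     openin M U \<and> openin (top_of_set S) (\<phi> ` U) \<and>
     homeomorphic_map (subtopology M U) (top_of_set (\<phi> ` U)) \<phi>)"

definition chart_expr :: "('a, 'e) chart \<Rightarrow> ('b, 'f) chart \<Rightarrow> ('a \<Rightarrow> 'b) \<Rightarrow> 'e \<Rightarrow> 'f" where
  "chart_expr c c' f = snd c' \<circ> f \<circ> inv_into (fst c) (snd c)"

definition chart_dom :: "('a, 'e) chart \<Rightarrow> ('b, 'f) chart \<Rightarrow> ('a \<Rightarrow> 'b) \<Rightarrow> 'e set" where
  "chart_dom c c' f = snd c ` {x \<in> fst c. f x \<in> fst c'}"

locale smooth_manifold =
  fixes M :: "'a topology" and S :: "'e::euclidean_space set" and \<A> :: "('a, 'e) chart set"
  assumes Hausdorff: "Hausdorff_space M"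
    and second_countable: "second_countable M"
    and subspace_model: "subspace S"
    and charts: "c \<in> \<A> \<Longrightarrow> is_chart M S c"
    and cover: "(\<Union>c\<in>\<A>. fst c) = topspace M"
    and compatible: "c \<in> \<A> \<Longrightarrow> c' \<in> \<A> \<Longrightarrow> Cinf_on S (chart_dom c c' id) (chart_expr c c' id)"

definition smooth_map ::
  "'a topology \<Rightarrow> 'e::euclidean_space set \<Rightarrow> ('a, 'e) chart set \<Rightarrow>
   'b topology \<Rightarrow> ('b, 'f::euclidean_space) chart set \<Rightarrow> ('a \<Rightarrow> 'b) \<Rightarrow> bool"
where
  "smooth_map M S \<A> N \<B> f \<longleftrightarrow> continuous_map M N f \<and>
     (\<forall>c\<in>\<A>. \<forall>c'\<in>\<B>. Cinf_on S (chart_dom c c' f) (chart_expr c c' f))"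

definition smooth_immersion ::
  "'a topology \<Rightarrow> 'e::euclidean_space set \<Rightarrow> ('a, 'e) chart set \<Rightarrow>
   'b topology \<Rightarrow> ('b, 'f::euclidean_space) chart set \<Rightarrow> ('a \<Rightarrow> 'b) \<Rightarrow> bool"
where
  "smooth_immersion M S \<A> N \<B> f \<longleftrightarrow> smooth_map M S \<A> N \<B> f \<and>
     (\<forall>c\<in>\<A>. \<forall>c'\<in>\<B>. \<forall>x\<in>chart_dom c c' f. \<forall>v\<in>S - {0}.
        \<not> ((\<lambda>t::real. chart_expr c c' f (x + t *\<^sub>R v)) has_vector_derivative 0) (at 0))"

definition prod_atlas ::
  "('a, 'e) chart set \<Rightarrow> ('b, 'f) chart set \<Rightarrow> ('a \<times> 'b, 'e \<times> 'f) chart set"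
where
  "prod_atlas \<A> \<B> = {(U \<times> U', map_prod \<phi> \<psi>) | U \<phi> U' \<psi>. (U, \<phi>) \<in> \<A> \<and> (U', \<psi>) \<in> \<B>}"

text \<open>
  Smooth functions are normalized to vanish off the manifold, so that equal functions on the
  manifold are equal as HOL functions.
\<close>

definition smooth_functions ::
  "'a topology \<Rightarrow> 'e::euclidean_space set \<Rightarrow> ('a, 'e) chart set \<Rightarrow> ('a \<Rightarrow> real) set"
where
  "smooth_functions M S \<A> =
     {f. smooth_map M S \<A> euclideanreal {(UNIV, id)} f \<and> (\<forall>x. x \<notin> topspace M \<longrightarrow> f x = 0)}"


section \<open>Lie groups\<close>

locale lie_group = group G + smooth_manifold M S \<A>
  for G :: "('a, 'b) monoid_scheme" (structure)
    and M :: "'a topology" and S :: "'e::euclidean_space set" and \<A> :: "('a, 'e) chart set" +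
  assumes topspace_eq: "topspace M = carrier G"
    and smooth_mult:
      "smooth_map (prod_topology M M) (S \<times> S) (prod_atlas \<A> \<A>) M \<A> (\<lambda>(x, y). x \<otimes> y)"
    and smooth_inv: "smooth_map M S \<A> M \<A> (\<lambda>x. inv x)"

text \<open>Lie subgroups are immersed: their topology may be finer than the subspace topology.\<close>

definition lie_subgroup ::
  "'a set \<Rightarrow> ('a, 'b) monoid_scheme \<Rightarrow> 'a topology \<Rightarrow> 'e::euclidean_space set \<Rightarrow>
   ('a, 'e) chart set \<Rightarrow> bool"
where
  "lie_subgroup H G M S \<A> \<longleftrightarrow> subgroup H G \<and>
     (\<exists>M' (S' :: 'e set) \<A>'. lie_group (G\<lparr>carrier := H\<rparr>) M' S' \<A>' \<and>
        smooth_immersion M' S' \<A>' M \<A> id)"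

text \<open>
  Vector fields are derivations of the algebra of smooth functions. Addition, zero and the product
  of functions below are pointwise.
\<close>

type_synonym 'a vfield = "('a \<Rightarrow> real) \<Rightarrow> 'a \<Rightarrow> real"

definition vscale :: "real \<Rightarrow> 'a vfield \<Rightarrow> 'a vfield" where
  "vscale a X = (\<lambda>f x. a * X f x)"

lemma vector_space_vscale: "vector_space vscale"
  by unfold_locales (auto simp: vscale_def fun_eq_iff algebra_simps)

definition lie_bracket :: "'a vfield \<Rightarrow> 'a vfield \<Rightarrow> 'a vfield" where
  "lie_bracket X Y = (\<lambda>f. X (Y f) - Y (X f))"

definition translate :: "('a, 'b) monoid_scheme \<Rightarrow> 'a \<Rightarrow> ('a \<Rightarrow> real) \<Rightarrow> 'a \<Rightarrow> real" where
  "translate G g f = (\<lambda>x. if x \<in> carrier G then f (g \<otimes>\<^bsub>G\<^esub> x) else 0)"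

text \<open>
  The Lie algebra of left-invariant vector fields. A field is normalized to be zero on arguments
  that are not smooth functions.
\<close>

definition lie_algebra ::
  "('a, 'b) monoid_scheme \<Rightarrow> 'a topology \<Rightarrow> 'e::euclidean_space set \<Rightarrow> ('a, 'e) chart set \<Rightarrow>
   'a vfield set"
where
  "lie_algebra G M S \<A> = (let F = smooth_functions M S \<A> in
     {X. (\<forall>f\<in>F. X f \<in> F) \<and> (\<forall>f. f \<notin> F \<longrightarrow> X f = 0) \<and>
         (\<forall>f\<in>F. \<forall>g\<in>F. X (f + g) = X f + X g) \<and>
         (\<forall>a. \<forall>f\<in>F. X (\<lambda>x. a * f x) = (\<lambda>x. a * X f x)) \<and>
         (\<forall>f\<in>F. \<forall>g\<in>F. X (f * g) = X f * g + f * X g) \<and>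
         (\<forall>g\<in>carrier G. \<forall>f\<in>F. X (translate G g f) = translate G g (X f))})"

text \<open>
  \<open>E\<close> is the exponential map: \<open>t \<mapsto> E (t X)\<close> is the one-parameter subgroup that is an
  integral curve of \<open>X\<close>. This determines \<open>E\<close> uniquely on the Lie algebra; such a map exists on
  every Lie group.
\<close>

definition is_exponential ::
  "('a, 'b) monoid_scheme \<Rightarrow> 'a topology \<Rightarrow> 'e::euclidean_space set \<Rightarrow> ('a, 'e) chart set \<Rightarrow>
   ('a vfield \<Rightarrow> 'a) \<Rightarrow> bool"
where
  "is_exponential G M S \<A> E \<longleftrightarrow> (\<forall>X\<in>lie_algebra G M S \<A>.
     (\<forall>t. E (vscale t X) \<in> carrier G) \<and>
     (\<forall>t u. E (vscale (t + u) X) = E (vscale t X) \<otimes>\<^bsub>G\<^esub> E (vscale u X)) \<and>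
     (\<forall>f\<in>smooth_functions M S \<A>. \<forall>t.
        ((\<lambda>t. f (E (vscale t X))) has_real_derivative X f (E (vscale t X))) (at t)))"


section \<open>Carnot groups\<close>

fun lower_central :: "('a, 'b) monoid_scheme \<Rightarrow> nat \<Rightarrow> 'a set" where
  "lower_central G 0 = carrier G"
| "lower_central G (Suc n) = generate G
     {x \<otimes>\<^bsub>G\<^esub> y \<otimes>\<^bsub>G\<^esub> inv\<^bsub>G\<^esub> x \<otimes>\<^bsub>G\<^esub> inv\<^bsub>G\<^esub> y | x y. x \<in> carrier G \<and> y \<in> lower_central G n}"

definition nilpotent_group :: "('a, 'b) monoid_scheme \<Rightarrow> bool" where
  "nilpotent_group G \<longleftrightarrow> group G \<and> (\<exists>n. lower_central G n = {\<one>\<^bsub>G\<^esub>})"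

text \<open>
  The analogue for abstract topologies of \<^const>\<open>simply_connected\<close>: any two loops are freely
  homotopic (in particular the space is path connected).
\<close>

definition simply_connected_space :: "'a topology \<Rightarrow> bool" where
  "simply_connected_space M \<longleftrightarrow>
     (\<forall>p q. pathin M p \<and> p 1 = p 0 \<and> pathin M q \<and> q 1 = q 0 \<longrightarrow>
        homotopic_with (\<lambda>r. r 1 = r 0) (top_of_set {0..1}) M p q)"

text \<open>
  \<open>\<gg> 1, \<dots>, \<gg> s\<close> are the layers; the values of \<open>\<gg>\<close> at other indices play no role.
\<close>

definition stratification ::
  "('a, 'b) monoid_scheme \<Rightarrow> 'a topology \<Rightarrow> 'e::euclidean_space set \<Rightarrow> ('a, 'e) chart set \<Rightarrow>
   nat \<Rightarrow> (nat \<Rightarrow> 'a vfield set) \<Rightarrow> bool"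
where
  "stratification G M S \<A> s \<gg> \<longleftrightarrow> 1 \<le> s \<and>
     (\<forall>j\<in>{1..s}. module.subspace vscale (\<gg> j)) \<and>
     lie_algebra G M S \<A> = {\<Sum>j=1..s. X j | X. \<forall>j\<in>{1..s}. X j \<in> \<gg> j} \<and>
     (\<forall>X. (\<forall>j\<in>{1..s}. X j \<in> \<gg> j) \<and> (\<Sum>j=1..s. X j) = 0 \<longrightarrow> (\<forall>j\<in>{1..s}. X j = 0)) \<and>
     (\<forall>j\<in>{1..<s}. \<gg> (Suc j) =
        module.span vscale {lie_bracket X Y | X Y. X \<in> \<gg> j \<and> Y \<in> \<gg> 1}) \<and>
     \<gg> s \<noteq> {0} \<and>
     (\<forall>X\<in>\<gg> s. \<forall>Y\<in>lie_algebra G M S \<A>. lie_bracket X Y = 0)"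

text \<open>
  The dilations are the group automorphisms that the exponential map induces from the maps
  acting on \<open>\<gg> j\<close> as multiplication by \<open>\<lambda> ^ j\<close>. As the exponential map of a simply connected
  nilpotent group is bijective, they exist and are uniquely determined.
\<close>

definition is_dilations ::
  "('a, 'b) monoid_scheme \<Rightarrow> ('a vfield \<Rightarrow> 'a) \<Rightarrow> nat \<Rightarrow> (nat \<Rightarrow> 'a vfield set) \<Rightarrow>
   (real \<Rightarrow> 'a \<Rightarrow> 'a) \<Rightarrow> bool"
where
  "is_dilations G E s \<gg> \<delta> \<longleftrightarrow> (\<forall>r>0. \<delta> r \<in> iso G G \<and>
     (\<forall>X. (\<forall>j\<in>{1..s}. X j \<in> \<gg> j) \<longrightarrow>
        \<delta> r (E (\<Sum>j=1..s. X j)) = E (\<Sum>j=1..s. vscale (r ^ j) (X j))))"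

locale carnot_group = lie_group G M S \<A>
  for G :: "('a, 'b) monoid_scheme" (structure)
    and M :: "'a topology" and S :: "'e::euclidean_space set" and \<A> :: "('a, 'e) chart set" +
  fixes E :: "'a vfield \<Rightarrow> 'a"
    and s :: nat and \<gg> :: "nat \<Rightarrow> 'a vfield set" and \<delta> :: "real \<Rightarrow> 'a \<Rightarrow> 'a"
  assumes connected: "connected_space M"
    and simply_connected: "simply_connected_space M"
    and nilpotent: "nilpotent_group G"
    and exponential: "is_exponential G M S \<A> E"
    and stratified: "stratification G M S \<A> s \<gg>"
    and dilations: "is_dilations G E s \<gg> \<delta>"

definition homogeneous_distance ::
  "('a, 'b) monoid_scheme \<Rightarrow> 'a topology \<Rightarrow> (real \<Rightarrow> 'a \<Rightarrow> 'a) \<Rightarrow> ('a \<Rightarrow> 'a \<Rightarrow> real) \<Rightarrow> bool"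
where
  "homogeneous_distance G M \<delta> d \<longleftrightarrow> Metric_space (carrier G) d \<and>
     Metric_space.mtopology (carrier G) d = M \<and>
     (\<forall>g\<in>carrier G. \<forall>x\<in>carrier G. \<forall>y\<in>carrier G. d (g \<otimes>\<^bsub>G\<^esub> x) (g \<otimes>\<^bsub>G\<^esub> y) = d x y) \<and>
     (\<forall>r>0. \<forall>x\<in>carrier G. \<forall>y\<in>carrier G. d (\<delta> r x) (\<delta> r y) = r * d x y)"

definition homogeneous_subgroup ::
  "'a set \<Rightarrow> ('a, 'b) monoid_scheme \<Rightarrow> 'a topology \<Rightarrow> 'e::euclidean_space set \<Rightarrow>
   ('a, 'e) chart set \<Rightarrow> (real \<Rightarrow> 'a \<Rightarrow> 'a) \<Rightarrow> bool"
where
  "homogeneous_subgroup H G M S \<A> \<delta> \<longleftrightarrow>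
     lie_subgroup H G M S \<A> \<and> (\<forall>r>0. \<delta> r ` H \<subseteq> H)"

definition homogeneous_splitting ::
  "('a, 'b) monoid_scheme \<Rightarrow> 'a topology \<Rightarrow> 'e::euclidean_space set \<Rightarrow>
   ('a, 'e) chart set \<Rightarrow> (real \<Rightarrow> 'a \<Rightarrow> 'a) \<Rightarrow> 'a set \<Rightarrow> 'a set \<Rightarrow> bool"
where
  "homogeneous_splitting G M S \<A> \<delta> W V \<longleftrightarrow>
     homogeneous_subgroup W G M S \<A> \<delta> \<and> homogeneous_subgroup V G M S \<A> \<delta> \<and>
     W \<inter> V = {\<one>\<^bsub>G\<^esub>} \<and> carrier G = W <#>\<^bsub>G\<^esub> V"


section \<open>Intrinsic Lipschitz maps\<close>

definition hnorm :: "('a, 'b) monoid_scheme \<Rightarrow> ('a \<Rightarrow> 'a \<Rightarrow> real) \<Rightarrow> 'a \<Rightarrow> real" where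
  "hnorm G d x = d \<one>\<^bsub>G\<^esub> x"

definition left_part :: "('a, 'b) monoid_scheme \<Rightarrow> 'a set \<Rightarrow> 'a set \<Rightarrow> 'a \<Rightarrow> 'a" where
  "left_part G W V x = (THE w. w \<in> W \<and> (\<exists>v\<in>V. x = w \<otimes>\<^bsub>G\<^esub> v))"

definition right_part :: "('a, 'b) monoid_scheme \<Rightarrow> 'a set \<Rightarrow> 'a set \<Rightarrow> 'a \<Rightarrow> 'a" where
  "right_part G W V x = (THE v. v \<in> V \<and> (\<exists>w\<in>W. x = w \<otimes>\<^bsub>G\<^esub> v))"

definition intrinsic_graph :: "('a, 'b) monoid_scheme \<Rightarrow> 'a set \<Rightarrow> ('a \<Rightarrow> 'a) \<Rightarrow> 'a set" where
  "intrinsic_graph G A \<phi> = {w \<otimes>\<^bsub>G\<^esub> \<phi> w | w. w \<in> A}"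

definition intrinsic_cone ::
  "('a, 'b) monoid_scheme \<Rightarrow> 'a set \<Rightarrow> 'a set \<Rightarrow> ('a \<Rightarrow> 'a \<Rightarrow> real) \<Rightarrow> real \<Rightarrow> 'a set"
where
  "intrinsic_cone G W V d \<alpha> =
     {x \<in> carrier G. hnorm G d (left_part G W V x) \<le> \<alpha> * hnorm G d (right_part G W V x)}"

definition cone_property ::
  "('a, 'b) monoid_scheme \<Rightarrow> 'a set \<Rightarrow> 'a set \<Rightarrow> ('a \<Rightarrow> 'a \<Rightarrow> real) \<Rightarrow>
   'a set \<Rightarrow> ('a \<Rightarrow> 'a) \<Rightarrow> real \<Rightarrow> bool"
where
  "cone_property G W V d A \<phi> \<alpha> \<longleftrightarrow> (\<forall>x\<in>intrinsic_graph G A \<phi>.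
     intrinsic_graph G A \<phi> \<inter> (x <#\<^bsub>G\<^esub> intrinsic_cone G W V d \<alpha>) = {x})"

definition intrinsic_lipschitz ::
  "('a, 'b) monoid_scheme \<Rightarrow> 'a set \<Rightarrow> 'a set \<Rightarrow> ('a \<Rightarrow> 'a \<Rightarrow> real) \<Rightarrow>
   'a set \<Rightarrow> ('a \<Rightarrow> 'a) \<Rightarrow> bool"
where
  "intrinsic_lipschitz G W V d A \<phi> \<longleftrightarrow> (\<exists>\<alpha>>0. cone_property G W V d A \<phi> \<alpha>)"

definition intrinsic_lipschitz_const ::
  "('a, 'b) monoid_scheme \<Rightarrow> 'a set \<Rightarrow> 'a set \<Rightarrow> ('a \<Rightarrow> 'a \<Rightarrow> real) \<Rightarrow>
   'a set \<Rightarrow> ('a \<Rightarrow> 'a) \<Rightarrow> real"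
where
  "intrinsic_lipschitz_const G W V d A \<phi> =
     Inf {1 / \<alpha> | \<alpha>. \<alpha> > 0 \<and> cone_property G W V d A \<phi> \<alpha>}"

end

theory Submission
  imports Defs
begin

text \<open>
  As \<open>V\<close> is horizontal, \<open>W\<close> is normal, and the projection \<open>\<rho>\<close> from \<open>G\<close> onto \<open>V\<close>, which is a
  finite-dimensional vector space, is a homomorphism. Consider the left-invariant pseudo-distance
  on \<open>G\<close> for which moving along \<open>V\<close> is cheap and all other moves are expensive. If the cost of
  the latter is large enough, then two points whose distance is smaller than the norm of the
  difference of their values under \<open>\<rho>\<close> are in a narrow cone with axis \<open>V\<close>. So \<open>\<rho>\<close> is 1-Lipschitz
  on an intrinsic Lipschitz graph; let \<open>H\<close> be a McShane extension of this restriction. Since \<open>H\<close>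
  is a contraction along the cosets of \<open>V\<close>, each coset contains exactly one point with
  \<open>H = \<rho>\<close>, and these points form the graph of the extension.

  Only first-order information on the Lie group is needed: near the identity, multiplication is
  addition in a chart up to small relative errors.
\<close>

text \<open>Two measures of smallness compete. \<open>nrm\<close> scales under dilations, but along
  products only a growing upper bound is available. The chart \<open>\<kappa>\<close> is nearly
  additive near the identity, but there it is linearly bounded by \<open>nrm\<close>, while the
  reverse control is only qualitative. So long products are estimated in \<open>\<kappa>\<close>,
  where every new factor makes an error relative to its own size, and smallness of
  \<open>nrm\<close> is regained from \<open>nrm_small\<close> after each factor. The factors that
  occur are conjugates of small elements by bounded elements of \<open>V\<close>; horizontality
  keeps the inflation by such conjugations bounded. One such estimate serves both the normality of
  \<open>W\<close> and the cone property of cheap paths.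

  The McShane extension of a vector-valued map loses the dimension as a factor. Hence the price
  \<open>\<eta>\<close> of moves along \<open>V\<close> is fixed first, low enough to leave a
  contraction by 1/2, and the price \<open>N\<close> of other moves is chosen afterwards from
  \<open>\<eta>\<close> and \<alpha>. No other property of \<phi> enters, which is why the constant
  of the extension is uniform.\<close>

section \<open>Charts at the identity\<close>

text \<open>\<open>Ck_on\<close> only supplies one continuous derivative per direction, so
  \<open>v\<close> is split along an orthonormal basis of \<open>L\<close> and the mean value
  inequality is applied on each leg. Keeping \<open>L\<close> apart from \<open>T\<close> allows
  varying a single factor of a product space: the error is then relative to that increment
  alone.\<close>

lemma Ck_on_1_uniform:
  fixes f :: "'x::euclidean_space \<Rightarrow> 'y::euclidean_space"
  assumes C1: "Ck_on 1 T D f" and T: "subspace T" and L: "subspace L" "L \<subseteq> T"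
    and D: "0 < \<rho>" "\<And>x. x \<in> T \<Longrightarrow> norm (x - p) < \<rho> \<Longrightarrow> x \<in> D" and p: "p \<in> T"
    and A: "bounded_linear A"
    and dA: "\<And>v. v \<in> L \<Longrightarrow> ((\<lambda>t::real. f (p + t *\<^sub>R v)) has_vector_derivative A v) (at 0)"
    and e: "0 < e"
  shows "\<exists>\<tau>>0. \<forall>x\<in>T. \<forall>v\<in>L. norm (x - p) < \<tau> \<longrightarrow> norm v < \<tau> \<longrightarrow>
           norm (f (x + v) - f x - A v) \<le> e * norm v"
proof -
  interpret A: bounded_linear A by fact
  obtain B where B: "B \<subseteq> L" "pairwise orthogonal B" "\<And>x. x \<in> B \<Longrightarrow> norm x = 1"
      "independent B" "span B = L"
    using orthonormal_basis_subspace[OF L(1)] by metis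
  have fB: "finite B" using B(4) independent_imp_finite by blast
  \<comment> \<open>The extra 1 keeps \<open>k\<close> positive when \<open>L\<close> is
    trivial.\<close>
  define k where "k = real (card B) + 1"
  have k: "k \<ge> 1" by (simp add: k_def)
  have "\<exists>\<tau>>0. \<forall>y\<in>T. norm (y - p) < \<tau> \<longrightarrow> y \<in> D \<and>
          (\<exists>z. ((\<lambda>t::real. f (y + t *\<^sub>R b)) has_vector_derivative z) (at 0) \<and> norm (z - A b) < e / k)"
    if b: "b \<in> B" for b
  proof -
    have bL: "b \<in> L" "b \<in> T" using b B(1) L(2) by auto
    obtain f' where f': "\<And>x. x \<in> D \<Longrightarrow> ((\<lambda>t::real. f (x + t *\<^sub>R b)) has_vector_derivative f' x) (at 0)"
      and cf: "continuous_on D f'"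
      using C1 bL unfolding One_nat_def Ck_on.simps by blast
    have pD: "p \<in> D" using D p by auto
    have fp: "f' p = A b"
      using vector_derivative_unique_at[OF f'[OF pD] dA[OF bL(1)]] .
    obtain \<tau> where \<tau>: "\<tau> > 0" "\<And>y. y \<in> D \<Longrightarrow> dist y p < \<tau> \<Longrightarrow> dist (f' y) (f' p) < e / k"
      using cf pD e k unfolding continuous_on_iff by (metis divide_pos_pos less_le_trans zero_less_one)
    show ?thesis
      apply (rule exI[of _ "min \<tau> \<rho>"])
      using \<tau> D f' fp by (auto simp: dist_norm)
  qed
  then obtain \<tau>' where \<tau>': "\<And>b. b \<in> B \<Longrightarrow> \<tau>' b > (0::real)"
     "\<And>b y. b \<in> B \<Longrightarrow> y \<in> T \<Longrightarrow> norm (y - p) < \<tau>' b \<Longrightarrow> y \<in> D \<and>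
          (\<exists>z. ((\<lambda>t::real. f (y + t *\<^sub>R b)) has_vector_derivative z) (at 0) \<and> norm (z - A b) < e / k)"
    by metis
  define \<tau>0 where "\<tau>0 = Min (insert \<rho> (\<tau>' ` B))"
  have \<tau>0: "\<tau>0 > 0" "\<And>b. b \<in> B \<Longrightarrow> \<tau>0 \<le> \<tau>' b"
    using fB D(1) \<tau>'(1) by (auto simp: \<tau>0_def)
  \<comment> \<open>All legs of the polygonal path from \<open>x\<close> to \<open>x + v\<close>
    stay within \<open>\<tau> + k * \<tau> = \<tau>0\<close> of \<open>p\<close>.\<close>
  define \<tau> where "\<tau> = \<tau>0 / (1 + k)"
  have \<tau>: "\<tau> > 0" using \<tau>0 k by (simp add: \<tau>_def)
  have main: "norm (f (x + v) - f x - A v) \<le> e * norm v"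
    if x: "x \<in> T" "norm (x - p) < \<tau>" and v: "v \<in> L" "norm v < \<tau>" for x v
  proof -
    have vb: "\<bar>v \<bullet> b\<bar> \<le> norm v" if "b \<in> B" for b
      using Cauchy_Schwarz_ineq2[of v b] B(3)[OF that] by simp
    have vsum: "v = (\<Sum>b\<in>B. (v \<bullet> b) *\<^sub>R b)"
    proof (rule vector_eq_dot_span)
      fix i assume i: "i \<in> B"
      have "(\<Sum>b\<in>B. (v \<bullet> b) *\<^sub>R b) \<bullet> i = (\<Sum>b\<in>B. if b = i then v \<bullet> i else 0)"
        unfolding inner_sum_left
        by (rule sum.cong) (use B i in \<open>auto simp: pairwise_def orthogonal_def norm_eq_1\<close>)
      then show "i \<bullet> v = i \<bullet> (\<Sum>b\<in>B. (v \<bullet> b) *\<^sub>R b)"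
        using fB i by (simp add: inner_commute)
    qed (use v B in \<open>auto intro: span_sum span_scale span_base\<close>)
    have "norm (f (x + (\<Sum>b\<in>B'. (v \<bullet> b) *\<^sub>R b)) - f x - A (\<Sum>b\<in>B'. (v \<bullet> b) *\<^sub>R b))
        \<le> real (card B') * (e / k * norm v)" if B': "B' \<subseteq> B" for B'
      using finite_subset[OF B' fB] B'
    proof (induction B' rule: finite_induct)
      case empty
      then show ?case by (simp add: A.zero)
    next
      case (insert b B')
      let ?s = "\<Sum>b\<in>B'. (v \<bullet> b) *\<^sub>R b"
      let ?c = "v \<bullet> b"
      have b: "b \<in> B" using insert by auto
      have bT: "b \<in> T" using b B(1) L(2) by auto
      have sT: "?s \<in> T"
        using insert B(1) L(2) by (intro subspace_sum[OF T] subspace_scale[OF T]) auto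
      have cB: "real (card B') + 1 \<le> k"
        using card_mono[OF fB, of B'] insert.prems by (simp add: k_def)
      have ns: "norm ?s \<le> real (card B') * norm v"
      proof -
        have "norm ?s \<le> (\<Sum>b\<in>B'. norm ((v \<bullet> b) *\<^sub>R b))" by (rule norm_sum)
        also have "\<dots> \<le> (\<Sum>b\<in>B'. norm v)"
          using insert.prems B(3) vb by (intro sum_mono) auto
        finally show ?thesis by simp
      qed
      have near: "norm (x + ?s + t *\<^sub>R b - p) < \<tau>' b" if t: "\<bar>t\<bar> \<le> \<bar>?c\<bar>" for t
      proof -
        have "norm (x + ?s + t *\<^sub>R b - p) \<le> norm (x - p) + norm ?s + norm (t *\<^sub>R b)"
          using norm_triangle_ineq[of "x - p + ?s" "t *\<^sub>R b"] norm_triangle_ineq[of "x - p" ?s]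
          by (simp add: algebra_simps)
        also have "\<dots> \<le> norm (x - p) + real (card B') * norm v + norm v"
          using ns t vb[OF b] B(3)[OF b] by simp
        also have "\<dots> = norm (x - p) + (real (card B') + 1) * norm v"
          by (simp add: algebra_simps)
        also have "\<dots> \<le> norm (x - p) + k * norm v"
          using cB by (intro add_left_mono mult_right_mono) auto
        also have "\<dots> < \<tau> + k * \<tau>"
          using x(2) v(2) k by (intro add_strict_mono mult_strict_left_mono) auto
        also have "\<dots> = \<tau> * (1 + k)" by (simp add: algebra_simps)
        also have "\<dots> = \<tau>0" using k by (simp add: \<tau>_def)
        finally show ?thesis using \<tau>0(2)[OF b] by linarith
      qed
      have inT: "x + ?s + t *\<^sub>R b \<in> T" for t
        using x(1) sT bT by (intro subspace_add[OF T] subspace_scale[OF T]) auto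
      \<comment> \<open>With the linear part removed, the error of this leg is the increment of
        \<open>h\<close>, whose derivative is bounded by \<open>e / k\<close>.\<close>
      define h where "h = (\<lambda>t. f (x + ?s + t *\<^sub>R b) - t *\<^sub>R A b)"
      have "\<exists>z. (h has_vector_derivative z) (at t) \<and> norm z \<le> e / k" if t: "\<bar>t\<bar> \<le> \<bar>?c\<bar>" for t
      proof -
        obtain z where z: "((\<lambda>r::real. f (x + ?s + t *\<^sub>R b + r *\<^sub>R b)) has_vector_derivative z) (at 0)"
            "norm (z - A b) < e / k"
          using \<tau>'(2)[OF b inT near[OF t]] by blast
        have "((\<lambda>r. f (x + ?s + t *\<^sub>R b + (r - t) *\<^sub>R b)) has_vector_derivative z) (at t)"
        proof -
          have "((\<lambda>r. r - t) has_vector_derivative 1) (at t)"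
            by (auto intro!: derivative_eq_intros)
          from vector_diff_chain_at[OF this, of "\<lambda>r. f (x + ?s + t *\<^sub>R b + r *\<^sub>R b)" z] z(1)
          show ?thesis by (simp add: o_def)
        qed
        then have "((\<lambda>r. f (x + ?s + r *\<^sub>R b)) has_vector_derivative z) (at t)"
          by (simp add: algebra_simps)
        then have "(h has_vector_derivative (z - A b)) (at t)"
          unfolding h_def by (auto intro!: derivative_eq_intros)
        then show ?thesis using z(2) by auto
      qed
      then obtain h' where h': "\<And>t. \<bar>t\<bar> \<le> \<bar>?c\<bar> \<Longrightarrow> (h has_vector_derivative h' t) (at t)"
          "\<And>t. \<bar>t\<bar> \<le> \<bar>?c\<bar> \<Longrightarrow> norm (h' t) \<le> e / k" by metis
      have seg: "\<bar>t\<bar> \<le> \<bar>?c\<bar>" if "t \<in> closed_segment 0 ?c" for t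
        using that by (auto simp: closed_segment_eq_real_ivl split: if_splits)
      have "norm (h ?c - h 0) \<le> e / k * norm (?c - 0)"
        by (rule differentiable_bound[of "closed_segment 0 ?c" h "\<lambda>t r. r *\<^sub>R h' t"])
          (use h' seg in \<open>auto simp: has_vector_derivative_def has_derivative_at_withinI
              mult.commute[of "e / k"] simp del: times_divide_eq_left times_divide_eq_right
              intro!: onorm_le mult_left_mono\<close>)
      also have "\<dots> \<le> e / k * norm v"
        using vb[OF b] e k by (intro mult_left_mono) auto
      finally have step: "norm (h ?c - h 0) \<le> e / k * norm v" .
      have eq: "f (x + (\<Sum>b\<in>insert b B'. (v \<bullet> b) *\<^sub>R b)) - f x - A (\<Sum>b\<in>insert b B'. (v \<bullet> b) *\<^sub>R b)
          = (f (x + ?s) - f x - A ?s) + (h ?c - h 0)"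
        using insert.hyps by (simp add: h_def A.add A.scaleR algebra_simps)
      show ?case
      proof -
        have "norm (f (x + ?s) - f x - A ?s) \<le> real (card B') * (e / k * norm v)"
          using insert by auto
        then have "norm (f (x + ?s) - f x - A ?s + (h ?c - h 0)) \<le> real (card B') * (e / k * norm v) + e / k * norm v"
          using step by (intro norm_triangle_le) linarith
        also have "\<dots> = real (card (insert b B')) * (e / k * norm v)"
          using insert.hyps by (simp add: algebra_simps add_divide_distrib)
        finally show ?thesis unfolding eq .
      qed
    qed
    from this[of B] have "norm (f (x + v) - f x - A v) \<le> real (card B) * (e / k * norm v)"
      using vsum by simp
    also have "\<dots> \<le> k * (e / k * norm v)"
      using e k by (intro mult_right_mono) (auto simp: k_def)
    finally show ?thesis using k by simp
  qed
  show ?thesis using \<tau> main by blast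
qed

section \<open>Normed groups with a chart in which multiplication is nearly addition\<close>

locale normed_group = group G for G (structure) +
  fixes nrm :: "'a \<Rightarrow> real"
  assumes nrm_nonneg: "x \<in> carrier G \<Longrightarrow> 0 \<le> nrm x"
    and nrm_eq_0: "x \<in> carrier G \<Longrightarrow> nrm x = 0 \<longleftrightarrow> x = \<one>"
    and nrm_mult: "x \<in> carrier G \<Longrightarrow> y \<in> carrier G \<Longrightarrow> nrm (x \<otimes> y) \<le> nrm x + nrm y"
    and nrm_inv: "x \<in> carrier G \<Longrightarrow> nrm (inv x) = nrm x"
begin

lemma nrm_one [simp]: "nrm \<one> = 0"
  using nrm_eq_0[of \<one>] by simp

lemma nrm_pow: "x \<in> carrier G \<Longrightarrow> nrm (x [^] (n::nat)) \<le> real n * nrm x"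
proof (induction n)
  case (Suc n)
  then show ?case using nrm_mult[of "x [^] n" x] by (simp add: algebra_simps)
qed simp

lemma nrm_conj:
  assumes "x \<in> carrier G" "y \<in> carrier G"
  shows "nrm (x \<otimes> y \<otimes> inv x) \<le> 2 * nrm x + nrm y"
  using nrm_mult[of "x \<otimes> y" "inv x"] nrm_mult[of x y] nrm_inv[of x] assms by simp

end

text \<open>
  \<open>\<kappa>\<close> is a chart that vanishes at the identity and whose domain contains the ball of radius \<open>R\<close>;
  its values outside that ball are irrelevant.
\<close>

locale chart_group = normed_group G nrm for G (structure) and nrm +
  fixes \<kappa> :: "'a \<Rightarrow> 'e::euclidean_space" and R :: real
  assumes R_pos: "0 < R"
    and nrm_small: "0 < e \<Longrightarrow> \<exists>t>0. \<forall>x\<in>carrier G. nrm x < R \<longrightarrow> norm (\<kappa> x) < t \<longrightarrow> nrm x < e"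
    and chart_small: "0 < e \<Longrightarrow> \<exists>r>0. \<forall>x\<in>carrier G. nrm x < r \<longrightarrow> norm (\<kappa> x) < e"
    and chart_mult: "0 < e \<Longrightarrow> \<exists>r>0. \<forall>x\<in>carrier G. \<forall>y\<in>carrier G. nrm x < r \<longrightarrow> nrm y < r \<longrightarrow>
      norm (\<kappa> (x \<otimes> y) - \<kappa> x - \<kappa> y) \<le> e * norm (\<kappa> y) \<and>
      norm (\<kappa> (x \<otimes> y) - \<kappa> x - \<kappa> y) \<le> e * norm (\<kappa> x)"
begin

definition good :: "real \<Rightarrow> real \<Rightarrow> bool" where
  "good e r \<longleftrightarrow> 0 < r \<and> r \<le> R \<and> (\<forall>x\<in>carrier G. \<forall>y\<in>carrier G. nrm x < r \<longrightarrow> nrm y < r \<longrightarrow>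
      norm (\<kappa> (x \<otimes> y) - \<kappa> x - \<kappa> y) \<le> e * norm (\<kappa> y) \<and>
      norm (\<kappa> (x \<otimes> y) - \<kappa> x - \<kappa> y) \<le> e * norm (\<kappa> x))"

lemma ex_good: assumes "0 < e" shows "\<exists>r. good e r"
proof -
  obtain r where "r > 0" "\<forall>x\<in>carrier G. \<forall>y\<in>carrier G. nrm x < r \<longrightarrow> nrm y < r \<longrightarrow>
      norm (\<kappa> (x \<otimes> y) - \<kappa> x - \<kappa> y) \<le> e * norm (\<kappa> y) \<and>
      norm (\<kappa> (x \<otimes> y) - \<kappa> x - \<kappa> y) \<le> e * norm (\<kappa> x)" using chart_mult[OF assms] by blast
  then show ?thesis using R_pos by (intro exI[of _ "min r R"]) (auto simp: good_def)
qed

lemma good_pos: "good e r \<Longrightarrow> 0 < r"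
  by (simp add: good_def)

lemma good_mult:
  assumes "good e r" "x \<in> carrier G" "y \<in> carrier G" "nrm x < r" "nrm y < r"
  shows "norm (\<kappa> (x \<otimes> y) - \<kappa> x - \<kappa> y) \<le> e * norm (\<kappa> y)"
    and "norm (\<kappa> (x \<otimes> y) - \<kappa> x - \<kappa> y) \<le> e * norm (\<kappa> x)"
  using assms by (auto simp: good_def)

text \<open>Each further factor \<open>x\<close> makes an error relative to
  \<open>\<kappa> x\<close> and not to the power reached so far, so the errors add up instead of
  compounding.\<close>

lemma chart_pow:
  assumes "good e r" "x \<in> carrier G" "\<And>j. j < n \<Longrightarrow> nrm (x [^] j) < r" "nrm x < r"
  shows "norm (\<kappa> (x [^] n) - real n *\<^sub>R \<kappa> x) \<le> real n * e * norm (\<kappa> x)"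
  using assms(3)
proof (induction n)
  case 0
  \<comment> \<open>For \<open>n = 0\<close> the claim is \<open>\<kappa> \<one> = 0\<close>: the
    product estimate for \<open>\<one> \<otimes> \<one>\<close> bounds
    \<open>norm (\<kappa> \<one>)\<close> by half of itself.\<close>
  obtain r' where r': "good (1/2) r'" using ex_good[of "1/2"] by auto
  have "norm (\<kappa> (\<one> \<otimes> \<one>) - \<kappa> \<one> - \<kappa> \<one>) \<le> 1/2 * norm (\<kappa> \<one>)"
    using good_mult[OF r', of \<one> \<one>] good_pos[OF r'] by simp
  then show ?case by simp
next
  case (Suc n)
  have "norm (\<kappa> (x [^] n \<otimes> x) - \<kappa> (x [^] n) - \<kappa> x) \<le> e * norm (\<kappa> x)"
    using assms Suc.prems[of n] by (intro good_mult(1)) auto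
  moreover have "norm (\<kappa> (x [^] n) - real n *\<^sub>R \<kappa> x) \<le> real n * e * norm (\<kappa> x)"
    using Suc by auto
  ultimately have "norm ((\<kappa> (x [^] n \<otimes> x) - \<kappa> (x [^] n) - \<kappa> x) + (\<kappa> (x [^] n) - real n *\<^sub>R \<kappa> x))
      \<le> e * norm (\<kappa> x) + real n * e * norm (\<kappa> x)"
    by (rule norm_triangle_mono)
  then show ?case using assms(2) by (simp add: algebra_simps)
qed

lemma chart_one [simp]: "\<kappa> \<one> = 0"
proof -
  obtain r where r: "good 1 r" using ex_good[of 1] by auto
  show ?thesis using chart_pow[OF r, of \<one> 0] good_pos[OF r] by simp
qed

text \<open>
  If \<open>nrm b\<close> were much smaller than \<open>\<kappa> b\<close>, then the powers of \<open>b\<close> would leave every chart ball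
  before they leave a ball of \<open>nrm\<close>.
\<close>

lemma chart_le_nrm: "\<exists>C>0. \<exists>r>0. \<forall>b\<in>carrier G. nrm b < r \<longrightarrow> norm (\<kappa> b) \<le> C * nrm b"
proof -
  obtain r1 where r1: "good (1/2) r1" using ex_good[of "1/2"] by auto
  obtain r2 where r2: "r2 > 0" "\<forall>x\<in>carrier G. nrm x < r2 \<longrightarrow> norm (\<kappa> x) < 1"
    using chart_small[of 1] by auto
  define r where "r = min r1 r2"
  have r: "r > 0" using r2 good_pos[OF r1] by (simp add: r_def)
  have "norm (\<kappa> b) \<le> 4 / r * nrm b" if b: "b \<in> carrier G" "nrm b < r" for b
  proof -
    have pw: "real n / 2 * norm (\<kappa> b) < 1" if n: "\<And>j. j \<le> n \<Longrightarrow> nrm (b [^] j) < r" for n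
    proof -
      have "norm (\<kappa> (b [^] n) - real n *\<^sub>R \<kappa> b) \<le> real n * (1/2) * norm (\<kappa> b)"
        using n b by (intro chart_pow[OF r1]) (auto simp: r_def)
      moreover have "norm (real n *\<^sub>R \<kappa> b) - norm (\<kappa> (b [^] n)) \<le> norm (\<kappa> (b [^] n) - real n *\<^sub>R \<kappa> b)"
        by (metis norm_minus_commute norm_triangle_ineq2)
      moreover have "norm (\<kappa> (b [^] n)) < 1" using r2 n[of n] b by (auto simp: r_def)
      ultimately show ?thesis by simp
    qed
    show ?thesis
    proof (cases "\<forall>j::nat. nrm (b [^] j) < r")
      case True
      then have *: "real n / 2 * norm (\<kappa> b) < 1" for n using pw by auto
      have "norm (\<kappa> b) = 0"
      proof (rule ccontr)
        assume "norm (\<kappa> b) \<noteq> 0"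
        then have p: "norm (\<kappa> b) > 0" by simp
        obtain n where "2 / norm (\<kappa> b) < real n" using reals_Archimedean2 by blast
        then show False using *[of n] p by (simp add: field_simps)
      qed
      then show ?thesis using r nrm_nonneg[OF b(1)] by simp
    next
      case False
      \<comment> \<open>The first exit time from the ball. The chart bound still holds at
        \<open>k - 1\<close>, and subadditivity at \<open>k\<close> gives
        \<open>r \<le> real k * nrm b\<close>. As \<open>k \<ge> 2\<close>, passing from
        \<open>k - 1\<close> to \<open>k\<close> costs only a factor 2, whence the constant
        \<open>4 / r\<close>.\<close>
      define k where "k = (LEAST j::nat. \<not> nrm (b [^] j) < r)"
      have k: "\<not> nrm (b [^] k) < r" "\<And>j. j < k \<Longrightarrow> nrm (b [^] j) < r"
        using False LeastI_ex[of "\<lambda>j::nat. \<not> nrm (b [^] j) < r"] not_less_Least[of _ "\<lambda>j::nat. \<not> nrm (b [^] j) < r"]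
        unfolding k_def by auto
      have "k \<noteq> 0" "k \<noteq> 1" using k(1) r b by (auto intro: ccontr)
      then have k2: "k \<ge> 2" by simp
      have "real (k - 1) / 2 * norm (\<kappa> b) < 1" using k2 by (intro pw k(2)) auto
      moreover have "real k / 4 * norm (\<kappa> b) \<le> real (k - 1) / 2 * norm (\<kappa> b)"
        using k2 by (intro mult_right_mono) (auto simp: of_nat_diff)
      ultimately have "real k * norm (\<kappa> b) \<le> 4" by simp
      moreover have "r \<le> real k * nrm b" using k(1) nrm_pow[OF b(1), of k] by simp
      ultimately have "real k * norm (\<kappa> b) * r \<le> 4 * (real k * nrm b)"
        using r nrm_nonneg[OF b(1)] by (intro mult_mono) auto
      then have "norm (\<kappa> b) * r \<le> 4 * nrm b" using k2 by simp
      then show ?thesis using r by (simp add: field_simps)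
    qed
  qed
  then show ?thesis using r by (intro exI[of _ "4 / r"] conjI exI[of _ r]) auto
qed

text \<open>With \<open>x = u \<otimes> b \<otimes> inv u\<close> one has
  \<open>x \<otimes> u = u \<otimes> b\<close>. Expanding both sides, \<open>\<kappa> u\<close>
  cancels, and the errors are at most half of \<open>norm (\<kappa> x)\<close> and half of
  \<open>norm (\<kappa> b)\<close>; solving for \<open>norm (\<kappa> x)\<close> gives the factor
  3.\<close>

lemma chart_conj_small:
  "\<exists>r>0. \<forall>u\<in>carrier G. \<forall>b\<in>carrier G. nrm u < r \<longrightarrow> nrm b < r \<longrightarrow>
     norm (\<kappa> (u \<otimes> b \<otimes> inv u)) \<le> 3 * norm (\<kappa> b)"
proof -
  obtain r where r: "good (1/2) r" using ex_good[of "1/2"] by auto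
  have "norm (\<kappa> (u \<otimes> b \<otimes> inv u)) \<le> 3 * norm (\<kappa> b)"
    if u: "u \<in> carrier G" "nrm u < r / 3" and b: "b \<in> carrier G" "nrm b < r / 3" for u b
  proof -
    let ?x = "u \<otimes> b \<otimes> inv u"
    have x: "?x \<in> carrier G" "nrm ?x < r" using nrm_conj[OF u(1) b(1)] u b by auto
    have eq: "?x \<otimes> u = u \<otimes> b" using u b by (simp add: m_assoc)
    have "norm (\<kappa> (u \<otimes> b) - \<kappa> u - \<kappa> b) \<le> 1/2 * norm (\<kappa> b)"
      using u b good_pos[OF r] by (intro good_mult(1)[OF r]) auto
    moreover have "norm (\<kappa> (u \<otimes> b) - \<kappa> ?x - \<kappa> u) \<le> 1/2 * norm (\<kappa> ?x)"
      using good_mult(2)[OF r x(1) u(1) x(2)] u good_pos[OF r] by (simp add: eq)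
    ultimately have "norm (\<kappa> ?x - \<kappa> b) \<le> 1/2 * norm (\<kappa> b) + 1/2 * norm (\<kappa> ?x)"
      using norm_triangle_ineq4[of "\<kappa> (u \<otimes> b) - \<kappa> u - \<kappa> b" "\<kappa> (u \<otimes> b) - \<kappa> ?x - \<kappa> u"] by simp
    moreover have "norm (\<kappa> ?x) - norm (\<kappa> b) \<le> norm (\<kappa> ?x - \<kappa> b)" by (rule norm_triangle_ineq2)
    ultimately show ?thesis by linarith
  qed
  then show ?thesis using good_pos[OF r] by (intro exI[of _ "r/3"]) auto
qed

text \<open>The commutator \<open>z\<close> satisfies
  \<open>z \<otimes> (y \<otimes> x) = x \<otimes> y\<close>, and both products have chart value
  \<open>\<kappa> x + \<kappa> y\<close> up to small relative errors, so little is left for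
  \<open>\<kappa> z\<close>.\<close>

lemma chart_commutator:
  assumes "0 < e"
  shows "\<exists>r>0. \<forall>x\<in>carrier G. \<forall>y\<in>carrier G. nrm x < r \<longrightarrow> nrm y < r \<longrightarrow>
     norm (\<kappa> (x \<otimes> y \<otimes> inv x \<otimes> inv y)) \<le> e * (norm (\<kappa> x) + norm (\<kappa> y))"
proof -
  define e' where "e' = min (e / 6) 1"
  have e': "e' > 0" "e' \<le> 1" "6 * e' \<le> e" using assms by (auto simp: e'_def)
  obtain r where r: "good e' r" using ex_good[OF e'(1)] by auto
  obtain rh where rh: "good (1/2) rh" using ex_good[of "1/2"] by auto
  define r0 where "r0 = min r rh / 4"
  have r0: "r0 > 0" using good_pos[OF r] good_pos[OF rh] by (simp add: r0_def)
  have "norm (\<kappa> (x \<otimes> y \<otimes> inv x \<otimes> inv y)) \<le> e * (norm (\<kappa> x) + norm (\<kappa> y))"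
    if x: "x \<in> carrier G" "nrm x < r0" and y: "y \<in> carrier G" "nrm y < r0" for x y
  proof -
    let ?z = "x \<otimes> y \<otimes> inv x \<otimes> inv y"
    let ?N = "norm (\<kappa> x) + norm (\<kappa> y)"
    have z: "?z \<in> carrier G" "nrm ?z < 4 * r0"
      using nrm_conj[OF x(1) y(1)] nrm_mult[of "x \<otimes> y \<otimes> inv x" "inv y"] nrm_inv[OF y(1)] x y by auto
    have yx: "y \<otimes> x \<in> carrier G" "nrm (y \<otimes> x) < 4 * r0"
      using nrm_mult[OF y(1) x(1)] x y r0 by auto
    have eq: "?z \<otimes> (y \<otimes> x) = x \<otimes> y"
      using x y by (simp add: m_assoc inv_solve_left')
    have l: "4 * r0 \<le> r" "4 * r0 \<le> rh" by (auto simp: r0_def)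
    have 1: "norm (\<kappa> (x \<otimes> y) - \<kappa> x - \<kappa> y) \<le> e' * norm (\<kappa> x)"
      using x y l r0 by (intro good_mult[OF r]) auto
    have 2: "norm (\<kappa> (y \<otimes> x) - \<kappa> y - \<kappa> x) \<le> e' * norm (\<kappa> y)"
      using x y l r0 by (intro good_mult[OF r]) auto
    have 3: "norm (\<kappa> (x \<otimes> y) - \<kappa> ?z - \<kappa> (y \<otimes> x)) \<le> e' * norm (\<kappa> (y \<otimes> x))"
      using good_mult(1)[OF r z(1) yx(1)] z yx l by (simp add: eq)
    have 4: "norm (\<kappa> (y \<otimes> x)) \<le> 2 * ?N"
    proof -
      have "norm (\<kappa> (y \<otimes> x)) \<le> norm (\<kappa> (y \<otimes> x) - \<kappa> y - \<kappa> x) + norm (\<kappa> x + \<kappa> y)"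
        using norm_triangle_ineq[of "\<kappa> (y \<otimes> x) - \<kappa> y - \<kappa> x" "\<kappa> x + \<kappa> y"] by simp
      also have "\<dots> \<le> e' * norm (\<kappa> y) + ?N" using 2 norm_triangle_ineq[of "\<kappa> x" "\<kappa> y"] by simp
      also have "e' * norm (\<kappa> y) \<le> ?N" using mult_right_mono[OF e'(2), of "norm (\<kappa> y)"] norm_ge_zero[of "\<kappa> x"] by (simp add: add_increasing)
      finally show ?thesis by simp
    qed
    have "\<kappa> ?z = (\<kappa> (x \<otimes> y) - \<kappa> x - \<kappa> y) - (\<kappa> (y \<otimes> x) - \<kappa> y - \<kappa> x) - (\<kappa> (x \<otimes> y) - \<kappa> ?z - \<kappa> (y \<otimes> x))"
      by simp
    then have "norm (\<kappa> ?z) \<le> e' * norm (\<kappa> x) + e' * norm (\<kappa> y) + e' * norm (\<kappa> (y \<otimes> x))"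
      using 1 2 3 norm_triangle_le_diff by (smt (verit) norm_triangle_ineq4)
    also have "\<dots> \<le> e' * norm (\<kappa> x) + e' * norm (\<kappa> y) + e' * (2 * ?N)"
      using 4 e' by (intro add_left_mono mult_left_mono) auto
    also have "\<dots> = (3 * e') * ?N" by (simp add: algebra_simps)
    also have "\<dots> \<le> e * ?N" using e' by (intro mult_right_mono) auto
    finally show ?thesis .
  qed
  then show ?thesis using r0 by blast
qed

end

section \<open>Horizontal subgroups\<close>

text \<open>Horizontality is encoded in \<open>dil_add\<close>: on \<open>V\<close>, dilation by
  \<open>t\<close> is the time-\<open>t\<close> map of a one-parameter subgroup. In particular
  \<open>dil (1 / real n) v\<close> is an \<open>n\<close>-th root of \<open>v\<close>, of norm
  \<open>nrm v / real n\<close>.\<close>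

locale horizontal_group = chart_group G nrm \<kappa> R
  for G (structure) and nrm and \<kappa> :: "'a \<Rightarrow> 'e::euclidean_space" and R +
  fixes dil :: "real \<Rightarrow> 'a \<Rightarrow> 'a" and V :: "'a set"
  assumes dil_hom: "0 < r \<Longrightarrow> dil r \<in> hom G G"
    and nrm_dil: "0 < r \<Longrightarrow> x \<in> carrier G \<Longrightarrow> nrm (dil r x) = r * nrm x"
    and V_subgroup: "subgroup V G"
    and dil_V: "0 < r \<Longrightarrow> v \<in> V \<Longrightarrow> dil r v \<in> V"
    and dil_add: "0 < r \<Longrightarrow> 0 < t \<Longrightarrow> v \<in> V \<Longrightarrow> dil r v \<otimes> dil t v = dil (r + t) v"
    and dil_dil: "0 < r \<Longrightarrow> 0 < t \<Longrightarrow> v \<in> V \<Longrightarrow> dil r (dil t v) = dil (r * t) v"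
    and dil_1: "v \<in> V \<Longrightarrow> dil 1 v = v"
begin

sublocale V: subgroup V G by (rule V_subgroup)

lemma dil_closed [simp]: "0 < r \<Longrightarrow> x \<in> carrier G \<Longrightarrow> dil r x \<in> carrier G"
  using dil_hom by (auto simp: hom_def)

lemma dil_mult: "0 < r \<Longrightarrow> x \<in> carrier G \<Longrightarrow> y \<in> carrier G \<Longrightarrow> dil r (x \<otimes> y) = dil r x \<otimes> dil r y"
  using dil_hom by (auto simp: hom_def)

lemma dil_inv: "0 < r \<Longrightarrow> x \<in> carrier G \<Longrightarrow> dil r (inv x) = inv (dil r x)"
  using group_hom.hom_inv[OF group_hom.intro[OF is_group is_group group_hom_axioms.intro[OF dil_hom]]]
  by blast

lemma V_carrier [simp]: "v \<in> V \<Longrightarrow> v \<in> carrier G"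
  by (rule V.mem_carrier)

lemma V_pow: "v \<in> V \<Longrightarrow> v [^] (n::nat) \<in> V"
  by (induction n) auto

lemma dil_pow:
  assumes "v \<in> V" "0 < r" "0 < (n::nat)"
  shows "dil r v [^] n = dil (real n * r) v"
  using assms(3)
proof (induction n)
  case (Suc n)
  show ?case
  proof (cases "n = 0")
    case False
    then show ?thesis using Suc assms dil_add[of "real n * r" r v] by (simp add: algebra_simps)
  qed (use assms in simp)
qed simp

text \<open>On \<open>V\<close> the automorphism \<open>dil 2\<close> is squaring, and a group in
  which squaring is multiplicative is abelian.\<close>

lemma V_commute:
  assumes "v \<in> V" "w \<in> V" shows "v \<otimes> w = w \<otimes> v"
proof -
  have sq: "dil 2 x = x \<otimes> x" if "x \<in> V" for x
    using dil_add[of 1 1 x] dil_1 that by simp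
  have "v \<otimes> (w \<otimes> v) \<otimes> w = v \<otimes> (v \<otimes> w) \<otimes> w"
    using sq[of "v \<otimes> w"] sq[of v] sq[of w] dil_mult[of 2 v w] assms by (simp add: m_assoc)
  then show ?thesis using assms by simp
qed

text \<open>
  As \<open>V\<close> is horizontal, \<open>u \<in> V\<close> has an \<open>m\<close>-th root of norm \<open>nrm u / m\<close>, so that conjugation by
  \<open>u\<close> is an iterate of conjugation by an element close to the identity.
\<close>

lemma chart_conj:
  assumes K: "0 < K" and s: "0 < s"
  shows "\<exists>C>0. \<exists>r>0. \<forall>u\<in>V. \<forall>b\<in>carrier G. nrm u \<le> K \<longrightarrow> nrm b < r \<longrightarrow>
     norm (\<kappa> (u \<otimes> b \<otimes> inv u)) \<le> C * norm (\<kappa> b) \<and> nrm (u \<otimes> b \<otimes> inv u) < s"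
proof -
  obtain r0 where r0: "r0 > 0" "\<And>u b. u \<in> carrier G \<Longrightarrow> b \<in> carrier G \<Longrightarrow> nrm u < r0 \<Longrightarrow> nrm b < r0 \<Longrightarrow>
     norm (\<kappa> (u \<otimes> b \<otimes> inv u)) \<le> 3 * norm (\<kappa> b)" using chart_conj_small by blast
  \<comment> \<open>Conjugating an element of norm below \<open>r1\<close> by another such element
    stays in the ball of radius \<open>3 * r1 \<le> R\<close>, where \<open>nrm_small\<close>
    applies.\<close>
  define r1 where "r1 = min (min r0 s) (R / 3)"
  have r1: "r1 > 0" "r1 \<le> r0" "r1 \<le> s" "3 * r1 \<le> R" using r0 s R_pos by (auto simp: r1_def)
  obtain t where t: "t > 0" "\<And>x. x \<in> carrier G \<Longrightarrow> nrm x < R \<Longrightarrow> norm (\<kappa> x) < t \<Longrightarrow> nrm x < r1"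
    using nrm_small[OF r1(1)] by blast
  obtain m :: nat where m: "K / r1 < real m" using reals_Archimedean2 by blast
  then have m0: "0 < m" using K r1 by (metis divide_pos_pos of_nat_0_less_iff less_trans)
  \<comment> \<open>Up to \<open>m\<close> conjugations, each at most tripling the chart value, keep
    it below \<open>t\<close>; so after each of them the norm is again below \<open>r1\<close> and
    the next one is admissible.\<close>
  obtain r2 where r2: "r2 > 0" "\<And>x. x \<in> carrier G \<Longrightarrow> nrm x < r2 \<Longrightarrow> norm (\<kappa> x) < t / 3 ^ m"
    using chart_small[of "t / 3 ^ m"] t by auto
  have "norm (\<kappa> (u \<otimes> b \<otimes> inv u)) \<le> 3 ^ m * norm (\<kappa> b) \<and> nrm (u \<otimes> b \<otimes> inv u) < s"
    if u: "u \<in> V" "nrm u \<le> K" and b: "b \<in> carrier G" "nrm b < min r1 r2" for u b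
  proof -
    define y where "y = dil (1 / real m) u"
    have y: "y \<in> V" "nrm y < r1"
      using u m m0 r1 by (auto simp: y_def dil_V nrm_dil field_simps)
    have ym: "y [^] m = u" using dil_pow[of u "1 / real m" m] u m0 dil_1 by (simp add: y_def)
    have "norm (\<kappa> (y [^] j \<otimes> b \<otimes> inv (y [^] j))) \<le> 3 ^ j * norm (\<kappa> b)
       \<and> nrm (y [^] j \<otimes> b \<otimes> inv (y [^] j)) < r1" if "j \<le> m" for j
      using that
    proof (induction j)
      case 0
      then show ?case using b by simp
    next
      case (Suc j)
      let ?x = "y [^] j \<otimes> b \<otimes> inv (y [^] j)"
      have x: "?x \<in> carrier G" using b y by simp
      have eq: "y [^] Suc j \<otimes> b \<otimes> inv (y [^] Suc j) = y \<otimes> ?x \<otimes> inv y"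
        unfolding nat_pow_Suc2[OF V_carrier[OF y(1)]]
        using y b by (simp add: m_assoc inv_mult_group)
      have "norm (\<kappa> (y \<otimes> ?x \<otimes> inv y)) \<le> 3 * norm (\<kappa> ?x)"
        using Suc y r1 b by (intro r0(2)) auto
      also have "\<dots> \<le> 3 ^ Suc j * norm (\<kappa> b)" using Suc by simp
      finally have 1: "norm (\<kappa> (y \<otimes> ?x \<otimes> inv y)) \<le> 3 ^ Suc j * norm (\<kappa> b)" .
      also have "\<dots> \<le> 3 ^ m * norm (\<kappa> b)"
        using Suc.prems by (intro mult_right_mono power_increasing) auto
      also have "\<dots> < t" using r2(2)[OF b(1)] b by (simp add: field_simps)
      finally have "norm (\<kappa> (y \<otimes> ?x \<otimes> inv y)) < t" .
      moreover have "nrm (y \<otimes> ?x \<otimes> inv y) < R"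
        using nrm_conj[OF V_carrier[OF y(1)] x] y Suc r1 by simp
      ultimately have "nrm (y \<otimes> ?x \<otimes> inv y) < r1" using x y by (intro t(2)) auto
      then show ?case using 1 unfolding eq by simp
    qed
    from this[of m] show ?thesis using r1 ym by auto
  qed
  then show ?thesis using r1 r2 by (intro exI[of _ "3 ^ m"] conjI exI[of _ "min r1 r2"]) auto
qed

text \<open>One step of a bootstrap for long products of conjugates
  \<open>u \<otimes> b \<otimes> inv u\<close>. The constants do not depend on the number of steps:
  chart values accumulate additively, and while their total stays below \<open>t\<close> the partial
  product \<open>q\<close> stays in the ball of radius \<open>e'\<close>, so the step can be
  repeated.\<close>

lemma chart_step:
  assumes K: "0 < K" and e: "0 < e"
  shows "\<exists>C>0. \<exists>t>0. \<exists>r>0. \<exists>e'. 0 < e' \<and> e' \<le> e \<and>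
    (\<forall>q\<in>carrier G. \<forall>u\<in>V. \<forall>b\<in>carrier G. nrm u \<le> K \<longrightarrow> nrm b < r \<longrightarrow> nrm q < e' \<longrightarrow>
      norm (\<kappa> q) + C * norm (\<kappa> b) < t \<longrightarrow>
      norm (\<kappa> (q \<otimes> (u \<otimes> b \<otimes> inv u))) \<le> norm (\<kappa> q) + C * norm (\<kappa> b) \<and>
      nrm (q \<otimes> (u \<otimes> b \<otimes> inv u)) < e')"
proof -
  obtain r0 where r0: "good 1 r0" using ex_good[of 1] by auto
  have r0': "r0 > 0" "r0 \<le> R" using r0 by (auto simp: good_def)
  define e' where "e' = min e (r0 / 2)"
  have e': "0 < e'" "e' \<le> e" "2 * e' \<le> r0" using e r0' by (auto simp: e'_def)
  obtain C r where C: "C > 0" "r > 0" "\<And>u b. u \<in> V \<Longrightarrow> b \<in> carrier G \<Longrightarrow> nrm u \<le> K \<Longrightarrow> nrm b < r \<Longrightarrow>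
     norm (\<kappa> (u \<otimes> b \<otimes> inv u)) \<le> C * norm (\<kappa> b) \<and> nrm (u \<otimes> b \<otimes> inv u) < e'"
    using chart_conj[OF K e'(1)] by blast
  obtain t where t: "t > 0" "\<And>x. x \<in> carrier G \<Longrightarrow> nrm x < R \<Longrightarrow> norm (\<kappa> x) < t \<Longrightarrow> nrm x < e'"
    using nrm_small[OF e'(1)] by blast
  have "norm (\<kappa> (q \<otimes> (u \<otimes> b \<otimes> inv u))) \<le> norm (\<kappa> q) + (2 * C) * norm (\<kappa> b) \<and>
      nrm (q \<otimes> (u \<otimes> b \<otimes> inv u)) < e'"
    if q: "q \<in> carrier G" "nrm q < e'" and u: "u \<in> V" "nrm u \<le> K" and b: "b \<in> carrier G" "nrm b < r"
      and small: "norm (\<kappa> q) + (2 * C) * norm (\<kappa> b) < t" for q u b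
  proof -
    let ?x = "u \<otimes> b \<otimes> inv u"
    have x: "?x \<in> carrier G" "nrm ?x < e'" "norm (\<kappa> ?x) \<le> C * norm (\<kappa> b)" using C(3) u b by auto
    have "norm (\<kappa> (q \<otimes> ?x) - \<kappa> q - \<kappa> ?x) \<le> 1 * norm (\<kappa> ?x)"
      using q x e' by (intro good_mult[OF r0]) auto
    then have "norm (\<kappa> (q \<otimes> ?x)) \<le> norm (\<kappa> q) + 2 * norm (\<kappa> ?x)"
      using norm_triangle_ineq[of "\<kappa> (q \<otimes> ?x) - \<kappa> q - \<kappa> ?x" "\<kappa> q + \<kappa> ?x"] norm_triangle_ineq[of "\<kappa> q" "\<kappa> ?x"]
      by simp
    then have 1: "norm (\<kappa> (q \<otimes> ?x)) \<le> norm (\<kappa> q) + (2 * C) * norm (\<kappa> b)" using x(3) by simp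
    have "nrm (q \<otimes> ?x) < R" using nrm_mult[OF q(1) x(1)] q x e' r0' by simp
    then show ?thesis using t(2)[of "q \<otimes> ?x"] 1 small q x by simp
  qed
  then show ?thesis using C t e'
    by (intro exI[of _ "2 * C"] exI[of _ t] exI[of _ r] exI[of _ e'] conjI) auto
qed

text \<open>For \<open>v \<in> V\<close> this is the initial velocity of
  \<open>t \<mapsto> dil t v\<close> in the chart, that is, the logarithm of \<open>v\<close>. It is
  sampled along \<open>t = 1 / n\<close>, where dilates are roots.\<close>

definition xi :: "'a \<Rightarrow> 'e" where
  "xi v = lim (\<lambda>n. real n *\<^sub>R \<kappa> (dil (1 / real n) v))"

text \<open>The root of order \<open>n\<close> is the \<open>m\<close>-th power of the root of order
  \<open>n * m\<close>, so \<open>chart_pow\<close> compares the two. Arbitrary indices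
  \<open>n\<close> and \<open>m\<close> are later compared through their common multiple, which
  gives the Cauchy property.\<close>

lemma chart_root_approx:
  assumes v: "v \<in> V" and e: "0 < e"
  shows "\<exists>N>0. \<forall>n\<ge>N. \<forall>m>0. norm (real n *\<^sub>R \<kappa> (dil (1 / real n) v)
     - real (n * m) *\<^sub>R \<kappa> (dil (1 / real (n * m)) v)) \<le> e"
proof -
  obtain C r where C: "C > 0" "r > 0" "\<And>b. b \<in> carrier G \<Longrightarrow> nrm b < r \<Longrightarrow> norm (\<kappa> b) \<le> C * nrm b"
    using chart_le_nrm by blast
  have nv: "nrm v \<ge> 0" using v nrm_nonneg by auto
  \<comment> \<open>The summand 1 keeps the denominator positive for
    \<open>v = \<one>\<close>.\<close>
  define e' where "e' = e / (C * nrm v + 1)"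
  have cv: "C * nrm v + 1 > 0" using C nv mult_nonneg_nonneg[of C "nrm v"] by linarith
  have e': "e' > 0" "e' * (C * nrm v) \<le> e"
    using e cv by (auto simp: e'_def field_simps)
  obtain r' where r': "good e' r'" using ex_good[OF e'(1)] by auto
  define r0 where "r0 = min r r'"
  have r0: "r0 > 0" using C good_pos[OF r'] by (simp add: r0_def)
  obtain N :: nat where N: "nrm v / r0 < real N" using reals_Archimedean2 by blast
  have "norm (real n *\<^sub>R \<kappa> (dil (1 / real n) v)
     - real (n * m) *\<^sub>R \<kappa> (dil (1 / real (n * m)) v)) \<le> e" if n: "n \<ge> Suc N" and m: "m > 0" for n m :: nat
  proof -
    define b where "b = dil (1 / real (n * m)) v"
    have n0: "n > 0" using n by simp
    have b: "b \<in> V" "nrm b = nrm v / real (n * m)" using v n0 m by (auto simp: b_def dil_V nrm_dil)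
    have bm: "b [^] m = dil (1 / real n) v" using dil_pow[OF v, of "1 / real (n*m)" m] n0 m by (simp add: b_def)
    have vn: "nrm v / real n < r0"
    proof -
      have "nrm v < real N * r0" using N r0 by (simp add: field_simps)
      also have "\<dots> \<le> real n * r0" using n r0 by (intro mult_right_mono) auto
      finally show ?thesis using n0 by (simp add: field_simps)
    qed
    have bj: "nrm (b [^] j) < r0" if "j \<le> m" for j
    proof -
      have "nrm (b [^] j) \<le> real j * (nrm v / real (n * m))" using nrm_pow[of b j] b by simp
      also have "\<dots> \<le> real m * (nrm v / real (n * m))" using that nv by (intro mult_right_mono) auto
      also have "\<dots> = nrm v / real n" using m by simp
      finally show ?thesis using vn by simp
    qed
    have b1: "nrm b < r0" using bj[of 1] m b by simp
    have "norm (\<kappa> (b [^] m) - real m *\<^sub>R \<kappa> b) \<le> real m * e' * norm (\<kappa> b)"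
      using bj b b1 by (intro chart_pow[OF r']) (auto simp: r0_def)
    also have "\<dots> \<le> real m * e' * (C * nrm b)" using e' b b1 by (intro mult_left_mono C(3)) (auto simp: r0_def)
    also have "\<dots> = e' * (C * nrm v) / real n" using m b by simp
    also have "\<dots> \<le> e / real n" using e' n0 by (intro divide_right_mono) auto
    finally have "real n * norm (\<kappa> (b [^] m) - real m *\<^sub>R \<kappa> b) \<le> e" using n0 by (simp add: field_simps)
    moreover have "real n *\<^sub>R \<kappa> (dil (1 / real n) v) - real (n * m) *\<^sub>R \<kappa> b = real n *\<^sub>R (\<kappa> (b [^] m) - real m *\<^sub>R \<kappa> b)"
      by (simp add: bm algebra_simps)
    ultimately show ?thesis unfolding b_def[symmetric] by simp
  qed
  then show ?thesis by blast
qed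

lemma xi_tendsto:
  assumes v: "v \<in> V"
  shows "(\<lambda>n. real n *\<^sub>R \<kappa> (dil (1 / real n) v)) \<longlonglongrightarrow> xi v"
proof -
  let ?a = "\<lambda>n. real n *\<^sub>R \<kappa> (dil (1 / real n) v)"
  have "Cauchy ?a"
  proof (rule metric_CauchyI)
    fix e :: real assume e: "0 < e"
    obtain N where N: "N > 0" "\<And>n m. n \<ge> N \<Longrightarrow> m > 0 \<Longrightarrow> norm (?a n - ?a (n * m)) \<le> e / 3"
      using chart_root_approx[OF v, of "e/3"] e by auto
    have "dist (?a m) (?a n) < e" if "m \<ge> N" "n \<ge> N" for m n
    proof -
      have "norm (?a m - ?a (m * n)) \<le> e / 3" "norm (?a n - ?a (m * n)) \<le> e / 3"
        using N(1) N(2)[of m n] N(2)[of n m] that by (auto simp: mult.commute)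
      then have "dist (?a m) (?a n) \<le> e / 3 + e / 3"
        unfolding dist_norm using norm_triangle_ineq4[of "?a m - ?a (m * n)" "?a n - ?a (m * n)"] by simp
      then show ?thesis using e by simp
    qed
    then show "\<exists>M. \<forall>m\<ge>M. \<forall>n\<ge>M. dist (?a m) (?a n) < e" by blast
  qed
  then show ?thesis unfolding xi_def by (simp add: Cauchy_convergent_iff convergent_LIMSEQ_iff)
qed

lemma chart_root_bound:
  "\<exists>C>0. \<forall>v\<in>V. \<forall>\<^sub>F n in sequentially. real n * norm (\<kappa> (dil (1 / real n) v)) \<le> C * nrm v"
proof -
  obtain C r where C: "C > 0" "r > 0" "\<And>b. b \<in> carrier G \<Longrightarrow> nrm b < r \<Longrightarrow> norm (\<kappa> b) \<le> C * nrm b"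
    using chart_le_nrm by blast
  have "\<forall>\<^sub>F n in sequentially. real n * norm (\<kappa> (dil (1 / real n) v)) \<le> C * nrm v" if v: "v \<in> V" for v
  proof -
    obtain N :: nat where N: "nrm v / r < real N" using reals_Archimedean2 by blast
    have "real n * norm (\<kappa> (dil (1 / real n) v)) \<le> C * nrm v" if n: "n \<ge> Suc N" for n
    proof -
      have n0: "n > 0" using n by simp
      have "nrm v < real N * r" using N C by (simp add: field_simps)
      also have "\<dots> \<le> real n * r" using n C by (intro mult_right_mono) auto
      finally have "nrm (dil (1 / real n) v) < r" using v n0 by (simp add: nrm_dil field_simps)
      then have "norm (\<kappa> (dil (1 / real n) v)) \<le> C * nrm (dil (1 / real n) v)" using v n0 by (intro C(3)) auto
      then show ?thesis using v n0 by (simp add: nrm_dil field_simps)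
    qed
    then show ?thesis unfolding eventually_sequentially by blast
  qed
  then show ?thesis using C(1) by blast
qed

lemma xi_le_nrm: "\<exists>C>0. \<forall>v\<in>V. norm (xi v) \<le> C * nrm v"
proof -
  obtain C where C: "C > 0" "\<And>v. v \<in> V \<Longrightarrow> \<forall>\<^sub>F n in sequentially. real n * norm (\<kappa> (dil (1 / real n) v)) \<le> C * nrm v"
    using chart_root_bound by blast
  have "norm (xi v) \<le> C * nrm v" if v: "v \<in> V" for v
    by (rule tendsto_upperbound[OF tendsto_norm[OF xi_tendsto[OF v]]]) (use C(2)[OF v] in auto)
  then show ?thesis using C(1) by blast
qed

text \<open>Dilations are homomorphisms, so the \<open>n\<close>-th root of
  \<open>v \<otimes> w\<close> is the product of the roots. The error of this product is relative to
  a root of \<open>w\<close>, hence still small after multiplication by \<open>n\<close>.\<close>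

lemma xi_mult:
  assumes v: "v \<in> V" and w: "w \<in> V"
  shows "xi (v \<otimes> w) = xi v + xi w"
proof -
  let ?a = "\<lambda>v n. real n *\<^sub>R \<kappa> (dil (1 / real n) v)"
  obtain C where C: "C > 0" "\<And>v. v \<in> V \<Longrightarrow> \<forall>\<^sub>F n in sequentially. real n * norm (\<kappa> (dil (1 / real n) v)) \<le> C * nrm v"
    using chart_root_bound by blast
  have small: "\<forall>\<^sub>F n in sequentially. nrm (dil (1 / real n) u) < r" if "u \<in> V" "r > 0" for u r
  proof -
    have "(\<lambda>n. nrm u / real n) \<longlonglongrightarrow> 0" by (rule lim_const_over_n)
    from order_tendstoD(2)[OF this that(2)] eventually_gt_at_top[of 0] show ?thesis
      by eventually_elim (use that in \<open>simp add: nrm_dil\<close>)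
  qed
  have "(\<lambda>n. ?a (v \<otimes> w) n - ?a v n - ?a w n) \<longlonglongrightarrow> 0"
  proof (rule tendstoI)
    fix e :: real assume e: "0 < e"
    have nw: "nrm w \<ge> 0" using w nrm_nonneg by auto
    define e' where "e' = e / (C * nrm w + 1)"
    have cw: "C * nrm w + 1 > 0" using C nw mult_nonneg_nonneg[of C "nrm w"] by linarith
    have e': "e' > 0" "e' * (C * nrm w) < e"
      using e cw by (auto simp: e'_def field_simps)
    obtain r where r: "good e' r" using ex_good[OF e'(1)] by auto
    show "\<forall>\<^sub>F n in sequentially. dist (?a (v \<otimes> w) n - ?a v n - ?a w n) 0 < e"
      using small[OF v good_pos[OF r]] small[OF w good_pos[OF r]] C(2)[OF w] eventually_gt_at_top[of 0]
    proof eventually_elim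
      case (elim n)
      let ?v = "dil (1 / real n) v" and ?w = "dil (1 / real n) w"
      have "norm (\<kappa> (?v \<otimes> ?w) - \<kappa> ?v - \<kappa> ?w) \<le> e' * norm (\<kappa> ?w)"
        using elim v w by (intro good_mult[OF r]) auto
      then have "real n * norm (\<kappa> (?v \<otimes> ?w) - \<kappa> ?v - \<kappa> ?w) \<le> real n * (e' * norm (\<kappa> ?w))"
        by (intro mult_left_mono) auto
      also have "\<dots> = e' * (real n * norm (\<kappa> ?w))" by simp
      also have "\<dots> \<le> e' * (C * nrm w)" using elim e' by (intro mult_left_mono) auto
      also have "\<dots> < e" by (rule e')
      finally have "norm (real n *\<^sub>R (\<kappa> (?v \<otimes> ?w) - \<kappa> ?v - \<kappa> ?w)) < e" by simp
      then show ?case using elim v w by (simp add: dil_mult algebra_simps)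
    qed
  qed
  moreover have "(\<lambda>n. ?a (v \<otimes> w) n - ?a v n - ?a w n) \<longlonglongrightarrow> xi (v \<otimes> w) - xi v - xi w"
    using v w by (intro tendsto_diff xi_tendsto) auto
  ultimately have "xi (v \<otimes> w) - xi v - xi w = 0" using LIMSEQ_unique by blast
  then show ?thesis by (simp add: algebra_simps)
qed

lemma xi_one [simp]: "xi \<one> = 0"
  using xi_mult[of \<one> \<one>] by simp

lemma xi_inv: "v \<in> V \<Longrightarrow> xi (inv v) = - xi v"
  using xi_mult[of v "inv v"] by (simp add: eq_neg_iff_add_eq_0 add.commute)

lemma xi_pow: "v \<in> V \<Longrightarrow> xi (v [^] (n::nat)) = real n *\<^sub>R xi v"
  by (induction n) (auto simp: xi_mult V_pow algebra_simps)

text \<open>Additivity handles integer multiples. For real \<open>t\<close>, rounding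
  \<open>n * t\<close> to an integer leaves a remainder bounded independently of \<open>n\<close>,
  so \<open>n\<close> times the defect is bounded and the defect vanishes.\<close>

lemma xi_dil:
  assumes v: "v \<in> V" and t: "0 < t"
  shows "xi (dil t v) = t *\<^sub>R xi v"
proof -
  obtain C where C: "C > 0" "\<And>v. v \<in> V \<Longrightarrow> norm (xi v) \<le> C * nrm v" using xi_le_nrm by blast
  define B where "B = C * (2 * nrm v) + 2 * norm (xi v)"
  have nv: "nrm v \<ge> 0" using v nrm_nonneg by auto
  have bd: "real n * norm (xi (dil t v) - t *\<^sub>R xi v) \<le> B" if n: "n > 0" for n :: nat
  proof -
    define k where "k = nat \<lfloor>real n * t\<rfloor>"
    \<comment> \<open>The shift by 1 keeps the fractional dilation factor in \<open>[1, 2)\<close>,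
      hence positive even when \<open>real n * t\<close> is an integer; it is paid for by one extra
      factor \<open>v\<close>.\<close>
    define s where "s = real n * t - real k + 1"
    have nt: "0 < real n * t" using n t by simp
    have s: "1 \<le> s" "s < 2" using nt by (auto simp: s_def k_def) linarith+
    have "dil (real n * t + 1) v = v [^] k \<otimes> dil s v"
    proof (cases "k = 0")
      case True then show ?thesis using v s by (simp add: s_def)
    next
      case False
      then have "v [^] k = dil (real k) v" using dil_pow[OF v, of 1 k] dil_1[OF v] by simp
      then show ?thesis using dil_add[of "real k" s v] v s False by (simp add: s_def)
    qed
    moreover have "dil (real n * t + 1) v = dil t v [^] n \<otimes> v"
      using dil_pow[OF v t n] dil_add[of "real n * t" 1 v] nt v dil_1[OF v] by simp
    ultimately have "xi (dil t v [^] n \<otimes> v) = xi (v [^] k \<otimes> dil s v)" by simp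
    then have "real n *\<^sub>R xi (dil t v) + xi v = real k *\<^sub>R xi v + xi (dil s v)"
      using v s t by (simp add: xi_mult xi_pow dil_V V_pow)
    then have "real n *\<^sub>R (xi (dil t v) - t *\<^sub>R xi v) = xi (dil s v) - s *\<^sub>R xi v"
      by (simp add: s_def algebra_simps)
    then have "real n * norm (xi (dil t v) - t *\<^sub>R xi v) = norm (xi (dil s v) - s *\<^sub>R xi v)"
      by (metis abs_of_nat norm_scaleR)
    also have "\<dots> \<le> norm (xi (dil s v)) + s * norm (xi v)"
      using norm_triangle_ineq4[of "xi (dil s v)" "s *\<^sub>R xi v"] s by simp
    also have "\<dots> \<le> C * (s * nrm v) + s * norm (xi v)" using C(2)[of "dil s v"] v s by (simp add: dil_V nrm_dil)
    also have "\<dots> \<le> B" unfolding B_def using s C nv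
      by (intro add_mono mult_left_mono mult_right_mono) auto
    finally show ?thesis .
  qed
  have "norm (xi (dil t v) - t *\<^sub>R xi v) = 0"
  proof (rule ccontr)
    assume "norm (xi (dil t v) - t *\<^sub>R xi v) \<noteq> 0"
    then have p: "norm (xi (dil t v) - t *\<^sub>R xi v) > 0" (is "?p > 0") by simp
    obtain n where n: "\<bar>B\<bar> / ?p < real n" using reals_Archimedean2 by blast
    have "0 \<le> \<bar>B\<bar> / ?p" using p by simp
    then have "n > 0" using n by (metis of_nat_0_less_iff order_le_less_trans)
    then show False using bd[of n] n p by (simp add: field_simps)
  qed
  then show ?thesis by simp
qed

text \<open>On the sphere of radius \<open>r / 2\<close> the chart value is at least
  \<open>t\<close>, and it is at most 3/2 of \<open>n\<close> times that of the \<open>n\<close>-th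
  root. In the limit \<open>norm (xi v) \<ge> 2 / 3 * t\<close> there, and both sides scale under
  dilations.\<close>

lemma nrm_le_xi: "\<exists>C>0. \<forall>v\<in>V. nrm v \<le> C * norm (xi v)"
proof -
  obtain r where r: "good (1/2) r" using ex_good[of "1/2"] by auto
  have r0: "r > 0" "r \<le> R" using r by (auto simp: good_def)
  obtain t where t: "t > 0" "\<And>x. x \<in> carrier G \<Longrightarrow> nrm x < R \<Longrightarrow> norm (\<kappa> x) < t \<Longrightarrow> nrm x < r / 2"
    using nrm_small[of "r/2"] r0 by auto
  have half: "2 / 3 * t \<le> norm (xi v)" if v: "v \<in> V" "nrm v = r / 2" for v
  proof (rule tendsto_lowerbound[OF tendsto_norm[OF xi_tendsto[OF v(1)]]])
    have tv: "t \<le> norm (\<kappa> v)" using t(2)[of v] v r0 by force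
    show "\<forall>\<^sub>F n in sequentially. 2 / 3 * t \<le> norm (real n *\<^sub>R \<kappa> (dil (1 / real n) v))"
      using eventually_gt_at_top[of 0]
    proof eventually_elim
      case (elim n)
      define b where "b = dil (1 / real n) v"
      have b: "b \<in> V" "nrm b = r / 2 / real n" using elim v by (auto simp: b_def dil_V nrm_dil)
      have bn: "b [^] n = v" using dil_pow[OF v(1), of "1 / real n" n] elim v dil_1 by (simp add: b_def)
      have bj: "nrm (b [^] j) < r" if "j \<le> n" for j
      proof -
        have "nrm (b [^] j) \<le> real j * (r / 2 / real n)" using nrm_pow[of b j] b by simp
        also have "\<dots> \<le> real n * (r / 2 / real n)" using that r0 by (intro mult_right_mono) auto
        finally show ?thesis using elim r0 by simp
      qed
      have "norm (\<kappa> (b [^] n) - real n *\<^sub>R \<kappa> b) \<le> real n * (1/2) * norm (\<kappa> b)"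
        using bj[of 1] bj b elim by (intro chart_pow[OF r]) auto
      moreover have "norm (\<kappa> v) \<le> norm (\<kappa> v - real n *\<^sub>R \<kappa> b) + norm (real n *\<^sub>R \<kappa> b)"
        by (metis diff_add_cancel norm_triangle_ineq)
      ultimately have "t \<le> 3 / 2 * (real n * norm (\<kappa> b))" using tv by (simp add: bn)
      then show ?case by (simp add: b_def)
    qed
  qed simp
  have "nrm v \<le> 3 * r / (4 * t) * norm (xi v)" if v: "v \<in> V" for v
  proof (cases "v = \<one>")
    case False
    then have p: "nrm v > 0" using nrm_eq_0[of v] nrm_nonneg[of v] v by force
    define c where "c = r / 2 / nrm v"
    have c: "c > 0" using p r0 by (simp add: c_def)
    have "2 / 3 * t \<le> norm (xi (dil c v))"
      using v c p by (intro half) (auto simp: dil_V nrm_dil c_def)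
    then have "2 / 3 * t \<le> c * norm (xi v)" using xi_dil[OF v c] c by simp
    then show ?thesis using p t r0 by (simp add: c_def field_simps)
  qed simp
  then show ?thesis using t r0 by (intro exI[of _ "3 * r / (4 * t)"]) auto
qed

lemma xi_inj: "inj_on xi V"
proof (rule inj_onI)
  fix v w assume vw: "v \<in> V" "w \<in> V" "xi v = xi w"
  obtain C where C: "C > 0" "\<And>v. v \<in> V \<Longrightarrow> nrm v \<le> C * norm (xi v)" using nrm_le_xi by blast
  have "xi (v \<otimes> inv w) = 0" using vw by (simp add: xi_mult xi_inv)
  then have "nrm (v \<otimes> inv w) = 0" using C(2)[of "v \<otimes> inv w"] nrm_nonneg[of "v \<otimes> inv w"] vw by simp
  then show "v = w" using vw nrm_eq_0[of "v \<otimes> inv w"] by (simp add: inv_solve_right')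
qed

lemma xi_subspace: "subspace (xi ` V)"
proof (rule subspaceI)
  show "0 \<in> xi ` V" using xi_one V.one_closed by (metis image_eqI)
  show "x + y \<in> xi ` V" if "x \<in> xi ` V" "y \<in> xi ` V" for x y
    using that by (auto simp: image_iff) (metis V.m_closed xi_mult)
  show "c *\<^sub>R x \<in> xi ` V" if x: "x \<in> xi ` V" for c x
  proof -
    obtain v where v: "v \<in> V" "x = xi v" using x by auto
    consider "c = 0" | "c > 0" | "c < 0" by linarith
    then show ?thesis
    proof cases
      case 1 then show ?thesis using xi_one V.one_closed by (metis image_eqI scaleR_zero_left)
    next
      case 2 then show ?thesis using v xi_dil dil_V by (metis image_eqI)
    next
      case 3
      then have "xi (inv (dil (-c) v)) = c *\<^sub>R x" using v by (simp add: xi_inv xi_dil dil_V)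
      then show ?thesis using v 3 dil_V[of "-c" v] by (metis V.m_inv_closed image_eqI neg_0_less_iff_less)
    qed
  qed
qed

end

section \<open>Splittings\<close>

lemma (in group) mult_inv_cancel [simp]:
  assumes "x \<in> carrier G" "y \<in> carrier G"
  shows "x \<otimes> (inv x \<otimes> y) = y" "inv x \<otimes> (x \<otimes> y) = y"
  using assms by (simp_all add: m_assoc[symmetric])

lemma (in group) complementary_unique:
  assumes H: "subgroup H G" and K: "subgroup K G" and HK: "H \<inter> K = {\<one>}"
    and "h \<in> H" "k \<in> K" "h' \<in> H" "k' \<in> K" and eq: "h \<otimes> k = h' \<otimes> k'"
  shows "h = h' \<and> k = k'"
proof -
  interpret H: subgroup H G by (rule H)
  interpret K: subgroup K G by (rule K)
  have c: "h \<in> carrier G" "k \<in> carrier G" "h' \<in> carrier G" "k' \<in> carrier G" using assms by auto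
  have "inv h' \<otimes> (h \<otimes> k) \<otimes> inv k = inv h' \<otimes> (h' \<otimes> k') \<otimes> inv k" using eq by simp
  then have *: "inv h' \<otimes> h = k' \<otimes> inv k" using c by (simp add: m_assoc)
  moreover have "inv h' \<otimes> h \<in> H" "k' \<otimes> inv k \<in> K" using assms by auto
  ultimately have "k' \<otimes> inv k \<in> H \<inter> K" by simp
  then have 1: "inv h' \<otimes> h = \<one>" "k' \<otimes> inv k = \<one>" using HK * by auto
  have "h' \<otimes> (inv h' \<otimes> h) = h'" "(k' \<otimes> inv k) \<otimes> k = k" unfolding 1 using c by simp_all
  moreover have "h' \<otimes> (inv h' \<otimes> h) = h" "(k' \<otimes> inv k) \<otimes> k = k'" using c by (simp_all add: m_assoc)
  ultimately show ?thesis by simp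
qed

text \<open>
  An instance of the open mapping theorem: by Baire's theorem some product of compact pieces of
  \<open>W\<close> and \<open>V\<close> has interior points, and there the decomposition is continuous.
\<close>

lemma (in horizontal_group) splitting_bound:
  assumes met: "Metric_space (carrier G) d" and M: "Metric_space.mtopology (carrier G) d = M"
    and d: "\<And>x y. x \<in> carrier G \<Longrightarrow> y \<in> carrier G \<Longrightarrow> d x y = nrm (inv x \<otimes> y)"
    and lc: "locally_compact_space M"
    and cont: "continuous_map (prod_topology M M) M (\<lambda>(x, y). x \<otimes> y)"
    and W: "subgroup W G" and dil_W: "\<And>r w. 0 < r \<Longrightarrow> w \<in> W \<Longrightarrow> dil r w \<in> W"
    and Int: "W \<inter> V = {\<one>}" and WV: "carrier G = W <#> V"
    and K: "\<And>n::nat. compactin M (K n)" "W = (\<Union>n. K n)"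
  shows "\<exists>C>0. \<forall>w\<in>W. \<forall>v\<in>V. nrm v \<le> C * nrm (w \<otimes> v)"
proof -
  interpret Metric_space "carrier G" d by (rule met)
  interpret W: subgroup W G by (rule W)
  have top: "topspace M = carrier G" using M topspace_mtopology by simp
  have haus: "Hausdorff_space M" using M Hausdorff_space_mtopology by simp
  have unique: "w = w' \<and> v = v'" if "w \<in> W" "v \<in> V" "w' \<in> W" "v' \<in> V" "w \<otimes> v = w' \<otimes> v'" for w v w' v'
    using complementary_unique[OF W V_subgroup Int that] .
  obtain Cv where Cv: "Cv > 0" "\<And>v. v \<in> V \<Longrightarrow> nrm v \<le> Cv * norm (xi v)" using nrm_le_xi by blast
  define e where "e = inv_into V xi"
  have e: "e (xi v) = v" if "v \<in> V" for v
    unfolding e_def using that xi_inj by simp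
  let ?P = "xi ` V"
  have ce: "continuous_map (top_of_set ?P) M e"
    unfolding M[symmetric] continuous_map_to_metric
  proof (intro ballI allI impI)
    fix z and \<epsilon> :: real assume z: "z \<in> topspace (top_of_set ?P)" and \<epsilon>: "\<epsilon> > 0"
    then obtain v where v: "v \<in> V" "z = xi v" by auto
    have "e y \<in> mball (e z) \<epsilon>" if y: "y \<in> ?P \<inter> ball z (\<epsilon> / Cv)" for y
    proof -
      obtain v' where v': "v' \<in> V" "y = xi v'" using y by auto
      have "d v v' \<le> Cv * norm (xi (inv v \<otimes> v'))" using v v' Cv(2)[of "inv v \<otimes> v'"] by (simp add: d)
      also have "\<dots> = Cv * dist z y" using v v' by (simp add: xi_mult xi_inv dist_norm norm_minus_commute)
      also have "\<dots> < \<epsilon>" using y Cv(1) by (simp add: field_simps)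
      finally show ?thesis using v v' e by simp
    qed
    moreover have "z \<in> ?P \<inter> ball z (\<epsilon> / Cv)" using z \<epsilon> Cv(1) by simp
    ultimately show "\<exists>U. openin (top_of_set ?P) U \<and> z \<in> U \<and> (\<forall>y\<in>U. e y \<in> mball (e z) \<epsilon>)"
      by (intro exI[of _ "?P \<inter> ball z (\<epsilon> / Cv)"]) (simp add: openin_open_Int)
  qed
  \<comment> \<open>\<open>xi\<close> identifies \<open>V\<close> with a closed linear subspace,
    whose balls exhaust \<open>V\<close> by compact sets.\<close>
  define B where "B n = e ` (?P \<inter> cball 0 (real n))" for n
  have B: "compactin M (B n)" for n
  proof -
    have "compact (?P \<inter> cball 0 (real n))"
      using closed_subspace[OF xi_subspace] by (simp add: closed_Int_compact)
    then have "compactin (top_of_set ?P) (?P \<inter> cball 0 (real n))" by (simp add: compactin_subtopology)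
    then show ?thesis unfolding B_def by (rule image_compactin[OF _ ce])
  qed
  have BV: "B n \<subseteq> V" for n using e by (auto simp: B_def)
  have VB: "\<exists>n. v \<in> B n" if v: "v \<in> V" for v
  proof -
    obtain n where "norm (xi v) \<le> real n" using real_arch_simple by blast
    then have "xi v \<in> ?P \<inter> cball 0 (real n)" using v by simp
    then show ?thesis using e[OF v] unfolding B_def by (metis image_eqI)
  qed
  define F where "F X Y = (\<lambda>(x, y). x \<otimes> y) ` (X \<times> Y)" for X Y
  have F: "closedin M (F X Y)" if "compactin M X" "compactin M Y" for X Y
    unfolding F_def using that
    by (intro compactin_imp_closedin[OF haus] image_compactin[OF _ cont]) (simp add: compactin_Times)
  have "\<exists>n m. M interior_of F (K n) (B m) \<noteq> {}"
  proof (rule ccontr)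
    assume "\<not> ?thesis"
    then have "M interior_of \<Union> (range (\<lambda>(n, m). F (K n) (B m))) = {}"
      using F[OF K(1) B] lc locally_compact_Hausdorff_imp_regular_space[OF lc haus]
      by (intro Baire_category_alt) auto
    moreover have "\<Union> (range (\<lambda>(n, m). F (K n) (B m))) = topspace M"
    proof
      show "\<Union> (range (\<lambda>(n, m). F (K n) (B m))) \<subseteq> topspace M"
        using F[OF K(1) B] closedin_subset by fastforce
      show "topspace M \<subseteq> \<Union> (range (\<lambda>(n, m). F (K n) (B m)))"
      proof
        fix x assume "x \<in> topspace M"
        then obtain w v where "w \<in> W" "v \<in> V" "x = w \<otimes> v" using top WV by (auto simp: set_mult_def)
        moreover obtain n where "w \<in> K n" using \<open>w \<in> W\<close> K(2) by auto
        moreover obtain m where "v \<in> B m" using VB[OF \<open>v \<in> V\<close>] by auto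
        ultimately have "x \<in> (\<lambda>(n, m). F (K n) (B m)) (n, m)" by (auto simp: F_def)
        then show "x \<in> \<Union> (range (\<lambda>(n, m). F (K n) (B m)))" by blast
      qed
    qed
    ultimately have "M interior_of topspace M = {}" by simp
    then have "topspace M = {}" unfolding interior_of_topspace .
    then show False using top one_closed by blast
  qed
  then obtain n m p0 where p0: "p0 \<in> M interior_of F (K n) (B m)" by blast
  then obtain w0 v0 where wv0: "w0 \<in> K n" "v0 \<in> B m" "p0 = w0 \<otimes> v0"
    using interior_of_subset[of M "F (K n) (B m)"] by (auto simp: F_def)
  have wv0': "w0 \<in> W" "v0 \<in> V" using wv0 K(2) BV by auto
  \<comment> \<open>Points of the compact piece whose \<open>V\<close>-component is at distance at
    least 1 from \<open>v0\<close>. This set is closed and misses \<open>p0\<close> by uniqueness,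
    so near \<open>p0\<close> the \<open>V\<close>-component is close to \<open>v0\<close>.\<close>
  define F' where "F' = F (K n) (B m - mball v0 1)"
  have "compactin M (B m - mball v0 1)"
    using compactin_imp_closedin[OF haus B] openin_mball[of v0 1] M
    by (intro closed_compactin[OF B] closedin_diff) auto
  then have F': "closedin M F'" unfolding F'_def by (rule F[OF K(1)])
  define Q where "Q = M interior_of F (K n) (B m) - F'"
  have Q: "openin M Q" unfolding Q_def using F' by (intro openin_diff) auto
  have p0Q: "p0 \<in> Q"
  proof -
    have "p0 \<notin> F'"
    proof
      assume "p0 \<in> F'"
      then obtain w v where wv: "w \<in> K n" "v \<in> B m" "v \<notin> mball v0 1" "p0 = w \<otimes> v"
        by (auto simp: F'_def F_def)
      then have "v = v0" using unique[of w v w0 v0] wv0 wv0' K(2) BV by blast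
      then show False using wv wv0' by simp
    qed
    then show ?thesis using p0 by (simp add: Q_def)
  qed
  \<comment> \<open>Moves the identity to \<open>p0\<close> compatibly with the splitting: \<open>f
    (w \<otimes> v) = (w0 \<otimes> w) \<otimes> (v \<otimes> v0)\<close>. Continuity at
    \<open>p0\<close> is thereby transported to the identity.\<close>
  define f where "f x = w0 \<otimes> (x \<otimes> v0)" for x
  have pair: "continuous_map M M (\<lambda>x. g x \<otimes> h x)" if "continuous_map M M g" "continuous_map M M h" for g h
    using continuous_map_compose[OF continuous_map_pairedI[OF that] cont] by (simp add: o_def)
  have "continuous_map M M f"
    unfolding f_def using wv0' by (intro pair) (auto simp: top)
  from openin_continuous_map_preimage[OF this Q]
  have "openin M {x \<in> carrier G. f x \<in> Q}" by (simp add: top)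
  moreover have "\<one> \<in> {x \<in> carrier G. f x \<in> Q}" using p0Q wv0 wv0' by (simp add: f_def)
  ultimately obtain \<tau> where \<tau>: "\<tau> > 0" "mball \<one> \<tau> \<subseteq> {x \<in> carrier G. f x \<in> Q}"
    unfolding M[symmetric] openin_mtopology by blast
  have small: "nrm v < 1" if wv: "w \<in> W" "v \<in> V" and s: "nrm (w \<otimes> v) < \<tau>" for w v
  proof -
    have "w \<otimes> v \<in> mball \<one> \<tau>" using wv s by (simp add: d)
    then have fQ: "f (w \<otimes> v) \<in> Q" using \<tau>(2) by blast
    then have "f (w \<otimes> v) \<in> F (K n) (B m)" "f (w \<otimes> v) \<notin> F'"
      using interior_of_subset[of M "F (K n) (B m)"] by (auto simp: Q_def)
    then obtain w' v' where wv': "w' \<in> K n" "v' \<in> B m" "f (w \<otimes> v) = w' \<otimes> v'"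
      by (auto simp: F_def)
    have near: "v' \<in> mball v0 1"
    proof (rule ccontr)
      assume "v' \<notin> mball v0 1"
      then have "f (w \<otimes> v) \<in> F'" using wv' unfolding F'_def F_def by (intro image_eqI[of _ _ "(w', v')"]) auto
      then show False using \<open>f (w \<otimes> v) \<notin> F'\<close> by blast
    qed
    have "(w0 \<otimes> w) \<otimes> (v \<otimes> v0) = w' \<otimes> v'"
      using wv' wv wv0' by (simp add: f_def m_assoc)
    moreover have "w' \<in> W" using wv'(1) K(2) by auto
    moreover have "v' \<in> V" using wv'(2) BV by auto
    moreover have "w0 \<otimes> w \<in> W" "v \<otimes> v0 \<in> V" using wv wv0' by auto
    ultimately have "v \<otimes> v0 = v'" using unique by metis
    then have v': "v' = v0 \<otimes> v" using V_commute[of v v0] wv wv0' by simp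
    have "inv v0 \<otimes> v' = v" unfolding v' using wv wv0' by simp
    then show ?thesis using near d[of v0 v'] by simp
  qed
  have "nrm v \<le> 2 / \<tau> * nrm (w \<otimes> v)" if wv: "w \<in> W" "v \<in> V" for w v
  proof (cases "w \<otimes> v = \<one>")
    case True
    then have "v = \<one>" using unique[of w v \<one> \<one>] wv by simp
    then show ?thesis using True by simp
  next
    case False
    have c: "w \<in> carrier G" "w \<otimes> v \<in> carrier G" using wv by auto
    then have pos: "nrm (w \<otimes> v) > 0" using False nrm_nonneg[of "w \<otimes> v"] nrm_eq_0[of "w \<otimes> v"] by linarith
    define r where "r = \<tau> / 2 / nrm (w \<otimes> v)"
    have r: "r > 0" using \<tau>(1) pos by (simp add: r_def)
    have "nrm (dil r w \<otimes> dil r v) = r * nrm (w \<otimes> v)"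
      using dil_mult[OF r c(1), of v] nrm_dil[OF r c(2)] wv by simp
    also have "\<dots> < \<tau>" using pos \<tau>(1) by (simp add: r_def)
    finally have "nrm (dil r v) < 1" using wv r by (intro small[of "dil r w"]) (auto simp: dil_W dil_V)
    then have "r * nrm v < 1" using wv r by (simp add: nrm_dil)
    then show ?thesis using pos \<tau>(1) by (simp add: r_def field_simps)
  qed
  then show ?thesis using \<tau>(1) by (intro exI[of _ "2 / \<tau>"]) auto
qed

locale split_group = horizontal_group G nrm \<kappa> R dil V
  for G (structure) and nrm and \<kappa> :: "'a \<Rightarrow> 'e::euclidean_space" and R and dil and V +
  fixes W :: "'a set"
  assumes W_subgroup: "subgroup W G"
    and dil_W: "0 < r \<Longrightarrow> w \<in> W \<Longrightarrow> dil r w \<in> W"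
    and W_Int_V: "W \<inter> V = {\<one>}"
    and W_times_V: "carrier G = W <#> V"
    and right_bound: "\<exists>C>0. \<forall>w\<in>W. \<forall>v\<in>V. nrm v \<le> C * nrm (w \<otimes> v)"
begin

sublocale W: subgroup W G by (rule W_subgroup)

lemma W_carrier [simp]: "w \<in> W \<Longrightarrow> w \<in> carrier G"
  by (rule W.mem_carrier)

lemma W_pow: "w \<in> W \<Longrightarrow> w [^] (n::nat) \<in> W"
  by (induction n) auto

abbreviation lp where "lp \<equiv> left_part G W V"
abbreviation rp where "rp \<equiv> right_part G W V"

lemma decompose: "x \<in> carrier G \<Longrightarrow> \<exists>w\<in>W. \<exists>v\<in>V. x = w \<otimes> v"
  using W_times_V by (auto simp: set_mult_def)

lemma decompose_unique:
  assumes "w \<in> W" "v \<in> V" "w' \<in> W" "v' \<in> V" "w \<otimes> v = w' \<otimes> v'"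
  shows "w = w' \<and> v = v'"
  using complementary_unique[OF W_subgroup V_subgroup W_Int_V assms] .

lemma parts [simp]:
  assumes "w \<in> W" "v \<in> V"
  shows "lp (w \<otimes> v) = w" "rp (w \<otimes> v) = v"
  unfolding left_part_def right_part_def using assms
  by (auto intro!: the_equality dest: decompose_unique)

lemma
  assumes "x \<in> carrier G"
  shows parts_in: "lp x \<in> W" "rp x \<in> V" and parts_mult: "lp x \<otimes> rp x = x"
proof -
  obtain w v where "w \<in> W" "v \<in> V" "x = w \<otimes> v" using decompose[OF assms] by blast
  then show "lp x \<in> W" "rp x \<in> V" "lp x \<otimes> rp x = x" by simp_all
qed

lemma rp_V [simp]: "v \<in> V \<Longrightarrow> rp v = v" and lp_V [simp]: "v \<in> V \<Longrightarrow> lp v = \<one>"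
  using parts[of \<one> v] by auto

text \<open>
  The dilates by \<open>1 / m\<close> of the commutator \<open>v0 w0 v0\<^sup>-\<^sup>1 w0\<^sup>-\<^sup>1 = w v\<close> are \<open>o(1 / m)\<close>.
  Hence the \<open>m\<close>-th powers of the elements \<open>dil (1 / m) w\<close> of \<open>W\<close> tend to \<open>v\<^sup>-\<^sup>1\<close>, which forces
  \<open>v = \<one>\<close>.
\<close>

lemma commutator_in_W:
  assumes v0: "v0 \<in> V" and w0: "w0 \<in> W"
  shows "v0 \<otimes> w0 \<otimes> inv v0 \<otimes> inv w0 \<in> W"
proof -
  define q where "q = v0 \<otimes> w0 \<otimes> inv v0 \<otimes> inv w0"
  have q: "q \<in> carrier G" using v0 w0 by (simp add: q_def)
  define w where "w = lp q"
  define v where "v = rp q"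
  have wv: "w \<in> W" "v \<in> V" "q = w \<otimes> v"
    using parts_in[OF q] parts_mult[OF q] by (auto simp: w_def v_def)
  obtain C where C: "C > 0" "\<And>w v. w \<in> W \<Longrightarrow> v \<in> V \<Longrightarrow> nrm v \<le> C * nrm (w \<otimes> v)"
    using right_bound by blast
  obtain C2 r2 where C2: "C2 > 0" "r2 > 0" "\<And>b. b \<in> carrier G \<Longrightarrow> nrm b < r2 \<Longrightarrow> norm (\<kappa> b) \<le> C2 * nrm b"
    using chart_le_nrm by blast
  \<comment> \<open>Here \<open>v\<close> is the \<open>V\<close>-component of the commutator; it
    has to be trivial.\<close>
  have "nrm v \<le> C * e" if e: "e > 0" for e
  proof -
    define K where "K = nrm v + 1"
    have K: "K > 0" using nrm_nonneg[of v] wv by (simp add: K_def)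
    obtain C1 t r e' where step: "C1 > 0" "t > 0" "r > 0" "0 < e'" "e' \<le> e"
      and step': "\<forall>q\<in>carrier G. \<forall>u\<in>V. \<forall>b\<in>carrier G. nrm u \<le> K \<longrightarrow> nrm b < r \<longrightarrow> nrm q < e' \<longrightarrow>
        norm (\<kappa> q) + C1 * norm (\<kappa> b) < t \<longrightarrow>
        norm (\<kappa> (q \<otimes> (u \<otimes> b \<otimes> inv u))) \<le> norm (\<kappa> q) + C1 * norm (\<kappa> b) \<and>
        nrm (q \<otimes> (u \<otimes> b \<otimes> inv u)) < e'"
      using chart_step[OF K e] by (elim exE conjE) (rule that)
    \<comment> \<open>With the commutator estimate at accuracy \<open>t / B\<close>, even
      \<open>m\<close> copies of \<open>C1 * norm (\<kappa> qm)\<close> add up to less than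
      \<open>t\<close>, as \<open>chart_step\<close> requires.\<close>
    define B where "B = C1 * C2 * (nrm v0 + nrm w0) + 1"
    have B: "B > 0" using step(1) C2(1) nrm_nonneg[of v0] nrm_nonneg[of w0] v0 w0
      by (simp add: B_def add_nonneg_pos)
    obtain r3 where r3: "r3 > 0" "\<And>x y. x \<in> carrier G \<Longrightarrow> y \<in> carrier G \<Longrightarrow> nrm x < r3 \<Longrightarrow> nrm y < r3 \<Longrightarrow>
       norm (\<kappa> (x \<otimes> y \<otimes> inv x \<otimes> inv y)) \<le> t / B * (norm (\<kappa> x) + norm (\<kappa> y))"
      using chart_commutator[of "t / B"] divide_pos_pos[OF step(2) B] by blast
    have small: "\<forall>\<^sub>F m in sequentially. nrm (dil (1 / real m) x) < s" if "x \<in> carrier G" "s > 0" for x s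
    proof -
      have "(\<lambda>m. nrm x / real m) \<longlonglongrightarrow> 0" by (rule lim_const_over_n)
      from order_tendstoD(2)[OF this that(2)] eventually_gt_at_top[of 0] show ?thesis
        by eventually_elim (use that in \<open>simp add: nrm_dil\<close>)
    qed
    have ev: "\<forall>\<^sub>F m::nat in sequentially. m > 0 \<and> nrm (dil (1 / real m) q) < r \<and>
       nrm (dil (1 / real m) v0) < min r2 r3 \<and> nrm (dil (1 / real m) w0) < min r2 r3"
      using v0 w0 q step r3 C2 by (intro eventually_conj small) (auto intro: eventually_gt_at_top)
    obtain m :: nat where m: "m > 0" "nrm (dil (1 / real m) q) < r"
        "nrm (dil (1 / real m) v0) < min r2 r3" "nrm (dil (1 / real m) w0) < min r2 r3"
      using eventually_happens'[OF sequentially_bot ev] by auto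
    define qm where "qm = dil (1 / real m) q"
    define vm where "vm = dil (1 / real m) v"
    define wm where "wm = dil (1 / real m) w"
    define a where "a = dil (1 / real m) v0"
    define b where "b = dil (1 / real m) w0"
    have in_car: "qm \<in> carrier G" "vm \<in> V" "wm \<in> W" "a \<in> carrier G" "b \<in> carrier G"
      using m q wv v0 w0 by (auto simp: qm_def vm_def wm_def a_def b_def dil_V dil_W)
    have qm: "qm = wm \<otimes> vm" using wv m by (simp add: qm_def vm_def wm_def dil_mult)
    have qc: "qm = a \<otimes> b \<otimes> inv a \<otimes> inv b"
      using v0 w0 m by (simp add: qm_def q_def a_def b_def dil_mult dil_inv)
    have vmm: "vm [^] m = v" using dil_pow[of v "1 / real m" m] wv m dil_1 by (simp add: vm_def)
    have kq: "C1 * norm (\<kappa> qm) < t / real m"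
    proof -
      have "norm (\<kappa> qm) \<le> t / B * (norm (\<kappa> a) + norm (\<kappa> b))"
        unfolding qc using m in_car by (intro r3) (auto simp: a_def b_def)
      also have "\<dots> \<le> t / B * (C2 * nrm a + C2 * nrm b)"
        using m in_car B step by (intro mult_left_mono add_mono C2) (auto simp: a_def b_def)
      also have "\<dots> = t / B * (C2 * (nrm v0 + nrm w0) / real m)"
        using v0 w0 m by (simp add: a_def b_def nrm_dil algebra_simps add_divide_distrib)
      finally have "norm (\<kappa> qm) \<le> t / B * (C2 * (nrm v0 + nrm w0) / real m)" .
      then have "C1 * norm (\<kappa> qm) \<le> C1 * (t / B * (C2 * (nrm v0 + nrm w0) / real m))"
        using step(1) by (intro mult_left_mono) auto
      also have "\<dots> = t / real m * ((C1 * C2 * (nrm v0 + nrm w0)) / B)"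
        by (simp add: mult.commute mult.left_commute)
      also have "\<dots> = t / real m * ((B - 1) / B)" by (simp add: B_def)
      also have "\<dots> < t / real m * 1"
        using B m step by (intro mult_strict_left_mono) auto
      finally show ?thesis by simp
    qed
    \<comment> \<open>Since \<open>wm = qm \<otimes> inv vm\<close>, collecting the powers of
      \<open>inv vm\<close> on the right turns each factor \<open>qm\<close> into its conjugate by
      \<open>u = inv (vm [^] j)\<close>, whose norm is at most \<open>nrm v\<close>. So
      \<open>Q\<close> grows by one \<open>chart_step\<close> at a time.\<close>
    have "\<exists>Q\<in>carrier G. wm [^] j = Q \<otimes> inv (vm [^] j) \<and> nrm Q < e' \<and> norm (\<kappa> Q) \<le> real j * (C1 * norm (\<kappa> qm))"
      if "j \<le> m" for j
      using that
    proof (induction j)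
      case 0
      show ?case using step by (intro bexI[of _ \<one>]) auto
    next
      case (Suc j)
      then obtain Q where Q: "Q \<in> carrier G" "wm [^] j = Q \<otimes> inv (vm [^] j)" "nrm Q < e'"
        "norm (\<kappa> Q) \<le> real j * (C1 * norm (\<kappa> qm))" by auto
      let ?u = "inv (vm [^] j)"
      have u: "?u \<in> V" "vm [^] j \<in> V" using in_car by (auto simp: V_pow)
      have "nrm ?u \<le> real j * (nrm v / real m)"
        using nrm_pow[of vm j] u in_car wv m by (simp add: nrm_inv vm_def nrm_dil)
      also have "\<dots> \<le> real m * (nrm v / real m)"
        using Suc.prems nrm_nonneg[of v] wv by (intro mult_right_mono) auto
      also have "\<dots> \<le> K" using m by (simp add: K_def)
      finally have uK: "nrm ?u \<le> K" .
      have bd: "norm (\<kappa> Q) + C1 * norm (\<kappa> qm) \<le> real (Suc j) * (C1 * norm (\<kappa> qm))"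
        using Q(4) by (simp add: algebra_simps)
      also have "\<dots> \<le> real m * (C1 * norm (\<kappa> qm))"
        using Suc.prems step by (intro mult_right_mono) auto
      also have "\<dots> < t" using kq m by (simp add: field_simps)
      finally have lt: "norm (\<kappa> Q) + C1 * norm (\<kappa> qm) < t" .
      let ?Q = "Q \<otimes> (?u \<otimes> qm \<otimes> inv ?u)"
      have st: "norm (\<kappa> ?Q) \<le> norm (\<kappa> Q) + C1 * norm (\<kappa> qm) \<and> nrm ?Q < e'"
        using Q u in_car uK lt m by (intro step'[rule_format]) (auto simp: qm_def)
      have "wm = qm \<otimes> inv vm" unfolding qm using in_car by (simp add: m_assoc)
      moreover have "inv (vm [^] Suc j) = ?u \<otimes> inv vm"
        unfolding nat_pow_Suc2[OF V_carrier[OF in_car(2)]] using in_car u by (simp add: inv_mult_group)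
      ultimately have "wm [^] Suc j = ?Q \<otimes> inv (vm [^] Suc j)"
        using in_car u Q by (simp add: m_assoc)
      then show ?case using st bd Q(1) u in_car by (intro bexI[of _ ?Q]) auto
    qed
    from this[of m] obtain Q where Q: "Q \<in> carrier G" "wm [^] m = Q \<otimes> inv v" "nrm Q < e'"
      by (auto simp: vmm)
    \<comment> \<open>The small element \<open>Q\<close> has \<open>W\<close>-part
      \<open>wm [^] m\<close> and \<open>V\<close>-part \<open>v\<close>, so \<open>v\<close> is
      small as well.\<close>
    have "wm [^] m \<otimes> v = Q" using Q wv by (simp add: m_assoc)
    then have "nrm v \<le> C * nrm Q" using C(2)[of "wm [^] m" v] wv in_car W_pow by auto
    also have "\<dots> \<le> C * e" using C Q step by (intro mult_left_mono) auto
    finally show ?thesis .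
  qed
  from this[of "_ / C"] have "nrm v \<le> 0" using C(1) field_le_epsilon[of "nrm v" 0] by simp
  then have "v = \<one>" using nrm_nonneg[of v] nrm_eq_0[of v] wv by auto
  then show ?thesis using wv unfolding q_def[symmetric] by simp
qed

lemma conj_in_W:
  assumes "v \<in> V" "w \<in> W" shows "v \<otimes> w \<otimes> inv v \<in> W"
proof -
  have "v \<otimes> w \<otimes> inv v = (v \<otimes> w \<otimes> inv v \<otimes> inv w) \<otimes> w" using assms by (simp add: m_assoc)
  then show ?thesis using commutator_in_W[OF assms] assms by (metis W.m_closed)
qed

text \<open>By normality \<open>lp y\<close> stays in \<open>W\<close> when it is moved to the left
  past \<open>rp x\<close>.\<close>

lemma rp_mult:
  assumes "x \<in> carrier G" "y \<in> carrier G" shows "rp (x \<otimes> y) = rp x \<otimes> rp y"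
proof -
  have "x \<otimes> y = (lp x \<otimes> (rp x \<otimes> lp y \<otimes> inv (rp x))) \<otimes> (rp x \<otimes> rp y)"
    using assms parts_in[OF assms(1)] parts_in[OF assms(2)]
    by (subst parts_mult[OF assms(1), symmetric], subst parts_mult[OF assms(2), symmetric]) (simp add: m_assoc)
  then show ?thesis using assms parts_in by (simp add: conj_in_W)
qed

lemma rp_inv:
  assumes x: "x \<in> carrier G" shows "rp (inv x) = inv (rp x)"
proof -
  have "rp (inv x) \<otimes> rp x = \<one>" using rp_mult[of "inv x" x] x by simp
  then show ?thesis using x parts_in[of x] parts_in[of "inv x"] by (simp add: inv_equality)
qed

lemma parts_dil:
  assumes "0 < r" "x \<in> carrier G"
  shows "lp (dil r x) = dil r (lp x)" "rp (dil r x) = dil r (rp x)"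
proof -
  have "dil r x = dil r (lp x) \<otimes> dil r (rp x)"
    using dil_mult[of r "lp x" "rp x"] parts_mult[of x] parts_in[of x] assms by simp
  moreover have "dil r (lp x) \<in> W" "dil r (rp x) \<in> V" using assms parts_in dil_W dil_V by auto
  ultimately show "lp (dil r x) = dil r (lp x)" "rp (dil r x) = dil r (rp x)" by simp_all
qed

section \<open>The homomorphism onto \<open>V\<close> and cheap paths\<close>

definition \<rho> :: "'a \<Rightarrow> 'e" where "\<rho> x = xi (rp x)"

lemma rho_mult: "x \<in> carrier G \<Longrightarrow> y \<in> carrier G \<Longrightarrow> \<rho> (x \<otimes> y) = \<rho> x + \<rho> y"
  by (simp add: \<rho>_def rp_mult xi_mult parts_in)

lemma rho_inv: "x \<in> carrier G \<Longrightarrow> \<rho> (inv x) = - \<rho> x"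
  by (simp add: \<rho>_def rp_inv xi_inv parts_in)

lemma rho_dil: "0 < r \<Longrightarrow> x \<in> carrier G \<Longrightarrow> \<rho> (dil r x) = r *\<^sub>R \<rho> x"
  by (simp add: \<rho>_def parts_dil xi_dil parts_in)

text \<open>Paths as words, with \<open>c\<close> the total price: a letter in \<open>V\<close> may
  be bought at rate \<open>\<eta>\<close>, any letter at rate \<open>N\<close>. The infimum of the
  prices of \<open>inv x \<otimes> y\<close> is the pseudo-distance between \<open>x\<close> and
  \<open>y\<close>.\<close>

inductive reach :: "real \<Rightarrow> real \<Rightarrow> 'a \<Rightarrow> real \<Rightarrow> bool" for \<eta> N where
  reach_one: "reach \<eta> N \<one> 0"
| reach_V: "reach \<eta> N p c \<Longrightarrow> v \<in> V \<Longrightarrow> reach \<eta> N (p \<otimes> v) (c + \<eta> * nrm v)"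
| reach_G: "reach \<eta> N p c \<Longrightarrow> b \<in> carrier G \<Longrightarrow> reach \<eta> N (p \<otimes> b) (c + N * nrm b)"

lemma reach_carrier: "reach \<eta> N p c \<Longrightarrow> p \<in> carrier G"
  by (induction rule: reach.induct) auto

lemma reach_nonneg: "reach \<eta> N p c \<Longrightarrow> 0 \<le> \<eta> \<Longrightarrow> 0 \<le> N \<Longrightarrow> 0 \<le> c"
  by (induction rule: reach.induct) (auto simp: nrm_nonneg)

lemma reach_mult:
  assumes p: "reach \<eta> N p c" and q: "reach \<eta> N q c'" shows "reach \<eta> N (p \<otimes> q) (c + c')"
  using q
proof (induction rule: reach.induct)
  case reach_one
  then show ?case using p reach_carrier[OF p] by simp
next
  case (reach_V q c' v)
  then show ?case using reach.reach_V[OF reach_V.IH reach_V.hyps(2)] reach_carrier[OF p] reach_carrier[of \<eta> N q c']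
    by (simp add: m_assoc algebra_simps)
next
  case (reach_G q c' v)
  then show ?case using reach.reach_G[OF reach_G.IH reach_G.hyps(2)] reach_carrier[OF p] reach_carrier[of \<eta> N q c']
    by (simp add: m_assoc algebra_simps)
qed

lemma reach_single_V: "v \<in> V \<Longrightarrow> reach \<eta> N v (\<eta> * nrm v)"
  using reach_V[OF reach_one, of v] by simp

lemma reach_single: "b \<in> carrier G \<Longrightarrow> reach \<eta> N b (N * nrm b)"
  using reach_G[OF reach_one, of b] by simp

lemma reach_inv: "reach \<eta> N p c \<Longrightarrow> reach \<eta> N (inv p) c"
proof (induction rule: reach.induct)
  case reach_one
  then show ?case using reach.reach_one by simp
next
  case (reach_V p c v)
  then show ?case using reach_mult[OF reach_single_V[of "inv v"] reach_V.IH] reach_carrier[of \<eta> N p c]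
    by (simp add: inv_mult_group nrm_inv add.commute)
next
  case (reach_G p c v)
  then show ?case using reach_mult[OF reach_single[of "inv v"] reach_G.IH] reach_carrier[of \<eta> N p c]
    by (simp add: inv_mult_group nrm_inv add.commute)
qed

lemma reach_dil: "reach \<eta> N p c \<Longrightarrow> 0 < r \<Longrightarrow> reach \<eta> N (dil r p) (r * c)"
proof (induction rule: reach.induct)
  case reach_one
  have "dil r \<one> = \<one>" using dil_mult[of r \<one> \<one>] reach_one by simp
  then show ?case using reach.reach_one by simp
next
  case (reach_V p c v)
  then show ?case using reach.reach_V[OF reach_V.IH dil_V[of r v]] reach_carrier[of \<eta> N p c]
    by (simp add: dil_mult nrm_dil algebra_simps)
next
  case (reach_G p c v)
  then show ?case using reach.reach_G[OF reach_G.IH dil_closed[of r v]] reach_carrier[of \<eta> N p c]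
    by (simp add: dil_mult nrm_dil algebra_simps)
qed

lemma lp_bound: "\<exists>C>0. \<forall>x\<in>carrier G. nrm (lp x) \<le> C * nrm x"
proof -
  obtain C where C: "C > 0" "\<And>w v. w \<in> W \<Longrightarrow> v \<in> V \<Longrightarrow> nrm v \<le> C * nrm (w \<otimes> v)"
    using right_bound by blast
  have "nrm (lp x) \<le> (1 + C) * nrm x" if x: "x \<in> carrier G" for x
  proof -
    have "lp x = x \<otimes> inv (rp x)" using parts_mult[OF x] parts_in[OF x] x
      by (metis V_carrier W_carrier inv_solve_right)
    then have "nrm (lp x) \<le> nrm x + nrm (rp x)"
      using nrm_mult[of x "inv (rp x)"] nrm_inv[of "rp x"] x parts_in(2)[OF x] by simp
    also have "nrm (rp x) \<le> C * nrm x" using C(2)[OF parts_in[OF x]] parts_mult[OF x] by simp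
    finally show ?thesis by (simp add: algebra_simps)
  qed
  then show ?thesis using C(1) by (intro exI[of _ "1 + C"]) auto
qed

text \<open>
  When \<open>N\<close> is large, a path from \<open>\<one>\<close> to \<open>p\<close> of cost less than \<open>norm (\<rho> p)\<close> runs almost
  entirely along \<open>V\<close>, so that \<open>p\<close> lies in the cone.
\<close>

lemma cheap_in_cone:
  assumes \<alpha>: "0 < \<alpha>" and \<eta>: "0 < \<eta>"
  shows "\<exists>N>0. \<forall>p c. reach \<eta> N p c \<longrightarrow> c < norm (\<rho> p) \<longrightarrow> nrm (lp p) \<le> \<alpha> * nrm (rp p)"
proof -
  obtain C3 where C3: "C3 > 0" "\<And>x. x \<in> carrier G \<Longrightarrow> nrm (lp x) \<le> C3 * nrm x" using lp_bound by blast
  obtain Cx where Cx: "Cx > 0" "\<And>v. v \<in> V \<Longrightarrow> norm (xi v) \<le> Cx * nrm v" using xi_le_nrm by blast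
  obtain C2 r2 where C2: "C2 > 0" "r2 > 0" "\<And>b. b \<in> carrier G \<Longrightarrow> nrm b < r2 \<Longrightarrow> norm (\<kappa> b) \<le> C2 * nrm b"
    using chart_le_nrm by blast
  \<comment> \<open>After normalization to \<open>norm (\<rho> p) = 1\<close> the
    \<open>V\<close>-part has norm at least \<open>1 / Cx\<close>. A remainder \<open>q\<close> of
    norm below \<open>\<alpha> / (Cx * C3)\<close> has \<open>W\<close>-part at most
    \<open>\<alpha> / Cx\<close>, which is what the cone asks for.\<close>
  have K: "1 / \<eta> > 0" and e: "\<alpha> / (Cx * C3) > 0" using \<alpha> \<eta> C3 Cx by auto
  obtain C1 t r e' where step: "C1 > 0" "t > 0" "r > 0" "0 < e'" "e' \<le> \<alpha> / (Cx * C3)"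
      and step': "\<forall>q\<in>carrier G. \<forall>u\<in>V. \<forall>b\<in>carrier G. nrm u \<le> 1 / \<eta> \<longrightarrow> nrm b < r \<longrightarrow> nrm q < e' \<longrightarrow>
        norm (\<kappa> q) + C1 * norm (\<kappa> b) < t \<longrightarrow>
        norm (\<kappa> (q \<otimes> (u \<otimes> b \<otimes> inv u))) \<le> norm (\<kappa> q) + C1 * norm (\<kappa> b) \<and>
        nrm (q \<otimes> (u \<otimes> b \<otimes> inv u)) < e'"
    using chart_step[OF K e] by (elim exE conjE) (rule that)
  \<comment> \<open>A path of price below 1 then has expensive moves of total norm below
    \<open>1 / N\<close>: each is small enough for \<open>chart_step\<close> and
    \<open>chart_le_nrm\<close>, and together their weighted chart values stay below
    \<open>t\<close>.\<close>
  define N where "N = 1 / min (min r r2) (t / (C1 * C2))"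
  have N: "N > 0" "1 / N \<le> r" "1 / N \<le> r2" "1 / N \<le> t / (C1 * C2)"
    using step C2 by (auto simp: N_def)
  \<comment> \<open>All moves along \<open>V\<close> are collected on the right in \<open>u\<close>;
    an expensive move \<open>b\<close> passes \<open>u\<close> as
    \<open>u \<otimes> b \<otimes> inv u\<close> and joins \<open>q\<close>.\<close>
  have path: "\<exists>q\<in>carrier G. \<exists>u\<in>V. p = q \<otimes> u \<and> nrm u \<le> c / \<eta> \<and> nrm q < e' \<and> norm (\<kappa> q) \<le> C1 * C2 * (c / N)"
    if "reach \<eta> N p c" "c < 1" for p c
    using that
  proof (induction rule: reach.induct)
    case reach_one
    show ?case using step by (intro bexI[of _ \<one>]) auto
  next
    case (reach_V p c v)
    have nv: "nrm v \<ge> 0" using reach_V nrm_nonneg by auto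
    have "c < 1" using reach_V.prems mult_nonneg_nonneg[of \<eta> "nrm v"] \<eta> nv by linarith
    then obtain q u where q: "q \<in> carrier G" "u \<in> V" "p = q \<otimes> u" "nrm u \<le> c / \<eta>" "nrm q < e'"
        "norm (\<kappa> q) \<le> C1 * C2 * (c / N)"
      using reach_V.IH by blast
    have "nrm (u \<otimes> v) \<le> (c + \<eta> * nrm v) / \<eta>"
      using nrm_mult[of u v] q reach_V.hyps \<eta> by (simp add: add_divide_distrib)
    moreover have "C1 * C2 * (c / N) \<le> C1 * C2 * ((c + \<eta> * nrm v) / N)"
      using step C2 N \<eta> nv by (intro mult_left_mono divide_right_mono) auto
    ultimately show ?case using q reach_V.hyps
      by (intro bexI[of _ q] bexI[of _ "u \<otimes> v"]) (auto simp: m_assoc)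
  next
    case (reach_G p c b)
    have nb: "nrm b \<ge> 0" using reach_G nrm_nonneg by auto
    have "c < 1" using reach_G.prems mult_nonneg_nonneg[of N "nrm b"] N(1) nb by linarith
    then obtain q u where q: "q \<in> carrier G" "u \<in> V" "p = q \<otimes> u" "nrm u \<le> c / \<eta>" "nrm q < e'"
        "norm (\<kappa> q) \<le> C1 * C2 * (c / N)"
      using reach_G.IH by blast
    have c0: "0 \<le> c" using reach_nonneg[OF reach_G.hyps(1)] \<eta> N by auto
    have bN: "nrm b < 1 / N" using reach_G.prems c0 N(1) by (simp add: field_simps)
    have kb: "norm (\<kappa> b) \<le> C2 * nrm b" using bN N reach_G.hyps by (intro C2(3)) auto
    have "norm (\<kappa> q) + C1 * norm (\<kappa> b) \<le> C1 * C2 * (c / N) + C1 * (C2 * nrm b)"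
      using q kb step by (intro add_mono mult_left_mono) auto
    also have eqn: "\<dots> = C1 * C2 * ((c + N * nrm b) / N)" using N(1) by (simp add: field_simps)
    finally have tot: "norm (\<kappa> q) + C1 * norm (\<kappa> b) \<le> C1 * C2 * ((c + N * nrm b) / N)" .
    have "C1 * C2 * ((c + N * nrm b) / N) = (C1 * C2 * (c + N * nrm b)) * (1 / N)" by simp
    also have "\<dots> \<le> (C1 * C2 * (c + N * nrm b)) * (t / (C1 * C2))"
      using N step C2 c0 nb by (intro mult_left_mono) auto
    also have "\<dots> = (c + N * nrm b) * t" using step C2 by simp
    also have "\<dots> < 1 * t" using reach_G.prems step by (intro mult_strict_right_mono) auto
    finally have lt: "norm (\<kappa> q) + C1 * norm (\<kappa> b) < t" using tot by simp
    let ?q = "q \<otimes> (u \<otimes> b \<otimes> inv u)"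
    have "c / \<eta> \<le> 1 / \<eta>" using \<open>c < 1\<close> \<eta> by (intro divide_right_mono) auto
    then have st: "norm (\<kappa> ?q) \<le> norm (\<kappa> q) + C1 * norm (\<kappa> b) \<and> nrm ?q < e'"
      using q reach_G.hyps bN N lt by (intro step'[rule_format]) auto
    have "c / \<eta> \<le> (c + N * nrm b) / \<eta>" using N nb \<eta> by (intro divide_right_mono) auto
    moreover have "p \<otimes> b = ?q \<otimes> u" using q reach_G.hyps by (simp add: m_assoc)
    ultimately show ?case using st tot q reach_G.hyps
      by (intro bexI[of _ ?q] bexI[of _ u]) auto
  qed
  have unit: "nrm (lp p) \<le> \<alpha> * nrm (rp p)" if p: "reach \<eta> N p c" "c < 1" "norm (\<rho> p) = 1" for p c
  proof -
    have pc: "p \<in> carrier G" using reach_carrier[OF p(1)] .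
    obtain q u where q: "q \<in> carrier G" "u \<in> V" "p = q \<otimes> u" "nrm q < e'" using path[OF p(1,2)] by blast
    have "p = lp q \<otimes> (rp q \<otimes> u)"
      using q parts_mult[OF q(1)] parts_in[OF q(1)] m_assoc[of "lp q" "rp q" u] by simp
    then have "lp p = lp q" using q parts_in[OF q(1)] by simp
    then have "nrm (lp p) \<le> C3 * nrm q" using C3(2)[OF q(1)] by simp
    also have "\<dots> \<le> C3 * (\<alpha> / (Cx * C3))" using q step C3 by (intro mult_left_mono) auto
    also have "\<dots> = \<alpha> * (1 / Cx)" using C3 by simp
    also have "\<dots> \<le> \<alpha> * nrm (rp p)"
      using \<alpha> Cx(2)[OF parts_in(2)[OF pc]] p(3) Cx(1)
      by (intro mult_left_mono) (auto simp: \<rho>_def field_simps)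
    finally show ?thesis .
  qed
  have "nrm (lp p) \<le> \<alpha> * nrm (rp p)" if p: "reach \<eta> N p c" "c < norm (\<rho> p)" for p c
  proof -
    have pc: "p \<in> carrier G" using reach_carrier[OF p(1)] .
    have c0: "0 \<le> c" using reach_nonneg[OF p(1)] \<eta> N by auto
    then have pos: "norm (\<rho> p) > 0" using p(2) by linarith
    \<comment> \<open>Prices, \<open>\<rho>\<close> and both sides of the cone inequality scale
      linearly under dilations.\<close>
    define s where "s = 1 / norm (\<rho> p)"
    have s: "s > 0" using pos by (simp add: s_def)
    have "nrm (lp (dil s p)) \<le> \<alpha> * nrm (rp (dil s p))"
      using reach_dil[OF p(1) s] p(2) pos s pc by (intro unit[of _ "s * c"]) (auto simp: s_def rho_dil)
    then show ?thesis using s pc parts_in[OF pc] by (simp add: parts_dil nrm_dil)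
  qed
  then show ?thesis using N(1) by blast
qed

end

section \<open>Extension of graphs\<close>

lemma mcshane_real:
  fixes F :: "'a \<Rightarrow> real" and q :: "'a \<Rightarrow> 'a \<Rightarrow> real"
  assumes S: "S \<subseteq> X" "S \<noteq> {}"
    and refl: "\<And>x. x \<in> X \<Longrightarrow> q x x = 0" and sym: "\<And>x y. x \<in> X \<Longrightarrow> y \<in> X \<Longrightarrow> q x y = q y x"
    and tri: "\<And>x y z. x \<in> X \<Longrightarrow> y \<in> X \<Longrightarrow> z \<in> X \<Longrightarrow> q x z \<le> q x y + q y z"
    and F: "\<And>x y. x \<in> S \<Longrightarrow> y \<in> S \<Longrightarrow> \<bar>F x - F y\<bar> \<le> q x y"
  shows "\<exists>H. (\<forall>x\<in>S. H x = F x) \<and> (\<forall>x\<in>X. \<forall>y\<in>X. \<bar>H x - H y\<bar> \<le> q x y)"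
proof -
  define H where "H x = (INF s\<in>S. F s + q s x)" for x
  have low: "F s0 - q s0 x \<le> F s + q s x" if "s0 \<in> S" "s \<in> S" "x \<in> X" for s0 s x
    using F[of s0 s] tri[of s0 x s] sym[of x s] that S by (smt (verit) in_mono)
  have bdd: "bdd_below ((\<lambda>s. F s + q s x) ` S)" if "x \<in> X" for x
  proof -
    obtain s0 where "s0 \<in> S" using S by blast
    then show ?thesis using low[OF _ _ that] by (intro bdd_belowI2) blast
  qed
  have H_le: "H x \<le> F s + q s x" if "s \<in> S" "x \<in> X" for s x
    unfolding H_def using that by (intro cINF_lower bdd)
  have eq: "H x = F x" if x: "x \<in> S" for x
  proof (rule antisym)
    show "H x \<le> F x" using H_le[of x x] x S refl[of x] by auto
    show "F x \<le> H x" unfolding H_def using S low[OF x _, of _ x] x refl[of x]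
      by (intro cINF_greatest) auto
  qed
  have one: "H x \<le> H y + q x y" if "x \<in> X" "y \<in> X" for x y
  proof -
    have "H x - q x y \<le> H y"
      unfolding H_def[of y]
    proof (rule cINF_greatest[OF S(2)])
      fix s assume s: "s \<in> S"
      then show "H x - q x y \<le> F s + q s y"
        using H_le[OF s that(1)] tri[of s y x] sym[of x y] that S by (smt (verit) in_mono)
    qed
    then show ?thesis by simp
  qed
  have "\<bar>H x - H y\<bar> \<le> q x y" if "x \<in> X" "y \<in> X" for x y
    using one[OF that] one[OF that(2,1)] sym[OF that] by simp
  then show ?thesis using eq by blast
qed

text \<open>Coordinatewise extension costs the factor \<open>DIM('e)\<close>. The nearest-point
  projection onto the subspace \<open>P\<close> is 1-Lipschitz and fixes the prescribed values, so
  the extension can be kept inside \<open>P\<close>.\<close>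

lemma mcshane:
  fixes F :: "'a \<Rightarrow> 'e::euclidean_space" and q :: "'a \<Rightarrow> 'a \<Rightarrow> real"
  assumes S: "S \<subseteq> X"
    and nonneg: "\<And>x y. x \<in> X \<Longrightarrow> y \<in> X \<Longrightarrow> 0 \<le> q x y"
    and refl: "\<And>x. x \<in> X \<Longrightarrow> q x x = 0" and sym: "\<And>x y. x \<in> X \<Longrightarrow> y \<in> X \<Longrightarrow> q x y = q y x"
    and tri: "\<And>x y z. x \<in> X \<Longrightarrow> y \<in> X \<Longrightarrow> z \<in> X \<Longrightarrow> q x z \<le> q x y + q y z"
    and F: "\<And>x y. x \<in> S \<Longrightarrow> y \<in> S \<Longrightarrow> norm (F x - F y) \<le> q x y"
    and P: "subspace P" "F ` S \<subseteq> P"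
  shows "\<exists>H. (\<forall>x. H x \<in> P) \<and> (\<forall>x\<in>S. H x = F x) \<and>
     (\<forall>x\<in>X. \<forall>y\<in>X. norm (H x - H y) \<le> real DIM('e) * q x y)"
\<comment> \<open>McShane's formula is an infimum over \<open>S\<close>, so the empty set needs its
  own extension, the zero map.\<close>
proof (cases "S = {}")
  case True
  then show ?thesis using P(1) nonneg by (intro exI[of _ "\<lambda>_. 0"]) (auto simp: subspace_0)
next
  case False
  have "\<exists>h. (\<forall>x\<in>S. h x = F x \<bullet> b) \<and> (\<forall>x\<in>X. \<forall>y\<in>X. \<bar>h x - h y\<bar> \<le> q x y)" if b: "b \<in> Basis" for b
  proof (rule mcshane_real[OF S False refl sym tri])
    fix x y assume "x \<in> S" "y \<in> S"
    then show "\<bar>F x \<bullet> b - F y \<bullet> b\<bar> \<le> q x y"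
      using F[of x y] Basis_le_norm[OF b, of "F x - F y"] by (simp add: inner_diff_left)
  qed auto
  then obtain h where h: "\<And>b x. b \<in> Basis \<Longrightarrow> x \<in> S \<Longrightarrow> h b x = F x \<bullet> b"
     "\<And>b x y. b \<in> Basis \<Longrightarrow> x \<in> X \<Longrightarrow> y \<in> X \<Longrightarrow> \<bar>h b x - h b y\<bar> \<le> q x y" by metis
  define H0 where "H0 x = (\<Sum>b\<in>Basis. h b x *\<^sub>R b)" for x
  have cl: "closed P" "convex P" "P \<noteq> {}"
    using P(1) by (auto simp: closed_subspace subspace_imp_convex subspace_def)
  have H0S: "H0 x = F x" if "x \<in> S" for x
    using h(1)[OF _ that] by (simp add: H0_def euclidean_representation)
  have H0L: "norm (H0 x - H0 y) \<le> real DIM('e) * q x y" if "x \<in> X" "y \<in> X" for x y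
  proof -
    have "norm (H0 x - H0 y) \<le> (\<Sum>b\<in>Basis. \<bar>(H0 x - H0 y) \<bullet> b\<bar>)" by (rule norm_le_l1)
    also have "\<dots> \<le> (\<Sum>b\<in>(Basis::'e set). q x y)"
      using h(2)[OF _ that] by (intro sum_mono) (simp add: H0_def inner_diff_left)
    finally show ?thesis by simp
  qed
  have "norm (closest_point P (H0 x) - closest_point P (H0 y)) \<le> real DIM('e) * q x y"
    if "x \<in> X" "y \<in> X" for x y
    using closest_point_lipschitz[OF cl(2,1,3), of "H0 x" "H0 y"] H0L[OF that] by (simp add: dist_norm)
  moreover have "closest_point P (H0 x) = F x" if "x \<in> S" for x
    using H0S[OF that] P(2) that by (auto intro: closest_point_self)
  ultimately show ?thesis using closest_point_in_set[OF cl(1,3)]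
    by (intro exI[of _ "\<lambda>x. closest_point P (H0 x)"]) auto
qed

section \<open>The pseudo-distance and the extension as a family of fixed points\<close>

context split_group
begin

definition cost :: "real \<Rightarrow> real \<Rightarrow> 'a \<Rightarrow> real" where
  "cost \<eta> N p = Inf {c. reach \<eta> N p c}"

lemma
  assumes "0 \<le> \<eta>" "0 \<le> N"
  shows cost_le: "reach \<eta> N p c \<Longrightarrow> cost \<eta> N p \<le> c"
    and le_cost: "p \<in> carrier G \<Longrightarrow> (\<And>c. reach \<eta> N p c \<Longrightarrow> a \<le> c) \<Longrightarrow> a \<le> cost \<eta> N p"
proof -
  show "cost \<eta> N p \<le> c" if "reach \<eta> N p c"
    unfolding cost_def using reach_nonneg[of \<eta> N p] that assms
    by (intro cInf_lower bdd_belowI[of _ 0]) auto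
  show "a \<le> cost \<eta> N p" if "p \<in> carrier G" "\<And>c. reach \<eta> N p c \<Longrightarrow> a \<le> c"
    unfolding cost_def using reach_single[OF that(1)] that(2)
    by (intro cInf_greatest) blast+
qed

lemma cost_nonneg: "0 \<le> \<eta> \<Longrightarrow> 0 \<le> N \<Longrightarrow> p \<in> carrier G \<Longrightarrow> 0 \<le> cost \<eta> N p"
  by (rule le_cost) (auto intro: reach_nonneg)

lemma cost_one: "0 \<le> \<eta> \<Longrightarrow> 0 \<le> N \<Longrightarrow> cost \<eta> N \<one> = 0"
  using cost_le[OF _ _ reach_one] cost_nonneg[of \<eta> N \<one>] by fastforce

lemma cost_inv:
  assumes "p \<in> carrier G" shows "cost \<eta> N (inv p) = cost \<eta> N p"
proof -
  have "{c. reach \<eta> N (inv p) c} = {c. reach \<eta> N p c}"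
    using reach_inv[of \<eta> N p] reach_inv[of \<eta> N "inv p"] assms by auto
  then show ?thesis by (simp add: cost_def)
qed

lemma cost_mult:
  assumes nn: "0 \<le> \<eta>" "0 \<le> N" and p: "p \<in> carrier G" and q: "q \<in> carrier G"
  shows "cost \<eta> N (p \<otimes> q) \<le> cost \<eta> N p + cost \<eta> N q"
proof -
  have 1: "cost \<eta> N (p \<otimes> q) - c \<le> cost \<eta> N q" if "reach \<eta> N p c" for c
    using cost_le[OF nn reach_mult[OF that]] by (intro le_cost[OF nn q]) (simp add: algebra_simps)
  have "cost \<eta> N (p \<otimes> q) - cost \<eta> N q \<le> cost \<eta> N p"
    using 1 by (intro le_cost[OF nn p]) (simp add: algebra_simps)
  then show ?thesis by simp
qed

text \<open>The cone condition without cosets: differences of distinct points lie outside the closed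
  cone.\<close>

definition steep :: "real \<Rightarrow> 'a set \<Rightarrow> bool" where
  "steep \<alpha> S \<longleftrightarrow> (\<forall>x\<in>S. \<forall>y\<in>S. x \<noteq> y \<longrightarrow> \<alpha> * nrm (rp (inv x \<otimes> y)) < nrm (lp (inv x \<otimes> y)))"

lemma graph_carrier:
  "B \<subseteq> W \<Longrightarrow> \<psi> \<in> B \<rightarrow> V \<Longrightarrow> intrinsic_graph G B \<psi> \<subseteq> carrier G"
  by (auto simp: intrinsic_graph_def Pi_iff subset_iff)

text \<open>\<open>T\<close> is chosen before \<open>A\<close> and \<phi>, so it depends on \<alpha>
  and the splitting only; this is the source of the uniform bound.\<close>

lemma steep_extension:
  assumes \<alpha>: "0 < \<alpha>"
  shows "\<exists>T>0. \<forall>A \<phi>. A \<subseteq> W \<longrightarrow> \<phi> \<in> A \<rightarrow> V \<longrightarrow> steep \<alpha> (intrinsic_graph G A \<phi>) \<longrightarrow>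
    (\<exists>\<psi>. \<psi> \<in> W \<rightarrow> V \<and> (\<forall>w\<in>A. \<psi> w = \<phi> w) \<and> steep (1 / T) (intrinsic_graph G W \<psi>))"
proof -
  obtain Cv where Cv: "Cv > 0" "\<And>v. v \<in> V \<Longrightarrow> nrm v \<le> Cv * norm (xi v)" using nrm_le_xi by blast
  define D where "D = real DIM('e)"
  have D: "D > 0" by (simp add: D_def)
  \<comment> \<open>Chosen so that, after the loss of the factor \<open>D\<close> in
    \<open>mcshane\<close>, the extension still contracts by 1/2 along cosets of
    \<open>V\<close>.\<close>
  define \<eta> where "\<eta> = 1 / (2 * D * Cv)"
  have \<eta>: "\<eta> > 0" "D * \<eta> * Cv = 1 / 2" using D Cv by (auto simp: \<eta>_def)
  obtain N where N: "N > 0" "\<And>p c. reach \<eta> N p c \<Longrightarrow> c < norm (\<rho> p) \<Longrightarrow> nrm (lp p) \<le> \<alpha> * nrm (rp p)"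
    using cheap_in_cone[OF \<alpha> \<eta>(1)] by blast
  have nn: "0 \<le> \<eta>" "0 \<le> N" using \<eta> N by auto
  define q where "q x y = cost \<eta> N (inv x \<otimes> y)" for x y
  have q_refl: "q x x = 0" if "x \<in> carrier G" for x
    using that cost_one[OF nn] by (simp add: q_def)
  have q_sym: "q x y = q y x" if "x \<in> carrier G" "y \<in> carrier G" for x y
    using that cost_inv[of "inv x \<otimes> y"] by (simp add: q_def inv_mult_group)
  have q_tri: "q x z \<le> q x y + q y z" if "x \<in> carrier G" "y \<in> carrier G" "z \<in> carrier G" for x y z
  proof -
    have "inv x \<otimes> z = (inv x \<otimes> y) \<otimes> (inv y \<otimes> z)"
      using that by (simp add: m_assoc)
    then show ?thesis using cost_mult[OF nn, of "inv x \<otimes> y" "inv y \<otimes> z"] that by (simp add: q_def)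
  qed
  have cost_V: "D * cost \<eta> N v \<le> 1 / 2 * norm (xi v)" if v: "v \<in> V" for v
  proof -
    have "D * cost \<eta> N v \<le> D * (\<eta> * (Cv * norm (xi v)))"
      using cost_le[OF nn reach_single_V[OF v]] Cv(2)[OF v] \<eta> D
      by (intro mult_left_mono) (auto intro: order_trans mult_left_mono)
    also have "\<dots> = (D * \<eta> * Cv) * norm (xi v)" by simp
    finally show ?thesis unfolding \<eta>(2) .
  qed
  have q_nonneg: "0 \<le> q x y" if "x \<in> carrier G" "y \<in> carrier G" for x y
    using that cost_nonneg[OF nn] by (simp add: q_def)
  \<comment> \<open>The product is the slope bound obtained for the new graph; the summand 1 makes
    the inequality strict.\<close>
  define T where "T = 2 * D * N * Cv + 1"
  have T: "T > 0" using D N Cv by (simp add: T_def add_pos_pos)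
  have "\<exists>\<psi>. \<psi> \<in> W \<rightarrow> V \<and> (\<forall>w\<in>A. \<psi> w = \<phi> w) \<and> steep (1 / T) (intrinsic_graph G W \<psi>)"
    if A: "A \<subseteq> W" "\<phi> \<in> A \<rightarrow> V" and st: "steep \<alpha> (intrinsic_graph G A \<phi>)" for A \<phi>
  proof -
    let ?S = "intrinsic_graph G A \<phi>" and ?P = "xi ` V"
    have SG: "?S \<subseteq> carrier G" using graph_carrier[OF A] .
    have lip: "norm (\<rho> x - \<rho> y) \<le> q x y" if xy: "x \<in> ?S" "y \<in> ?S" for x y
    proof (cases "x = y")
      case True
      then show ?thesis using q_refl[of y] xy SG by auto
    next
      case False
      have c: "x \<in> carrier G" "y \<in> carrier G" using xy SG by auto
      have "norm (\<rho> (inv x \<otimes> y)) \<le> q x y"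
        unfolding q_def
      proof (rule le_cost[OF nn])
        fix c assume r: "reach \<eta> N (inv x \<otimes> y) c"
        show "norm (\<rho> (inv x \<otimes> y)) \<le> c"
          \<comment> \<open>A path cheaper than \<open>norm (\<rho> (inv x \<otimes> y))\<close>
            would put \<open>inv x \<otimes> y\<close> into the cone, against steepness.\<close>
          using N(2)[OF r] st xy False by (force simp: steep_def)
      qed (use c in simp)
      then show ?thesis using c by (simp add: rho_mult rho_inv norm_minus_commute)
    qed
    have "\<rho> ` ?S \<subseteq> ?P" using SG parts_in by (auto simp: \<rho>_def)
    from mcshane[of ?S "carrier G" q \<rho> ?P, OF SG q_nonneg q_refl q_sym q_tri lip xi_subspace this]
    obtain H where H: "\<And>x. H x \<in> ?P" "\<And>x. x \<in> ?S \<Longrightarrow> H x = \<rho> x"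
       "\<And>x y. x \<in> carrier G \<Longrightarrow> y \<in> carrier G \<Longrightarrow> norm (H x - H y) \<le> D * q x y"
      unfolding D_def by blast
    \<comment> \<open>As \<open>xi v = \<rho> (w \<otimes> v)\<close>, this is the point of the
      coset where \<open>H\<close> and \<open>\<rho>\<close> agree. Banach's theorem is applied in
      the coordinates \<open>xi\<close>, whose range is complete; this needs \<open>H\<close> to
      have values there.\<close>
    have fixpoint: "\<exists>!v. v \<in> V \<and> H (w \<otimes> v) = xi v" if w: "w \<in> W" for w
    proof -
      define e where "e = inv_into V xi"
      have e: "e (xi v) = v" if "v \<in> V" for v
        unfolding e_def using that xi_inj by simp
      have "\<exists>!z\<in>?P. H (w \<otimes> e z) = z"
      proof (rule Banach_fix[of _ "1/2"])
        show "complete ?P" by (simp add: closed_subspace complete_eq_closed xi_subspace)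
        show "dist (H (w \<otimes> e z)) (H (w \<otimes> e z')) \<le> 1 / 2 * dist z z'" if zz: "z \<in> ?P" "z' \<in> ?P" for z z'
        proof -
          obtain v v' where v: "v \<in> V" "z = xi v" "v' \<in> V" "z' = xi v'" using zz by auto
          have "inv (w \<otimes> v) \<otimes> (w \<otimes> v') = inv v \<otimes> v'"
            using w v by (simp add: inv_mult_group m_assoc)
          then have "norm (H (w \<otimes> v) - H (w \<otimes> v')) \<le> D * cost \<eta> N (inv v \<otimes> v')"
            using H(3)[of "w \<otimes> v" "w \<otimes> v'"] w v by (simp add: q_def)
          also have "\<dots> \<le> 1 / 2 * norm (xi (inv v \<otimes> v'))" using v by (intro cost_V) auto
          also have "\<dots> = 1 / 2 * norm (z - z')" using v by (simp add: xi_mult xi_inv norm_minus_commute)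
          finally show ?thesis using v e by (simp add: dist_norm)
        qed
      qed (use H(1) in auto)
      then obtain z where z: "z \<in> ?P" "H (w \<otimes> e z) = z" "\<And>y. y \<in> ?P \<Longrightarrow> H (w \<otimes> e y) = y \<Longrightarrow> y = z"
        by (elim ex1E) blast
      from z(1) obtain v where v: "v \<in> V" "z = xi v" by auto
      show ?thesis
      proof (rule ex1I[of _ v])
        show "v \<in> V \<and> H (w \<otimes> v) = xi v" using z v e by simp
        show "v' = v" if "v' \<in> V \<and> H (w \<otimes> v') = xi v'" for v'
        proof -
          have "H (w \<otimes> e (xi v')) = xi v'" using that e by simp
          then have "xi v' = xi v" using z(3)[of "xi v'"] that v(2) by blast
          then show ?thesis using inj_onD[OF xi_inj] that v(1) by blast
        qed
      qed
    qed
    define \<psi> where "\<psi> w = (THE v. v \<in> V \<and> H (w \<otimes> v) = xi v)" for w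
    have \<psi>: "\<psi> w \<in> V" "H (w \<otimes> \<psi> w) = xi (\<psi> w)" if "w \<in> W" for w
      using theI'[OF fixpoint[OF that]] by (auto simp: \<psi>_def)
    have ext: "\<psi> w = \<phi> w" if w: "w \<in> A" for w
    proof -
      have "w \<in> W" "\<phi> w \<in> V" "w \<otimes> \<phi> w \<in> ?S" using w A by (auto simp: intrinsic_graph_def)
      then have "\<phi> w \<in> V \<and> H (w \<otimes> \<phi> w) = xi (\<phi> w)" using H(2) by (simp add: \<rho>_def)
      then show ?thesis unfolding \<psi>_def by (rule the1_equality[OF fixpoint[OF \<open>w \<in> W\<close>]])
    qed
    have H\<rho>: "H x = \<rho> x" if "x \<in> intrinsic_graph G W \<psi>" for x
    proof -
      obtain w where w: "w \<in> W" "x = w \<otimes> \<psi> w" using \<open>x \<in> intrinsic_graph G W \<psi>\<close> by (auto simp: intrinsic_graph_def)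
      have "\<rho> x = xi (\<psi> w)" unfolding \<rho>_def w(2) parts(2)[OF w(1) \<psi>(1)[OF w(1)]] ..
      then show ?thesis using \<psi>(2)[OF w(1)] w(2) by simp
    qed
    have "1 / T * nrm (rp (inv x \<otimes> y)) < nrm (lp (inv x \<otimes> y))"
      if xy: "x \<in> intrinsic_graph G W \<psi>" "y \<in> intrinsic_graph G W \<psi>" "x \<noteq> y" for x y
    proof -
      let ?p = "inv x \<otimes> y"
      have "\<psi> \<in> W \<rightarrow> V" using \<psi>(1) by simp
      then have c: "x \<in> carrier G" "y \<in> carrier G"
        using xy graph_carrier[of W \<psi>] by auto
      then have p: "?p \<in> carrier G" by simp
      have l: "lp ?p \<in> W" "rp ?p \<in> V" using parts_in[OF p] by auto
      have xr: "xi (rp ?p) = \<rho> ?p" by (simp add: \<rho>_def)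
      have "norm (\<rho> ?p) = norm (H x - H y)"
        using c by (simp add: H\<rho>[OF xy(1)] H\<rho>[OF xy(2)] rho_mult rho_inv norm_minus_commute)
      also have "\<dots> \<le> D * cost \<eta> N ?p" using H(3)[OF c] by (simp add: q_def)
      also have "\<dots> \<le> D * (cost \<eta> N (lp ?p) + cost \<eta> N (rp ?p))"
        using cost_mult[OF nn, of "lp ?p" "rp ?p"] parts_mult[OF p] l D by simp
      also have "\<dots> = D * cost \<eta> N (lp ?p) + D * cost \<eta> N (rp ?p)" by (simp add: algebra_simps)
      \<comment> \<open>The \<open>W\<close>-part is paid at the full rate; the
        \<open>V\<close>-part amounts to at most half of the left-hand side and is absorbed
        there.\<close>
      also have "\<dots> \<le> D * (N * nrm (lp ?p)) + 1 / 2 * norm (\<rho> ?p)"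
        using cost_V[OF l(2)] cost_le[OF nn reach_single[of "lp ?p"]] l D
        by (intro add_mono mult_left_mono) (auto simp: xr)
      finally have "norm (\<rho> ?p) \<le> 2 * D * N * nrm (lp ?p)" by simp
      then have "Cv * norm (\<rho> ?p) \<le> Cv * (2 * D * N * nrm (lp ?p))"
        using Cv(1) by (intro mult_left_mono) auto
      then have bound: "nrm (rp ?p) \<le> (T - 1) * nrm (lp ?p)"
        using Cv(2)[OF l(2)] by (simp add: xr T_def algebra_simps)
      \<comment> \<open>Strictness needs a nontrivial \<open>W\<close>-part: otherwise the bound
        forces \<open>x = y\<close>.\<close>
      have "nrm (lp ?p) \<noteq> 0"
      proof
        assume z: "nrm (lp ?p) = 0"
        then have "nrm (rp ?p) = 0" using bound nrm_nonneg[of "rp ?p"] l by simp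
        then have "?p = \<one>" using z nrm_eq_0 l parts_mult[OF p] by simp
        then show False using xy(3) mult_inv_cancel(1)[OF c] c by simp
      qed
      then have "nrm (lp ?p) > 0" using nrm_nonneg[of "lp ?p"] l by simp
      then have "nrm (rp ?p) < T * nrm (lp ?p)" using bound by (simp add: algebra_simps)
      then show ?thesis using T by (simp add: field_simps)
    qed
    then show ?thesis using \<psi> ext by (intro exI[of _ \<psi>]) (auto simp: steep_def)
  qed
  then show ?thesis using T by blast
qed

section \<open>Back to cones and Lipschitz constants\<close>

lemma cone_property_iff_steep:
  assumes nrm: "\<And>x. hnorm G d x = nrm x" and B: "B \<subseteq> W" "\<psi> \<in> B \<rightarrow> V" and \<alpha>: "0 \<le> \<alpha>"
  shows "cone_property G W V d B \<psi> \<alpha> \<longleftrightarrow> steep \<alpha> (intrinsic_graph G B \<psi>)"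
proof -
  let ?S = "intrinsic_graph G B \<psi>" and ?C = "intrinsic_cone G W V d \<alpha>"
  have S: "?S \<subseteq> carrier G" using graph_carrier[OF B] .
  have coset: "y \<in> x <# ?C \<longleftrightarrow> nrm (lp (inv x \<otimes> y)) \<le> \<alpha> * nrm (rp (inv x \<otimes> y))"
    if "x \<in> carrier G" "y \<in> carrier G" for x y
  proof -
    have "y \<in> x <# ?C \<longleftrightarrow> inv x \<otimes> y \<in> ?C"
    proof
      assume "y \<in> x <# ?C"
      then obtain h where "h \<in> ?C" "y = x \<otimes> h" by (auto simp: l_coset_def)
      moreover have "h \<in> carrier G" using \<open>h \<in> ?C\<close> by (simp add: intrinsic_cone_def)
      ultimately show "inv x \<otimes> y \<in> ?C" using that by simp
    next
      assume "inv x \<otimes> y \<in> ?C"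
      then show "y \<in> x <# ?C" using mult_inv_cancel(1)[OF that] by (force simp: l_coset_def)
    qed
    then show ?thesis using that by (simp add: intrinsic_cone_def nrm)
  qed
  have self: "x \<in> x <# ?C" if "x \<in> carrier G" for x
    using coset[OF that that] that by simp
  show ?thesis
  proof
    assume c: "cone_property G W V d B \<psi> \<alpha>"
    show "steep \<alpha> ?S"
      unfolding steep_def
    proof (intro ballI impI)
      fix x y assume xy: "x \<in> ?S" "y \<in> ?S" "x \<noteq> y"
      then have "?S \<inter> (x <# ?C) = {x}" using c by (simp add: cone_property_def)
      then have "y \<notin> x <# ?C" using xy(2,3) by (metis Int_iff singletonD)
      then show "\<alpha> * nrm (rp (inv x \<otimes> y)) < nrm (lp (inv x \<otimes> y))"
        using coset[OF subsetD[OF S xy(1)] subsetD[OF S xy(2)]] by simp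
    qed
  next
    assume st: "steep \<alpha> ?S"
    show "cone_property G W V d B \<psi> \<alpha>"
      unfolding cone_property_def
    proof (intro ballI equalityI subsetI)
      fix x y assume x: "x \<in> ?S" and y: "y \<in> ?S \<inter> (x <# ?C)"
      then have c: "x \<in> carrier G" "y \<in> carrier G" using S by auto
      have "nrm (lp (inv x \<otimes> y)) \<le> \<alpha> * nrm (rp (inv x \<otimes> y))" using y coset[OF c] by simp
      then show "y \<in> {x}" using st x y unfolding steep_def by fastforce
    next
      fix x y assume "x \<in> ?S" "y \<in> {x}"
      then show "y \<in> ?S \<inter> (x <# ?C)" using self S by auto
    qed
  qed
qed

lemma steep_mono:
  assumes "steep \<alpha> X" "\<beta> \<le> \<alpha>" "X \<subseteq> carrier G"
  shows "steep \<beta> X"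
  unfolding steep_def
proof (intro ballI impI)
  fix x y assume xy: "x \<in> X" "y \<in> X" "x \<noteq> y"
  then have "rp (inv x \<otimes> y) \<in> V" using assms(3) by (intro parts_in) auto
  then have "\<beta> * nrm (rp (inv x \<otimes> y)) \<le> \<alpha> * nrm (rp (inv x \<otimes> y))"
    using assms(2) nrm_nonneg by (intro mult_right_mono) auto
  also have "\<dots> < nrm (lp (inv x \<otimes> y))" using assms(1) xy by (simp add: steep_def)
  finally show "\<beta> * nrm (rp (inv x \<otimes> y)) < nrm (lp (inv x \<otimes> y))" .
qed

text \<open>
  The extension has to be chosen before the bound \<open>l\<close> is known, so it is constructed from the
  Lipschitz constant of \<open>\<phi>\<close> rounded up to an integer.
\<close>

lemma intrinsic_lipschitz_extension:
  assumes nrm: "\<And>x. hnorm G d x = nrm x"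
  shows "\<exists>u :: real \<Rightarrow> real. (\<forall>l\<ge>0. u l \<ge> 0) \<and>
    (\<forall>A \<phi>. A \<subseteq> W \<and> \<phi> \<in> A \<rightarrow> V \<and> intrinsic_lipschitz G W V d A \<phi> \<longrightarrow>
      (\<exists>\<psi>. \<psi> \<in> W \<rightarrow> V \<and> (\<forall>w\<in>A. \<psi> w = \<phi> w) \<and> intrinsic_lipschitz G W V d W \<psi> \<and>
        (\<forall>l\<ge>0. intrinsic_lipschitz_const G W V d A \<phi> \<le> l \<longrightarrow>
          intrinsic_lipschitz_const G W V d W \<psi> \<le> u l)))"
proof -
  have "\<forall>n::nat. \<exists>T>0. \<forall>A \<phi>. A \<subseteq> W \<longrightarrow> \<phi> \<in> A \<rightarrow> V \<longrightarrow> steep (1 / (real n + 1)) (intrinsic_graph G A \<phi>) \<longrightarrow>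
    (\<exists>\<psi>. \<psi> \<in> W \<rightarrow> V \<and> (\<forall>w\<in>A. \<psi> w = \<phi> w) \<and> steep (1 / T) (intrinsic_graph G W \<psi>))"
    by (intro allI steep_extension) simp
  from choice[OF this] obtain T :: "nat \<Rightarrow> real" where TT: "\<forall>n. 0 < T n \<and>
    (\<forall>A \<phi>. A \<subseteq> W \<longrightarrow> \<phi> \<in> A \<rightarrow> V \<longrightarrow> steep (1 / (real n + 1)) (intrinsic_graph G A \<phi>) \<longrightarrow>
    (\<exists>\<psi>. \<psi> \<in> W \<rightarrow> V \<and> (\<forall>w\<in>A. \<psi> w = \<phi> w) \<and> steep (1 / T n) (intrinsic_graph G W \<psi>)))"
    by (elim exE)
  have T0: "T n > 0" for n using TT by simp
  note T = conjunct2[OF spec[OF TT], rule_format]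
  \<comment> \<open>Summing gives a monotone majorant of \<open>T\<close>, whatever the order of its
    values.\<close>
  define u where "u l = (\<Sum>k\<le>nat \<lceil>l\<rceil>. T k)" for l :: real
  have u0: "u l \<ge> 0" for l unfolding u_def using T0 by (intro sum_nonneg) (simp add: less_imp_le)
  have "\<exists>\<psi>. \<psi> \<in> W \<rightarrow> V \<and> (\<forall>w\<in>A. \<psi> w = \<phi> w) \<and> intrinsic_lipschitz G W V d W \<psi> \<and>
        (\<forall>l\<ge>0. intrinsic_lipschitz_const G W V d A \<phi> \<le> l \<longrightarrow>
          intrinsic_lipschitz_const G W V d W \<psi> \<le> u l)"
    if A: "A \<subseteq> W" "\<phi> \<in> A \<rightarrow> V" and lip: "intrinsic_lipschitz G W V d A \<phi>" for A \<phi>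
  proof -
    define c where "c = intrinsic_lipschitz_const G W V d A \<phi>"
    define n where "n = nat \<lceil>c\<rceil>"
    let ?X = "{1 / \<alpha> | \<alpha>. \<alpha> > 0 \<and> cone_property G W V d A \<phi> \<alpha>}"
    have "?X \<noteq> {}" using lip by (auto simp: intrinsic_lipschitz_def)
    \<comment> \<open>The infimum need not be attained; the slack of 1 yields an actual \<alpha>
      with \<open>1 / \<alpha> < real n + 1\<close>.\<close>
    moreover have "Inf ?X < real n + 1" unfolding n_def c_def intrinsic_lipschitz_const_def by linarith
    ultimately obtain \<alpha> where \<alpha>: "\<alpha> > 0" "cone_property G W V d A \<phi> \<alpha>" "1 / \<alpha> < real n + 1"
      using cInf_lessD[of ?X] by blast
    have "steep \<alpha> (intrinsic_graph G A \<phi>)"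
      using \<alpha> cone_property_iff_steep[of d, OF nrm A] by simp
    moreover have "1 / (real n + 1) \<le> \<alpha>" using \<alpha> by (simp add: field_simps)
    ultimately have "steep (1 / (real n + 1)) (intrinsic_graph G A \<phi>)"
      using steep_mono graph_carrier[OF A] by blast
    from T[OF A this] obtain \<psi> where \<psi>: "\<psi> \<in> W \<rightarrow> V" "\<forall>w\<in>A. \<psi> w = \<phi> w"
      "steep (1 / T n) (intrinsic_graph G W \<psi>)" by blast
    have cp: "cone_property G W V d W \<psi> (1 / T n)"
      using cone_property_iff_steep[of d, OF nrm subset_refl \<psi>(1)] \<psi>(3) T0[of n] by simp
    then have "intrinsic_lipschitz G W V d W \<psi>"
      using T0[of n] by (auto simp: intrinsic_lipschitz_def intro!: exI[of _ "1 / T n"])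
    moreover have "intrinsic_lipschitz_const G W V d W \<psi> \<le> u l" if "c \<le> l" for l
    proof -
      have "intrinsic_lipschitz_const G W V d W \<psi> \<le> T n"
        unfolding intrinsic_lipschitz_const_def
      proof (rule cInf_lower)
        show "T n \<in> {1 / \<alpha> |\<alpha>. 0 < \<alpha> \<and> cone_property G W V d W \<psi> \<alpha>}"
          using cp T0[of n] by (intro CollectI exI[of _ "1 / T n"]) auto
        show "bdd_below {1 / \<alpha> |\<alpha>. 0 < \<alpha> \<and> cone_property G W V d W \<psi> \<alpha>}"
          by (rule bdd_belowI[of _ 0]) auto
      qed
      also have "T n \<le> u l"
      proof -
        have "n \<le> nat \<lceil>l\<rceil>" unfolding n_def using that by (intro nat_mono ceiling_mono)
        then show ?thesis unfolding u_def using T0 by (intro member_le_sum) (auto simp: less_imp_le)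
      qed
      finally show ?thesis .
    qed
    ultimately show ?thesis using \<psi> unfolding c_def by blast
  qed
  then show ?thesis using u0 by (intro exI[of _ u]) blast
qed

end

section \<open>Carnot groups\<close>

text \<open>The model space \<open>S\<close> is a closed subspace, so small closed balls in a chart
  are compact. This makes Baire's theorem available.\<close>

lemma (in smooth_manifold) locally_compact: "locally_compact_space M"
  unfolding locally_compact_space_def
proof
  fix x assume "x \<in> topspace M"
  then obtain c where c: "c \<in> \<A>" "x \<in> fst c" using cover by blast
  obtain U \<phi> where U: "c = (U, \<phi>)" by (cases c)
  have U': "x \<in> U" "openin M U" "openin (top_of_set S) (\<phi> ` U)"
      "homeomorphic_map (subtopology M U) (top_of_set (\<phi> ` U)) \<phi>"
    using charts[OF c(1)] c(2) by (auto simp: is_chart_def U)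
  have sU: "topspace (subtopology M U) = U" using U'(2) openin_subset by fastforce
  obtain g where g: "homeomorphic_maps (subtopology M U) (top_of_set (\<phi> ` U)) \<phi> g"
    using U'(4) homeomorphic_map_maps by blast
  obtain t where t: "t > 0" "cball (\<phi> x) t \<inter> S \<subseteq> \<phi> ` U"
    using U'(1,3) by (auto simp: openin_contains_cball)
  let ?O = "{y \<in> U. \<phi> y \<in> ball (\<phi> x) t}" and ?K = "g ` (cball (\<phi> x) t \<inter> S)"
  have "openin (subtopology M U) {y \<in> topspace (subtopology M U). \<phi> y \<in> \<phi> ` U \<inter> ball (\<phi> x) t}"
    by (rule openin_continuous_map_preimage[OF homeomorphic_imp_continuous_map[OF U'(4)]])
      (simp add: openin_open_Int)
  then have "openin M {y \<in> topspace (subtopology M U). \<phi> y \<in> \<phi> ` U \<inter> ball (\<phi> x) t}"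
    using U'(2) openin_trans_full by blast
  moreover have "{y \<in> topspace (subtopology M U). \<phi> y \<in> \<phi> ` U \<inter> ball (\<phi> x) t} = ?O"
    unfolding sU by auto
  ultimately have 1: "openin M ?O" by simp
  have "compact (cball (\<phi> x) t \<inter> S)"
    using closed_subspace[OF subspace_model] by (simp add: compact_Int_closed)
  then have "compactin (top_of_set (\<phi> ` U)) (cball (\<phi> x) t \<inter> S)"
    using t(2) by (simp add: compactin_subtopology)
  then have "compactin (subtopology M U) ?K"
    using image_compactin g by (auto simp: homeomorphic_maps_def)
  then have 2: "compactin M ?K" by (simp add: compactin_subtopology)
  have "?O \<subseteq> ?K"
  proof
    fix y assume y: "y \<in> ?O"
    then have "g (\<phi> y) = y" using g sU by (auto simp: homeomorphic_maps_def)
    moreover have "\<phi> y \<in> S" using U'(3) y openin_imp_subset by fastforce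
    ultimately show "y \<in> ?K" using y by (metis (no_types, lifting) IntI ball_subset_cball image_eqI in_mono mem_Collect_eq)
  qed
  then show "\<exists>O' K. openin M O' \<and> compactin M K \<and> x \<in> O' \<and> O' \<subseteq> K"
    using 1 2 U'(1) t(1) by (intro exI[of _ ?O] exI[of _ ?K]) auto
qed

lemma (in smooth_manifold) sigma_compact:
  "\<exists>K :: nat \<Rightarrow> 'a set. (\<forall>n. compactin M (K n)) \<and> topspace M = (\<Union>n. K n)"
proof -
  obtain O' K where OK: "\<And>x. x \<in> topspace M \<Longrightarrow> openin M (O' x) \<and> compactin M (K x) \<and> x \<in> O' x \<and> O' x \<subseteq> K x"
    using locally_compact unfolding locally_compact_space_def by metis
  have "Lindelof_space M" by (rule second_countable_imp_Lindelof_space[OF second_countable])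
  moreover have "topspace M \<subseteq> \<Union>(O' ` topspace M)" "\<forall>U\<in>O' ` topspace M. openin M U" using OK by auto
  ultimately obtain \<V> where \<V>: "countable \<V>" "\<V> \<subseteq> O' ` topspace M" "topspace M \<subseteq> \<Union>\<V>"
    unfolding Lindelof_space_alt by meson
  obtain X where X: "countable X" "X \<subseteq> topspace M" "\<V> = O' ` X"
    using countable_subset_image[of \<V> O' "topspace M"] \<V>(1,2) by blast
  have un: "topspace M = (\<Union>x\<in>X. K x)"
  proof
    show "topspace M \<subseteq> (\<Union>x\<in>X. K x)"
    proof
      fix y assume "y \<in> topspace M"
      then obtain x where "x \<in> X" "y \<in> O' x" using \<V>(3) X(3) by auto
      then show "y \<in> (\<Union>x\<in>X. K x)" using OK[of x] X(2) by auto
    qed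
    show "(\<Union>x\<in>X. K x) \<subseteq> topspace M"
    proof (rule UN_least)
      fix x assume "x \<in> X"
      then show "K x \<subseteq> topspace M" using OK[of x] X(2) compactin_subset_topspace[of M "K x"] by auto
    qed
  qed
  show ?thesis
  proof (cases "X = {}")
    case True
    then show ?thesis using un by (intro exI[of _ "\<lambda>_. {}"]) auto
  next
    case False
    then have "range (from_nat_into X) = X" using X(1) by (simp add: range_from_nat_into)
    then have "(\<Union>n. K (from_nat_into X n)) = (\<Union>x\<in>X. K x)"
      by (metis image_image)
    moreover have "compactin M (K (from_nat_into X n))" for n
      using OK[of "from_nat_into X n"] X(2) from_nat_into[OF False, of n] by auto
    ultimately show ?thesis using un by (intro exI[of _ "\<lambda>n. K (from_nat_into X n)"]) simp
  qed
qed

text \<open>In a chart, multiplication is a map \<open>H\<close> with \<open>H (p, b) = b\<close>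
  and \<open>H (a, p) = a\<close>, where \<open>p\<close> is the image of the identity. So its
  partial derivatives at \<open>(p, p)\<close> are identities, and \<open>Ck_on_1_uniform\<close>,
  applied along each factor separately, yields the two one-sided error bounds of
  \<open>chart_mult\<close>.\<close>

lemma lie_group_chart:
  fixes G :: "('a, 'b) monoid_scheme" and S :: "'e::euclidean_space set"
  assumes lie: "lie_group G M S \<A>" and nrm: "normed_group G nrm"
    and nbhd: "\<And>O'. openin M O' \<Longrightarrow> \<one>\<^bsub>G\<^esub> \<in> O' \<Longrightarrow> \<exists>r>0. \<forall>x\<in>carrier G. nrm x < r \<longrightarrow> x \<in> O'"
    and balls: "\<And>r. 0 < r \<Longrightarrow> openin M {x \<in> carrier G. nrm x < r}"
  shows "\<exists>(\<kappa> :: 'a \<Rightarrow> 'e) R. chart_group G nrm \<kappa> R"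
proof -
  interpret lie_group G M S \<A> by fact
  interpret normed_group G nrm by fact
  obtain c where c: "c \<in> \<A>" "\<one>\<^bsub>G\<^esub> \<in> fst c" using cover topspace_eq by force
  obtain U \<phi> where U: "c = (U, \<phi>)" by (cases c)
  have ch: "\<one>\<^bsub>G\<^esub> \<in> U" "openin M U" "openin (top_of_set S) (\<phi> ` U)"
      "homeomorphic_map (subtopology M U) (top_of_set (\<phi> ` U)) \<phi>"
    using charts[OF c(1)] c(2) by (auto simp: is_chart_def U)
  have sU: "topspace (subtopology M U) = U" using ch(2) openin_subset by fastforce
  have UG: "U \<subseteq> carrier G" using ch(2) openin_subset topspace_eq by blast
  have inj: "inj_on \<phi> U" using ch(4) homeomorphic_imp_injective_map sU by metis
  have \<phi>S: "\<phi> x \<in> S" if "x \<in> U" for x using ch(3) that openin_imp_subset by fastforce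
  define p where "p = \<phi> \<one>\<^bsub>G\<^esub>"
  have pS: "p \<in> S" using \<phi>S ch(1) by (simp add: p_def)
  obtain R where R: "R > 0" "\<And>x. x \<in> carrier G \<Longrightarrow> nrm x < R \<Longrightarrow> x \<in> U" using nbhd[OF ch(2,1)] by blast
  have near: "\<exists>t>0. \<forall>a\<in>S. norm (a - p) < t \<longrightarrow> (\<exists>x\<in>U. nrm x < e \<and> \<phi> x = a)" if e: "e > 0" for e
  proof -
    let ?B = "U \<inter> {x \<in> carrier G. nrm x < e}"
    have "openin (subtopology M U) ?B" using balls[OF e] by (metis openin_subtopology_Int2)
    then have "openin (top_of_set (\<phi> ` U)) (\<phi> ` ?B)"
      using homeomorphic_imp_open_map[OF ch(4)] by (simp add: open_map_def)
    then have "openin (top_of_set S) (\<phi> ` ?B)" using ch(3) openin_trans by blast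
    moreover have "p \<in> \<phi> ` ?B" using ch(1) e by (auto simp: p_def)
    ultimately obtain t where t: "t > 0" "ball p t \<inter> S \<subseteq> \<phi> ` ?B"
      unfolding openin_contains_ball by meson
    have "\<exists>x\<in>U. nrm x < e \<and> \<phi> x = a" if "a \<in> S" "norm (a - p) < t" for a
    proof -
      have "a \<in> ball p t \<inter> S" using that by (simp add: dist_norm norm_minus_commute)
      then show ?thesis using t(2) by blast
    qed
    then show ?thesis using t(1) by blast
  qed
  define \<kappa> where "\<kappa> x = \<phi> x - p" for x
  have small: "\<exists>r>0. \<forall>x\<in>carrier G. nrm x < r \<longrightarrow> norm (\<kappa> x) < e" if e: "0 < e" for e
  proof -
    have "openin (subtopology M U) {y \<in> topspace (subtopology M U). \<phi> y \<in> \<phi> ` U \<inter> ball p e}"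
      by (rule openin_continuous_map_preimage[OF homeomorphic_imp_continuous_map[OF ch(4)]])
        (simp add: openin_open_Int)
    then have "openin M {y \<in> topspace (subtopology M U). \<phi> y \<in> \<phi> ` U \<inter> ball p e}"
      using ch(2) openin_trans_full by blast
    from nbhd[OF this] show ?thesis
      unfolding sU using ch(1) e by (auto simp: p_def \<kappa>_def dist_norm norm_minus_commute)
  qed
  define m where "m = (\<lambda>(x, y). x \<otimes>\<^bsub>G\<^esub> y)"
  define H where "H = chart_expr (U \<times> U, map_prod \<phi> \<phi>) c m"
  define D where "D = chart_dom (U \<times> U, map_prod \<phi> \<phi>) c m"
  have "(U \<times> U, map_prod \<phi> \<phi>) \<in> prod_atlas \<A> \<A>"
    using c(1) by (auto simp: prod_atlas_def U)
  then have "Cinf_on (S \<times> S) D H"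
    using smooth_mult c(1) unfolding smooth_map_def D_def H_def m_def by blast
  then have C1: "Ck_on 1 (S \<times> S) D H" by (auto simp: Cinf_on_def)
  have inj2: "inj_on (map_prod \<phi> \<phi>) (U \<times> U)" using inj by (auto simp: inj_on_def)
  have HD: "H (\<phi> x, \<phi> y) = \<phi> (x \<otimes>\<^bsub>G\<^esub> y)" "x \<otimes>\<^bsub>G\<^esub> y \<in> U \<Longrightarrow> (\<phi> x, \<phi> y) \<in> D" if "x \<in> U" "y \<in> U" for x y
  proof -
    have "inv_into (U \<times> U) (map_prod \<phi> \<phi>) (map_prod \<phi> \<phi> (x, y)) = (x, y)"
      using that by (intro inv_into_f_f inj2) auto
    then show "H (\<phi> x, \<phi> y) = \<phi> (x \<otimes>\<^bsub>G\<^esub> y)"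
      by (simp add: H_def chart_expr_def U m_def)
    show "(\<phi> x, \<phi> y) \<in> D" if "x \<otimes>\<^bsub>G\<^esub> y \<in> U"
      using \<open>x \<in> U\<close> \<open>y \<in> U\<close> that by (force simp: D_def chart_dom_def U m_def)
  qed
  have SS: "subspace (S \<times> S)" by (rule subspace_Times[OF subspace_model subspace_model])
  \<comment> \<open>Points this close to \<open>p\<close> come from elements of norm below
    \<open>R / 2\<close>, whose products stay in the chart domain; so \<open>D\<close> contains a
    neighbourhood of \<open>(p, p)\<close>.\<close>
  obtain t2 where t2: "t2 > 0" "\<And>a. a \<in> S \<Longrightarrow> norm (a - p) < t2 \<Longrightarrow> \<exists>x\<in>U. nrm x < R / 2 \<and> \<phi> x = a"
    using near[of "R/2"] R by auto
  have D_nbhd: "z \<in> D" if z: "z \<in> S \<times> S" "norm (z - (p, p)) < t2" for z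
  proof -
    obtain a b where ab: "z = (a, b)" "a \<in> S" "b \<in> S" using z by auto
    have "norm (a - p) < t2" "norm (b - p) < t2"
      using norm_fst_le[of "a - p" "b - p"] norm_snd_le[of "b - p" "a - p"] z ab by auto
    then obtain x y where xy: "x \<in> U" "nrm x < R / 2" "\<phi> x = a" "y \<in> U" "nrm y < R / 2" "\<phi> y = b"
      using t2(2) ab by metis
    have "x \<in> carrier G" "y \<in> carrier G" using xy UG by auto
    then have "x \<otimes>\<^bsub>G\<^esub> y \<in> U" using nrm_mult[of x y] xy(2,5) by (intro R(2)) auto
    then show ?thesis using HD(2)[OF xy(1,4)] xy ab by simp
  qed
  \<comment> \<open>Treats both factors at once: \<open>B\<close> embeds the chart as one of the
    slices through \<open>(p, p)\<close>, on which \<open>H\<close> is the identity, and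
    \<open>A\<close> is the projection to that factor.\<close>
  have der: "((\<lambda>t::real. H ((p, p) + t *\<^sub>R v)) has_vector_derivative A v) (at 0)"
    if A: "\<And>x. x \<in> U \<Longrightarrow> H (B (\<phi> x)) = \<phi> x" and v: "v \<in> L" and
      L: "\<And>v. v \<in> L \<Longrightarrow> A v \<in> S" "\<And>t v. v \<in> L \<Longrightarrow> (p, p) + t *\<^sub>R v = B (p + t *\<^sub>R A v)"
    for A :: "'e \<times> 'e \<Rightarrow> 'e" and B L v
  proof -
    have d: "((\<lambda>t::real. p + t *\<^sub>R A v) has_vector_derivative A v) (at 0)"
      by (auto intro!: derivative_eq_intros)
    show ?thesis
    proof (rule has_vector_derivative_transform_within[OF d])
      show "0 < t2 / (norm (A v) + 1)" using t2(1) by (simp add: add_nonneg_pos)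
      fix t :: real assume "dist t 0 < t2 / (norm (A v) + 1)"
      then have "\<bar>t\<bar> * (norm (A v) + 1) < t2" by (simp add: pos_less_divide_eq add_nonneg_pos)
      then have "norm (t *\<^sub>R A v) < t2" by (simp add: algebra_simps)
      moreover have "p + t *\<^sub>R A v \<in> S"
        using pS L(1)[OF v] subspace_model by (simp add: subspace_add subspace_scale)
      ultimately obtain x where "x \<in> U" "\<phi> x = p + t *\<^sub>R A v" using t2(2)[of "p + t *\<^sub>R A v"] by auto
      then show "p + t *\<^sub>R A v = H ((p, p) + t *\<^sub>R v)" using A[of x] L(2)[OF v] by simp
    qed simp
  qed
  have mult: "\<exists>r>0. \<forall>x\<in>carrier G. \<forall>y\<in>carrier G. nrm x < r \<longrightarrow> nrm y < r \<longrightarrow>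
      norm (\<kappa> (x \<otimes>\<^bsub>G\<^esub> y) - \<kappa> x - \<kappa> y) \<le> e * norm (\<kappa> y) \<and>
      norm (\<kappa> (x \<otimes>\<^bsub>G\<^esub> y) - \<kappa> x - \<kappa> y) \<le> e * norm (\<kappa> x)" if e: "0 < e" for e
  proof -
    have S0: "subspace ({0} \<times> S)" "subspace (S \<times> {0})"
      by (rule subspace_Times[OF subspace_single_0 subspace_model],
          rule subspace_Times[OF subspace_model subspace_single_0])
    have sub: "{0} \<times> S \<subseteq> S \<times> S" "S \<times> {0} \<subseteq> S \<times> S" using subspace_0[OF subspace_model] by auto
    have pp: "(p, p) \<in> S \<times> S" using pS by simp
    have "\<exists>\<tau>>0. \<forall>x\<in>S \<times> S. \<forall>v\<in>{0} \<times> S. norm (x - (p, p)) < \<tau> \<longrightarrow> norm v < \<tau> \<longrightarrow>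
           norm (H (x + v) - H x - snd v) \<le> e * norm v"
    proof (rule Ck_on_1_uniform[OF C1 SS S0(1) sub(1) t2(1) D_nbhd pp bounded_linear_snd _ e])
      show "((\<lambda>t::real. H ((p, p) + t *\<^sub>R v)) has_vector_derivative snd v) (at 0)" if "v \<in> {0} \<times> S" for v
      proof (rule der[where B = "\<lambda>b. (p, b)" and L = "{0} \<times> S"])
        show "H (p, \<phi> x) = \<phi> x" if "x \<in> U" for x using HD(1)[OF ch(1) that] UG that by (auto simp: p_def)
      qed (use that in auto)
    qed auto
    then obtain \<tau>1 where \<tau>1: "\<tau>1 > 0" "\<And>x v. x \<in> S \<times> S \<Longrightarrow> v \<in> {0} \<times> S \<Longrightarrow> norm (x - (p, p)) < \<tau>1 \<Longrightarrow>
        norm v < \<tau>1 \<Longrightarrow> norm (H (x + v) - H x - snd v) \<le> e * norm v" by blast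
    have "\<exists>\<tau>>0. \<forall>x\<in>S \<times> S. \<forall>v\<in>S \<times> {0}. norm (x - (p, p)) < \<tau> \<longrightarrow> norm v < \<tau> \<longrightarrow>
           norm (H (x + v) - H x - fst v) \<le> e * norm v"
    proof (rule Ck_on_1_uniform[OF C1 SS S0(2) sub(2) t2(1) D_nbhd pp bounded_linear_fst _ e])
      show "((\<lambda>t::real. H ((p, p) + t *\<^sub>R v)) has_vector_derivative fst v) (at 0)" if "v \<in> S \<times> {0}" for v
      proof (rule der[where B = "\<lambda>b. (b, p)" and L = "S \<times> {0}"])
        show "H (\<phi> x, p) = \<phi> x" if "x \<in> U" for x using HD(1)[OF that ch(1)] UG that by (auto simp: p_def)
      qed (use that in auto)
    qed auto
    then obtain \<tau>2 where \<tau>2: "\<tau>2 > 0" "\<And>x v. x \<in> S \<times> S \<Longrightarrow> v \<in> S \<times> {0} \<Longrightarrow> norm (x - (p, p)) < \<tau>2 \<Longrightarrow>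
        norm v < \<tau>2 \<Longrightarrow> norm (H (x + v) - H x - fst v) \<le> e * norm v" by blast
    obtain r where r: "r > 0" "\<And>x. x \<in> carrier G \<Longrightarrow> nrm x < r \<Longrightarrow> norm (\<kappa> x) < min \<tau>1 \<tau>2"
      using small[of "min \<tau>1 \<tau>2"] \<tau>1 \<tau>2 by auto
    have "norm (\<kappa> (x \<otimes>\<^bsub>G\<^esub> y) - \<kappa> x - \<kappa> y) \<le> e * norm (\<kappa> y) \<and>
      norm (\<kappa> (x \<otimes>\<^bsub>G\<^esub> y) - \<kappa> x - \<kappa> y) \<le> e * norm (\<kappa> x)"
      if x: "x \<in> carrier G" "nrm x < min r (R / 2)" and y: "y \<in> carrier G" "nrm y < min r (R / 2)" for x y
    proof -
      have xU: "x \<in> U" "y \<in> U" using R x y by auto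
      have kS: "\<kappa> x \<in> S" "\<kappa> y \<in> S"
        using \<phi>S xU pS subspace_diff[OF subspace_model] by (auto simp: \<kappa>_def)
      have nk: "norm (\<kappa> x) < \<tau>1" "norm (\<kappa> y) < \<tau>1" "norm (\<kappa> x) < \<tau>2" "norm (\<kappa> y) < \<tau>2"
        using r(2)[of x] r(2)[of y] x y by auto
      have xx: "\<phi> x = p + \<kappa> x" "\<phi> y = p + \<kappa> y" by (simp_all add: \<kappa>_def)
      have one: "H (\<phi> x, p) = \<phi> x" "H (p, \<phi> y) = \<phi> y"
        using HD(1)[OF xU(1) ch(1)] HD(1)[OF ch(1) xU(2)] x y by (simp_all add: p_def)
      have "norm (H ((\<phi> x, p) + (0, \<kappa> y)) - H (\<phi> x, p) - snd (0::'e, \<kappa> y)) \<le> e * norm (0::'e, \<kappa> y)"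
        by (rule \<tau>1(2)) (use \<phi>S xU pS kS nk in \<open>auto simp: \<kappa>_def[symmetric] norm_Pair\<close>)
      then have 1: "norm (\<phi> (x \<otimes>\<^bsub>G\<^esub> y) - \<phi> x - \<kappa> y) \<le> e * norm (\<kappa> y)"
        using HD(1)[OF xU] one by (simp add: xx(2)[symmetric] norm_Pair)
      have "norm (H ((p, \<phi> y) + (\<kappa> x, 0)) - H (p, \<phi> y) - fst (\<kappa> x, 0::'e)) \<le> e * norm (\<kappa> x, 0::'e)"
        by (rule \<tau>2(2)) (use \<phi>S xU pS kS nk in \<open>auto simp: \<kappa>_def[symmetric] norm_Pair\<close>)
      then have 2: "norm (\<phi> (x \<otimes>\<^bsub>G\<^esub> y) - \<phi> y - \<kappa> x) \<le> e * norm (\<kappa> x)"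
        using HD(1)[OF xU] one by (simp add: xx(1)[symmetric] norm_Pair)
      show ?thesis using 1 2 by (simp add: \<kappa>_def algebra_simps)
    qed
    then show ?thesis using r(1) R(1) by (intro exI[of _ "min r (R / 2)"]) auto
  qed
  have "chart_group G nrm \<kappa> R"
  proof
    show "0 < R" by (rule R)
    show "\<exists>t>0. \<forall>x\<in>carrier G. nrm x < R \<longrightarrow> norm (\<kappa> x) < t \<longrightarrow> nrm x < e" if "0 < e" for e
    proof -
      obtain t where t: "t > 0" "\<And>a. a \<in> S \<Longrightarrow> norm (a - p) < t \<Longrightarrow> \<exists>x\<in>U. nrm x < e \<and> \<phi> x = a"
        using near[OF \<open>0 < e\<close>] by blast
      have "nrm x < e" if x: "x \<in> carrier G" "nrm x < R" "norm (\<kappa> x) < t" for x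
      proof -
        have xU: "x \<in> U" using R x by auto
        obtain y where "y \<in> U" "nrm y < e" "\<phi> y = \<phi> x"
          using t(2)[of "\<phi> x"] \<phi>S[OF xU] x(3) by (auto simp: \<kappa>_def)
        then show ?thesis using inj xU by (auto dest: inj_onD)
      qed
      then show ?thesis using t(1) by blast
    qed
  next
    show "\<exists>r>0. \<forall>x\<in>carrier G. nrm x < r \<longrightarrow> norm (\<kappa> x) < e" if "0 < e" for e
      using that by (rule small)
  next
    show "\<exists>r>0. \<forall>x\<in>carrier G. \<forall>y\<in>carrier G. nrm x < r \<longrightarrow> nrm y < r \<longrightarrow>
      norm (\<kappa> (x \<otimes>\<^bsub>G\<^esub> y) - \<kappa> x - \<kappa> y) \<le> e * norm (\<kappa> y) \<and>
      norm (\<kappa> (x \<otimes>\<^bsub>G\<^esub> y) - \<kappa> x - \<kappa> y) \<le> e * norm (\<kappa> x)" if "0 < e" for e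
      using that by (rule mult)
  qed
  then show ?thesis by blast
qed

text \<open>\<open>X\<close> is read as a sum over the layers with a single nonzero term at index 1,
  where the dilation weight is \<open>r ^ 1\<close>.\<close>

lemma (in carnot_group) first_layer:
  assumes X: "X \<in> \<gg> 1"
  shows "vscale t X \<in> \<gg> 1" and "X \<in> lie_algebra G M S \<A>"
    and "0 < r \<Longrightarrow> \<delta> r (E X) = E (vscale r X)"
proof -
  interpret vector_space vscale by (rule vector_space_vscale)
  note st = stratified[unfolded stratification_def]
  have s: "1 \<le> s" and sub: "\<And>j. j \<in> {1..s} \<Longrightarrow> subspace (\<gg> j)"
    and alg: "lie_algebra G M S \<A> = {\<Sum>j=1..s. X j | X. \<forall>j\<in>{1..s}. X j \<in> \<gg> j}"
    using conjunct1[OF st] conjunct1[OF conjunct2[OF st]] conjunct1[OF conjunct2[OF conjunct2[OF st]]]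
    by simp_all
  show "vscale t X \<in> \<gg> 1" using subspace_scale[OF sub X] s by simp
  define Y where "Y j = (if j = 1 then X else 0)" for j :: nat
  have Y: "\<forall>j\<in>{1..s}. Y j \<in> \<gg> j" using X subspace_0[OF sub] by (auto simp: Y_def)
  have sumY: "(\<Sum>j=1..s. Y j) = X" using s by (simp add: Y_def)
  have "vscale (r ^ j) (Y j) = (if j = 1 then vscale r X else 0)" for r j by (simp add: Y_def)
  then have sumrY: "(\<Sum>j=1..s. vscale (r ^ j) (Y j)) = vscale r X" for r using s by simp
  show "X \<in> lie_algebra G M S \<A>" unfolding alg using Y sumY by blast
  show "\<delta> r (E X) = E (vscale r X)" if "0 < r"
  proof -
    have "\<delta> r (E (\<Sum>j=1..s. Y j)) = E (\<Sum>j=1..s. vscale (r ^ j) (Y j))"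
      using dilations that Y unfolding is_dilations_def by blast
    then show ?thesis by (simp only: sumY sumrY)
  qed
qed

theorem theorem1p5:
  fixes G :: "('a, 'b) monoid_scheme"
    and M :: "'a topology" and S :: "'e::euclidean_space set" and \<A> :: "('a, 'e) chart set"
    and E :: "'a vfield \<Rightarrow> 'a" and s :: nat and \<gg> :: "nat \<Rightarrow> 'a vfield set"
    and \<delta> :: "real \<Rightarrow> 'a \<Rightarrow> 'a" and d :: "'a \<Rightarrow> 'a \<Rightarrow> real"
    and W V :: "'a set"
  assumes carnot: "carnot_group G M S \<A> E s \<gg> \<delta>"
    and distance: "homogeneous_distance G M \<delta> d"
    and splitting: "homogeneous_splitting G M S \<A> \<delta> W V"
    and nontrivial: "V \<noteq> {\<one>\<^bsub>G\<^esub>}"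
    and horizontal: "V \<subseteq> E ` \<gg> 1"
  shows "\<exists>u :: real \<Rightarrow> real. (\<forall>l\<ge>0. u l \<ge> 0) \<and>
    (\<forall>A \<phi>. A \<subseteq> W \<and> \<phi> \<in> A \<rightarrow> V \<and> intrinsic_lipschitz G W V d A \<phi> \<longrightarrow>
      (\<exists>\<psi>. \<psi> \<in> W \<rightarrow> V \<and> (\<forall>w\<in>A. \<psi> w = \<phi> w) \<and> intrinsic_lipschitz G W V d W \<psi> \<and>
        (\<forall>l\<ge>0. intrinsic_lipschitz_const G W V d A \<phi> \<le> l \<longrightarrow>
          intrinsic_lipschitz_const G W V d W \<psi> \<le> u l)))"
proof -
  interpret carnot_group G M S \<A> E s \<gg> \<delta> by fact
  interpret met: Metric_space "carrier G" d
    using distance by (simp add: homogeneous_distance_def)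
  have M: "met.mtopology = M"
    and left: "\<And>g x y. g \<in> carrier G \<Longrightarrow> x \<in> carrier G \<Longrightarrow> y \<in> carrier G \<Longrightarrow> d (g \<otimes>\<^bsub>G\<^esub> x) (g \<otimes>\<^bsub>G\<^esub> y) = d x y"
    and dil: "\<And>r x y. 0 < r \<Longrightarrow> x \<in> carrier G \<Longrightarrow> y \<in> carrier G \<Longrightarrow> d (\<delta> r x) (\<delta> r y) = r * d x y"
    using distance by (auto simp: homogeneous_distance_def)
  define nrm where "nrm = hnorm G d"
  have nrm: "nrm x = d \<one>\<^bsub>G\<^esub> x" for x by (simp add: nrm_def hnorm_def)
  have d: "d x y = nrm (inv\<^bsub>G\<^esub> x \<otimes>\<^bsub>G\<^esub> y)" if "x \<in> carrier G" "y \<in> carrier G" for x y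
    using left[of "inv\<^bsub>G\<^esub> x" x y] that by (simp add: nrm)
  have ng: "normed_group G nrm"
  proof
    fix x y assume x: "x \<in> carrier G" and y: "y \<in> carrier G"
    show "nrm (x \<otimes>\<^bsub>G\<^esub> y) \<le> nrm x + nrm y"
      using met.triangle[of "\<one>\<^bsub>G\<^esub>" x "x \<otimes>\<^bsub>G\<^esub> y"] left[of x "\<one>\<^bsub>G\<^esub>" y] x y by (simp add: nrm)
  next
    fix x assume x: "x \<in> carrier G"
    show "0 \<le> nrm x" by (simp add: nrm met.nonneg)
    show "nrm x = 0 \<longleftrightarrow> x = \<one>\<^bsub>G\<^esub>" using x met.zero[of "\<one>\<^bsub>G\<^esub>" x] by (auto simp: nrm)
    show "nrm (inv\<^bsub>G\<^esub> x) = nrm x"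
      using left[of x "inv\<^bsub>G\<^esub> x" "\<one>\<^bsub>G\<^esub>"] x met.commute[of "inv\<^bsub>G\<^esub> x" "\<one>\<^bsub>G\<^esub>"] by (simp add: nrm)
  qed
  have ball: "met.mball \<one>\<^bsub>G\<^esub> r = {x \<in> carrier G. nrm x < r}" for r
    by (auto simp: nrm)
  obtain \<kappa> :: "'a \<Rightarrow> 'e" and R where chart: "chart_group G nrm \<kappa> R"
  proof -
    have "\<exists>(\<kappa> :: 'a \<Rightarrow> 'e) R. chart_group G nrm \<kappa> R"
    proof (rule lie_group_chart[OF lie_group_axioms ng])
      show "\<exists>r>0. \<forall>x\<in>carrier G. nrm x < r \<longrightarrow> x \<in> O'" if O: "openin M O'" "\<one>\<^bsub>G\<^esub> \<in> O'" for O'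
      proof -
        obtain r where "r > 0" "met.mball \<one>\<^bsub>G\<^esub> r \<subseteq> O'"
          using O unfolding M[symmetric] met.openin_mtopology by blast
        then show ?thesis unfolding ball by blast
      qed
      show "openin M {x \<in> carrier G. nrm x < r}" if "0 < r" for r
        unfolding ball[symmetric] M[symmetric] by (rule met.openin_mball)
    qed
    then show ?thesis using that by blast
  qed
  have W: "homogeneous_subgroup W G M S \<A> \<delta>" and V: "homogeneous_subgroup V G M S \<A> \<delta>"
    and Int: "W \<inter> V = {\<one>\<^bsub>G\<^esub>}" and WV: "carrier G = W <#>\<^bsub>G\<^esub> V"
    using splitting by (auto simp: homogeneous_splitting_def)
  have Wsub: "subgroup W G" and dil_W: "\<And>r w. 0 < r \<Longrightarrow> w \<in> W \<Longrightarrow> \<delta> r w \<in> W"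
    using W by (auto simp: homogeneous_subgroup_def lie_subgroup_def)
  have hom: "\<delta> r \<in> hom G G" if "0 < r" for r
    using dilations that by (auto simp: is_dilations_def iso_def)
  have one: "E (vscale 1 X) = E X" for X by (simp add: vscale_def)
  have exp: "E (vscale (t + t') X) = E (vscale t X) \<otimes>\<^bsub>G\<^esub> E (vscale t' X)" if "X \<in> \<gg> 1" for t t' X
    using exponential first_layer(2)[OF that] by (simp add: is_exponential_def)
  have scale2: "vscale r (vscale t X) = vscale (r * t) X" for r t X
    by (simp add: vscale_def mult.assoc)
  have h: "horizontal_group G nrm \<kappa> R \<delta> V"
  proof (intro horizontal_group.intro chart horizontal_group_axioms.intro)
    show "\<delta> r \<in> hom G G" if "0 < r" for r using hom[OF that] .
    show "nrm (\<delta> r x) = r * nrm x" if "0 < r" "x \<in> carrier G" for r x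
    proof -
      have "\<delta> r \<one>\<^bsub>G\<^esub> = \<one>\<^bsub>G\<^esub>"
        using hom_one[OF hom[OF that(1)] is_group is_group] .
      then show ?thesis using dil[OF that(1) one_closed that(2)] by (simp add: nrm)
    qed
    show "subgroup V G" using V by (simp add: homogeneous_subgroup_def lie_subgroup_def)
    show "\<delta> r v \<in> V" if "0 < r" "v \<in> V" for r v
      using V that by (auto simp: homogeneous_subgroup_def)
    \<comment> \<open>Here horizontality enters: \<open>\<delta> r v = E (vscale r X)\<close>, so
      the laws for dilations on \<open>V\<close> are those of the one-parameter subgroup of
      \<open>X\<close>.\<close>
    fix v assume "v \<in> V"
    then obtain X where X: "X \<in> \<gg> 1" "v = E X" using horizontal by blast
    show "\<delta> r v \<otimes>\<^bsub>G\<^esub> \<delta> t v = \<delta> (r + t) v" if "0 < r" "0 < t" for r t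
      using that X by (simp add: first_layer(3) exp)
    show "\<delta> r (\<delta> t v) = \<delta> (r * t) v" if "0 < r" "0 < t" for r t
      using first_layer(3)[OF first_layer(1)[OF X(1)] that(1)] first_layer(3)[OF X(1) that(2)]
        first_layer(3)[OF X(1) mult_pos_pos[OF that]]
      by (simp add: X(2) scale2)
    show "\<delta> 1 v = v" using X by (simp add: first_layer(3) one)
  qed
  then interpret h: horizontal_group G nrm \<kappa> R \<delta> V .
  \<comment> \<open>The own topology of \<open>W\<close> may be finer than that of \<open>G\<close>,
    but compact sets remain compact under the continuous inclusion, so \<open>W\<close> is a
    countable union of compact subsets of \<open>G\<close>.\<close>
  obtain M' and S' :: "'e set" and \<A>' where lieW: "lie_group (G\<lparr>carrier := W\<rparr>) M' S' \<A>'"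
      and imm: "smooth_immersion M' S' \<A>' M \<A> id"
    using W by (auto simp: homogeneous_subgroup_def lie_subgroup_def)
  interpret W: lie_group "G\<lparr>carrier := W\<rparr>" M' S' \<A>' by (rule lieW)
  obtain K :: "nat \<Rightarrow> 'a set" where K: "\<And>n. compactin M' (K n)" "topspace M' = (\<Union>n. K n)"
    using W.sigma_compact by blast
  have "continuous_map M' M id" using imm by (simp add: smooth_immersion_def smooth_map_def)
  then have K': "compactin M (K n)" for n using image_compactin[OF K(1)] by fastforce
  have WK: "W = (\<Union>n. K n)" using K(2) W.topspace_eq by simp
  have cont: "continuous_map (prod_topology M M) M (\<lambda>(x, y). x \<otimes>\<^bsub>G\<^esub> y)"
    using smooth_mult by (simp add: smooth_map_def)
  have "split_group G nrm \<kappa> R \<delta> V W"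
  proof (intro split_group.intro h split_group_axioms.intro)
    show "\<exists>C>0. \<forall>w\<in>W. \<forall>v\<in>V. nrm v \<le> C * nrm (w \<otimes>\<^bsub>G\<^esub> v)"
      by (rule h.splitting_bound[OF met.Metric_space_axioms M d locally_compact cont Wsub dil_W Int WV K' WK])
  qed (use Wsub dil_W Int WV in auto)
  then interpret split_group G nrm \<kappa> R \<delta> V W .
  show ?thesis by (rule intrinsic_lipschitz_extension) (simp add: nrm_def)
qed

end
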